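(* Let $m\ge 1$. For a vector $v=(a_1,\dots,a_{2m})\in\mathbb{Z}^{2m}$, the following are equivalent. (i) There exists a $\mathbb{Z}$-colored $m$-string virtual tangle diagram $(T,C)$ such that $\partial(T,C)=v$. (ii) Either (a) $v$ is trivial, or (b) $v$ is nontrivial and $\Delta(v)$ is divisible by $2^{k(v)+1}$. Moreover, if $m\ge 2$, such a diagram $T$ can be chosen to satisfy the properties $\mathrm{P}_2$ and $\mathrm{P}_3$ (that is, whenever these conditions hold, there is a $\mathbb{Z}$-colored $m$-string virtual tangle diagram $(T,C)$ with $\partial(T,C)=v$ such that $T$ satisfies both $\mathrm{P}_2$ and $\mathrm{P}_3$), where $\mathrm{P}_2$: $T$ has at most one virtual crossing; $\mathrm{P}_3$: $T$ can be transformed into a trivial tangle diagram by a finite sequence of moves (a) and (b), each of which interchanges adjacent endpoints of strings on the boundary of the $2$-disk containing $T$. If $m=1$, every boundary color vector $v\in\mathbb{Z}^2$ of a $\mathbb{Z}$-colored $1$-string virtual tangle diagram is trivial.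
   Context: An $m$-string virtual tangle diagram $T$ ($m\ge1$) consists of $m$ intervals (strings) properly immersed in a $2$-disk $D^2$ (so there are $2m$ boundary points on $\partial D^2$, and no closed components), whose singularities are only transverse double points. Each double point is designated either a classical crossing (with over/under information) or a virtual crossing (no over/under information). Diagrams are considered up to planar isotopy. An arc of $T$ is a connected component obtained from the diagram by removing all under-crossings (arcs pass through virtual crossings and over-crossings). A $\mathbb{Z}$-coloring of $T$ is a map $C:\{\text{arcs of }T\}\to\mathbb{Z}$ such that at each classical crossing $C(x)+C(z)=2C(y)$, where $x,z$ are the two under-arcs and $y$ is the over-arc; no condition is imposed at virtual crossings. The pair $(T,C)$ is called a $\mathbb{Z}$-colored diagram. Its boundary color vector $\partial(T,C)=(a_1,\dots,a_{2m})\in\mathbb{Z}^{2m}$ lists the colors at the $2m$ boundary points in cyclic order along $\partial D^2$ (the choice of the starting endpoint is arbitrary). A vector $v=(a_1,\dots,a_{2m})\in\mathbb{Z}^{2m}$ is trivial if $a_1=\dots=a_{2m}$, and nontrivial otherwise. $\Delta(v)=\sum_{i=1}^{2m}(-1)^{i-1}a_i$. For nontrivial $v$, $d(v)=\gcd\{a_i-a_j\mid 1\le i\ne j\le 2m\}>0$, and $k(v)\ge0$ is the integer such that $d(v)=2^{k(v)}(2n+1)$ with $n\ge0$ an integer. A trivial tangle diagram is a tangle diagram with no crossings. Moves (a) and (b): if two endpoints adjacent along $\partial D^2$ are such that the strings starting at them cross each other at a crossing immediately next to the boundary (the two initial segments up to this crossing, together with the boundary interval between the endpoints, bound a triangular region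 whose interior is disjoint from $T$), remove this crossing by interchanging the two endpoints along $\partial D^2$. It is move (a) when the crossing is classical (of either over/under type) and move (b) when the crossing is virtual. *)

theory Defs
  imports "HOL-Analysis.Analysis"
begin

section \<open>Virtual tangle diagrams in the closed unit disk\<close>

text \<open>
  The disk is \<^term>\<open>cball (0::complex) 1\<close>, and string \<open>i\<close> (for \<open>i < nstr T\<close>) is the curve
  \<open>strand T i\<close>, of which only the values on \<open>{0..1}\<close> matter.  Over/under information is
  recorded at parameters \<open>(i, t)\<close>, not at points of the disk: \<open>under T\<close> is the set of those
  parameters at which a string passes under.  A double point is a classical crossing if one of its
  two parameters lies in \<open>under T\<close> (that one is the under-strand, the other the over-strand), and a
  virtual crossing if neither does.
\<close>

record vtangle =
  nstr :: nat
  strand :: "nat \<Rightarrow> real \<Rightarrow> complex"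
  under :: "(nat \<times> real) set"

definition params :: "vtangle \<Rightarrow> (nat \<times> real) set" where
  "params T = {..<nstr T} \<times> {0..1}"

definition ends :: "vtangle \<Rightarrow> (nat \<times> real) set" where
  "ends T = {..<nstr T} \<times> {0, 1}"

definition pt :: "vtangle \<Rightarrow> nat \<times> real \<Rightarrow> complex" where
  "pt T x = strand T (fst x) (snd x)"

definition velocity :: "vtangle \<Rightarrow> nat \<times> real \<Rightarrow> complex" where
  "velocity T x = vector_derivative (strand T (fst x)) (at (snd x) within {0..1})"

definition crossing_pair :: "vtangle \<Rightarrow> nat \<times> real \<Rightarrow> nat \<times> real \<Rightarrow> bool" where
  "crossing_pair T x y \<longleftrightarrow> x \<in> params T \<and> y \<in> params T \<and> x \<noteq> y \<and> pt T x = pt T y"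

text \<open>Immersions are of class \<open>C\<^sup>1\<close>; at \<open>0\<close> and \<open>1\<close> the derivatives are one-sided.\<close>

definition immersed_interval :: "(real \<Rightarrow> complex) \<Rightarrow> bool" where
  "immersed_interval g \<longleftrightarrow>
     (\<exists>g'. continuous_on {0..1} g' \<and>
           (\<forall>t\<in>{0..1}. (g has_vector_derivative g' t) (at t within {0..1}) \<and> g' t \<noteq> 0))"

definition tangle_diagram :: "vtangle \<Rightarrow> bool" where
  "tangle_diagram T \<longleftrightarrow>
     \<comment> \<open>the strings are properly immersed in the disk, with \<open>2 * nstr T\<close> boundary points\<close>
     (\<forall>i<nstr T. immersed_interval (strand T i)) \<and>
     (\<forall>x\<in>params T. pt T x \<in> cball 0 1) \<and>
     (\<forall>x\<in>params T. pt T x \<in> sphere 0 1 \<longleftrightarrow> x \<in> ends T) \<and>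
     inj_on (pt T) (ends T) \<and>
     \<comment> \<open>the singularities are finitely many transverse double points\<close>
     finite {(x, y). crossing_pair T x y} \<and>
     (\<forall>x y. crossing_pair T x y \<longrightarrow> span {velocity T x, velocity T y} = UNIV) \<and>
     (\<forall>x y z. crossing_pair T x y \<and> crossing_pair T x z \<longrightarrow> y = z) \<and>
     \<comment> \<open>crossing information\<close>
     (\<forall>x\<in>under T. \<exists>y. crossing_pair T x y) \<and>
     (\<forall>x y. crossing_pair T x y \<longrightarrow> \<not> (x \<in> under T \<and> y \<in> under T))"

definition virtual_crossings :: "vtangle \<Rightarrow> complex set" where
  "virtual_crossings T =
     {pt T x | x y. crossing_pair T x y \<and> x \<notin> under T \<and> y \<notin> under T}"


section \<open>Colorings and boundary color vectors\<close>

text \<open>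
  An arc is represented by its set of parameters.  Cutting the parameter intervals, rather than the
  image in the disk, is what lets arcs pass through virtual crossings without being joined there to
  the other string.
\<close>

definition arcs :: "vtangle \<Rightarrow> (nat \<times> real) set set" where
  "arcs T = {{i} \<times> K | i K. i < nstr T \<and> K \<in> components ({0..1} - {t. (i, t) \<in> under T})}"

text \<open>
  In a crossing where \<open>(i, t)\<close> passes under \<open>y\<close>, the two under-arcs are the arc \<open>X\<close> ending at
  \<open>(i, t)\<close> and the arc \<open>Z\<close> starting there; they exist since \<open>under T\<close> is finite and \<open>0 < t < 1\<close>.
\<close>

definition coloring :: "vtangle \<Rightarrow> ((nat \<times> real) set \<Rightarrow> int) \<Rightarrow> bool" where
  "coloring T C \<longleftrightarrow>
     (\<forall>i t y. crossing_pair T (i, t) y \<and> (i, t) \<in> under T \<longrightarrow>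
        (\<forall>X\<in>arcs T. \<forall>Y\<in>arcs T. \<forall>Z\<in>arcs T.
           (\<exists>\<epsilon>>0. {i} \<times> {t - \<epsilon><..<t} \<subseteq> X) \<and> y \<in> Y \<and> (\<exists>\<epsilon>>0. {i} \<times> {t<..<t + \<epsilon>} \<subseteq> Z) \<longrightarrow>
           C X + C Z = 2 * C Y))"

text \<open>
  The boundary points are listed counterclockwise, \<open>e k\<close> being the \<open>k\<close>-th one.  The starting
  endpoint is arbitrary, so this is a relation rather than a function.
\<close>

definition boundary_vector ::
    "vtangle \<Rightarrow> ((nat \<times> real) set \<Rightarrow> int) \<Rightarrow> int list \<Rightarrow> bool" where
  "boundary_vector T C v \<longleftrightarrow>
     length v = 2 * nstr T \<and>
     (\<exists>(e :: nat \<Rightarrow> nat \<times> real) (\<theta> :: nat \<Rightarrow> real).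
        bij_betw e {..<2 * nstr T} (ends T) \<and>
        (\<forall>k<2 * nstr T. pt T (e k) = cis (\<theta> k)) \<and>
        (\<forall>k l. k < l \<and> l < 2 * nstr T \<longrightarrow> \<theta> k < \<theta> l \<and> \<theta> l < \<theta> k + 2 * pi) \<and>
        (\<forall>k<2 * nstr T. \<exists>A\<in>arcs T. e k \<in> A \<and> v ! k = C A))"

text \<open>\<open>T\<close> is an \<open>m\<close>-string diagram, colored by \<open>C\<close>, and \<open>v\<close> is its boundary color vector.\<close>

definition colored_diagram_with_boundary ::
    "nat \<Rightarrow> vtangle \<Rightarrow> ((nat \<times> real) set \<Rightarrow> int) \<Rightarrow> int list \<Rightarrow> bool" where
  "colored_diagram_with_boundary m T C v \<longleftrightarrow>
     tangle_diagram T \<and> nstr T = m \<and> coloring T C \<and> boundary_vector T C v"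


section \<open>Planar isotopy and the moves (a) and (b)\<close>

text \<open>
  Ambient isotopy of the disk; strings are unordered and unoriented, whence the permutation \<open>\<pi>\<close> and
  the (possibly orientation-reversing) reparametrizations \<open>\<phi> i\<close>.
\<close>

definition planar_isotopic :: "vtangle \<Rightarrow> vtangle \<Rightarrow> bool" where
  "planar_isotopic T T' \<longleftrightarrow>
     nstr T = nstr T' \<and>
     (\<exists>(H :: real \<Rightarrow> complex \<Rightarrow> complex) \<pi> \<phi>.
        continuous_on ({0..1} \<times> cball 0 1) (\<lambda>(s, z). H s z) \<and>
        (\<forall>s\<in>{0..1}. \<exists>G. homeomorphism (cball 0 1) (cball 0 1) (H s) G) \<and>
        (\<forall>z\<in>cball 0 1. H 0 z = z) \<and>
        bij_betw \<pi> {..<nstr T} {..<nstr T} \<and>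
        (\<forall>i<nstr T. \<exists>\<psi>. homeomorphism {0..1::real} {0..1::real} (\<phi> i) \<psi>) \<and>
        (\<forall>i<nstr T. \<forall>t\<in>{0..1}.
           H 1 (pt T (i, t)) = pt T' (\<pi> i, \<phi> i t) \<and>
           ((i, t) \<in> under T \<longleftrightarrow> (\<pi> i, \<phi> i t) \<in> under T')))"

text \<open>The part of a string between its end \<open>(i, a)\<close>, where \<open>a\<close> is \<open>0\<close> or \<open>1\<close>, and \<open>(i, t)\<close>.\<close>

definition end_segment :: "nat \<times> real \<Rightarrow> real \<Rightarrow> (nat \<times> real) set" where
  "end_segment p t = {fst p} \<times> closed_segment (snd p) t"

text \<open>
  The strings starting at the ends \<open>p\<close>, \<open>q\<close> cross at the parameters \<open>s\<close>, \<open>t\<close>, and their segments up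
  to this crossing bound, together with an interval of the circle, a triangular region whose interior
  is disjoint from the diagram.  The region is the image of a standard triangle under the
  embedding \<open>h\<close>.
\<close>

definition boundary_triangle ::
    "vtangle \<Rightarrow> nat \<times> real \<Rightarrow> real \<Rightarrow> nat \<times> real \<Rightarrow> real \<Rightarrow> (complex \<Rightarrow> complex) \<Rightarrow> bool" where
  "boundary_triangle T p s q t h \<longleftrightarrow>
     p \<in> ends T \<and> q \<in> ends T \<and> p \<noteq> q \<and> crossing_pair T (fst p, s) (fst q, t) \<and>
     continuous_on (convex hull {0, 1, \<i>}) h \<and> inj_on h (convex hull {0, 1, \<i>}) \<and>
     h ` (convex hull {0, 1, \<i>}) \<subseteq> cball 0 1 \<and>
     h ` closed_segment 0 \<i> = pt T ` end_segment p s \<and>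
     h ` closed_segment 1 \<i> = pt T ` end_segment q t \<and>
     h ` closed_segment 0 1 \<subseteq> sphere 0 1 \<and>
     h ` interior (convex hull {0, 1, \<i>}) \<inter> pt T ` params T = {}"

text \<open>
  Removal of such a crossing by interchanging the two endpoints.  The change takes place in a disk
  \<open>N\<close> containing the triangle and meeting \<open>T\<close> exactly in two slightly longer segments of the same
  strings, whose only crossing is the one removed.  Outside these segments \<open>T'\<close> agrees with \<open>T\<close>; in
  \<open>N\<close>, it consists of two disjoint embedded curves, which start at the interchanged endpoints.  Such
  curves are unique up to isotopy in \<open>N\<close>, so \<open>T'\<close> is determined up to planar isotopy.
\<close>

definition removes_boundary_crossing ::
    "vtangle \<Rightarrow> nat \<times> real \<Rightarrow> nat \<times> real \<Rightarrow> vtangle \<Rightarrow> bool" where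
  "removes_boundary_crossing T x y T' \<longleftrightarrow>
     (\<exists>p q s t h N s' t'.
        x = (fst p, s) \<and> y = (fst q, t) \<and> boundary_triangle T p s q t h \<and>
        N \<subseteq> cball 0 1 \<and> N homeomorphic cball (0::complex) 1 \<and>
        h ` (convex hull {0, 1, \<i>}) \<subseteq> N \<and>
        s' \<in> {0<..<1} \<and> s \<in> open_segment (snd p) s' \<and>
        t' \<in> {0<..<1} \<and> t \<in> open_segment (snd q) t' \<and>
        end_segment p s' \<inter> end_segment q t' = {} \<and>
        (let S = end_segment p s' \<union> end_segment q t' in
           (\<forall>z\<in>params T. pt T z \<in> N \<longleftrightarrow> z \<in> S) \<and>
           (\<forall>z\<in>S. \<forall>w\<in>S. crossing_pair T z w \<longrightarrow> {z, w} = {x, y}) \<and>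
           nstr T' = nstr T \<and>
           (\<forall>z\<in>params T - S. pt T' z = pt T z) \<and>
           pt T' ` S \<subseteq> N \<and> inj_on (pt T') S \<and>
           pt T' p = pt T q \<and> pt T' q = pt T p \<and>
           under T' = under T - {x, y}))"

definition move_a :: "vtangle \<Rightarrow> vtangle \<Rightarrow> bool" where
  "move_a T T' \<longleftrightarrow>
     (\<exists>x y. removes_boundary_crossing T x y T' \<and> (x \<in> under T \<or> y \<in> under T))"

definition move_b :: "vtangle \<Rightarrow> vtangle \<Rightarrow> bool" where
  "move_b T T' \<longleftrightarrow>
     (\<exists>x y. removes_boundary_crossing T x y T' \<and> x \<notin> under T \<and> y \<notin> under T)"

text \<open>Diagrams are considered up to planar isotopy, so isotopies may be interspersed.\<close>

definition reduction_step :: "vtangle \<Rightarrow> vtangle \<Rightarrow> bool" where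
  "reduction_step T T' \<longleftrightarrow>
     tangle_diagram T \<and> tangle_diagram T' \<and> (planar_isotopic T T' \<or> move_a T T' \<or> move_b T T')"

definition trivial_diagram :: "vtangle \<Rightarrow> bool" where
  "trivial_diagram T \<longleftrightarrow> tangle_diagram T \<and> (\<nexists>x y. crossing_pair T x y)"

definition P2 :: "vtangle \<Rightarrow> bool" where
  "P2 T \<longleftrightarrow> finite (virtual_crossings T) \<and> card (virtual_crossings T) \<le> 1"

definition P3 :: "vtangle \<Rightarrow> bool" where
  "P3 T \<longleftrightarrow> (\<exists>T'. reduction_step\<^sup>*\<^sup>* T T' \<and> trivial_diagram T')"


section \<open>Integer vectors\<close>

text \<open>
  Lists are indexed from \<open>0\<close>: the entry \<open>v ! i\<close> is $a_{i+1}$, and so has sign $(-1)^i$ in \<open>Delta\<close>.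
\<close>

definition trivial_vec :: "int list \<Rightarrow> bool" where
  "trivial_vec v \<longleftrightarrow> (\<forall>i<length v. \<forall>j<length v. v ! i = v ! j)"

definition Delta :: "int list \<Rightarrow> int" where
  "Delta v = (\<Sum>i<length v. (- 1) ^ i * v ! i)"

definition gcd_diff :: "int list \<Rightarrow> int" where
  "gcd_diff v = Gcd {v ! i - v ! j | i j. i < length v \<and> j < length v \<and> i \<noteq> j}"

text \<open>Well-defined for nontrivial \<open>v\<close>, where \<open>gcd_diff v > 0\<close>.\<close>

definition two_exponent :: "int list \<Rightarrow> nat" where
  "two_exponent v = (THE k. \<exists>n::nat. gcd_diff v = 2 ^ k * (2 * int n + 1))"

end

theory Submission
  imports Defs
begin

text \<open>
  Which vectors occur. At a crossing with over-arc \<open>Y\<close> the two under-arcs satisfy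
  \<open>C X + C Z = 2 * C Y\<close>. If all colors are congruent to \<open>a\<close> modulo \<open>g\<close>, this relation gives
  \<open>C X = C Z\<close> modulo \<open>2 * g\<close>, so the two ends of a string agree modulo \<open>2 * g\<close>. As every string
  reaches the boundary, congruences modulo powers of two spread from the boundary to all arcs
  (\<open>all_colors_congruent\<close>). With \<open>g = 2 ^ k\<close>, the strings contribute even multiples of \<open>2 ^ k\<close> to
  the sum of the \<open>a\<^sub>i - a\<close>, and this sum is \<open>Delta v\<close> modulo \<open>2 ^ (k + 1)\<close>
  (\<open>boundary_vector_Delta\<close>).

  Constructing diagrams. Undoing a move (a) at the boundary replaces neighbouring colors \<open>a, b\<close> by
  \<open>b, 2 * b - a\<close> or by \<open>2 * a - b, a\<close>, and undoing a move (b) replaces them by \<open>b, a\<close>. Starting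
  from uncrossed strings between neighbouring ends, whose boundary vectors are \<open>c\<^sub>1, c\<^sub>1, \<dots>, c\<^sub>m, c\<^sub>m\<close>, every vector
  reached in this way belongs to a diagram with property P3. The combinatorial part is to show
  that one transposition suffices. Classical steps keep \<open>Delta\<close>, and they shift a neighbouring pair by
  any multiple of its difference; hence Euclid's algorithm produces two equal neighbours among any
  three consecutive entries, equal neighbours can be moved to the front, and a vector with \<open>Delta v = 0\<close> becomes
  \<open>c\<^sub>1, c\<^sub>1, \<dots>, c\<^sub>m, c\<^sub>m\<close> (\<open>Delta_zero_reduces_to_doubled\<close>). In general, the smallest nonzero
  difference of neighbours in the orbit divides all differences (\<open>minimal_gap_divides\<close>), since
  otherwise a shift would leave a smaller remainder. Condition (ii) says that twice the gcd of the
  differences divides \<open>Delta v\<close>, so next to such a pair a difference of \<open>\<plusminus> Delta v / 2\<close> can be arranged.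
  Interchanging these two entries, which is the single virtual crossing, makes \<open>Delta\<close> vanish
  (\<open>one_swap_kills_Delta\<close>). For \<open>m = 1\<close> condition (ii) only leaves trivial vectors.

  Realizing the steps in the disk. In all diagrams constructed here, a string has polar coordinates
  \<open>(radius t, \<Theta> t / m)\<close> with the same radius function \<open>1 - t + t\<^sup>2\<close>, so that a diagram is given by real
  functions \<open>\<Theta>\<close> of class \<open>C\<^sup>1\<close>, and crossings are coincidences of angles at equal depth. Near the
  boundary the angles are the integers \<open>0, \<dots>, 2 * m - 1\<close>. A crossing is added by letting two
  neighbouring ends exchange their integers within this collar along a \<open>C\<^sup>1\<close> step function
  (\<open>swapped_layered\<close>). The new diagram agrees with the old one outside the collar, so it is
  turned into the old one by the corresponding move itself (\<open>swapped_reduces\<close>).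
\<close>

section \<open>Braid moves on integer vectors\<close>

text \<open>
  The two ways in which the boundary colors change when the ends of two neighbouring strings are
  crossed: the string passing over keeps its color, the other color is reflected in it.
\<close>

inductive braid_step :: "int list \<Rightarrow> int list \<Rightarrow> bool" where
  left_over: "braid_step (u @ a # b # w) (u @ (2 * a - b) # a # w)"
| right_over: "braid_step (u @ a # b # w) (u @ b # (2 * b - a) # w)"

abbreviation braid_equiv :: "int list \<Rightarrow> int list \<Rightarrow> bool"  (infix "\<bowtie>" 50) where
  "braid_equiv \<equiv> braid_step\<^sup>*\<^sup>*"

lemma braid_step_sym: "braid_step v w \<Longrightarrow> braid_step w v"
proof (induction rule: braid_step.induct)
  case (left_over u a b w)
  show ?case using braid_step.right_over[of u "2 * a - b" a w] by simp
next
  case (right_over u a b w)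
  show ?case using braid_step.left_over[of u b "2 * b - a" w] by simp
qed

lemma braid_equiv_sym: "v \<bowtie> w \<Longrightarrow> w \<bowtie> v"
  using sympD[OF symp_rtranclp] braid_step_sym by (metis sympI)

lemma braid_step_context: "braid_step v w \<Longrightarrow> braid_step (x @ v @ y) (x @ w @ y)"
proof (induction rule: braid_step.induct)
  case (left_over u a b w)
  show ?case using braid_step.left_over[of "x @ u" a b "w @ y"] by simp
next
  case (right_over u a b w)
  show ?case using braid_step.right_over[of "x @ u" a b "w @ y"] by simp
qed

lemma braid_equiv_context: "v \<bowtie> w \<Longrightarrow> x @ v @ y \<bowtie> x @ w @ y"
  by (induction rule: rtranclp_induct) (auto intro: rtranclp.rtrancl_into_rtrancl braid_step_context)

lemma braid_step_rev: "braid_step v w \<Longrightarrow> braid_step (rev v) (rev w)"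
proof (induction rule: braid_step.induct)
  case (left_over u a b w)
  show ?case using braid_step.right_over[of "rev w" b a "rev u"] by simp
next
  case (right_over u a b w)
  show ?case using braid_step.left_over[of "rev w" b a "rev u"] by simp
qed

lemma braid_equiv_rev: "v \<bowtie> w \<Longrightarrow> rev v \<bowtie> rev w"
  by (induction rule: rtranclp_induct) (auto intro: rtranclp.rtrancl_into_rtrancl braid_step_rev)

lemma braid_equiv_length: "v \<bowtie> w \<Longrightarrow> length w = length v"
  by (induction rule: rtranclp_induct) (auto elim: braid_step.cases)

text \<open>
  Twisting two neighbouring strings around each other moves both colors along the arithmetic
  progression that they span.
\<close>

lemma braid_equiv_shift:
  "u @ a # b # w \<bowtie> u @ (a + n * (b - a)) # (b + n * (b - a)) # w"
proof (induction n rule: int_induct[where k = 0])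
  case base
  show ?case by simp
next
  case (step1 i)
  have "braid_step (u @ (a + i * (b - a)) # (b + i * (b - a)) # w)
                   (u @ (a + (i + 1) * (b - a)) # (b + (i + 1) * (b - a)) # w)"
    using right_over[of u "a + i * (b - a)" "b + i * (b - a)" w] by (simp add: algebra_simps)
  with step1(2) show ?case by (rule rtranclp.rtrancl_into_rtrancl)
next
  case (step2 i)
  have "braid_step (u @ (a + i * (b - a)) # (b + i * (b - a)) # w)
                   (u @ (a + (i - 1) * (b - a)) # (b + (i - 1) * (b - a)) # w)"
    using left_over[of u "a + i * (b - a)" "b + i * (b - a)" w] by (simp add: algebra_simps)
  with step2(2) show ?case by (rule rtranclp.rtrancl_into_rtrancl)
qed

lemma Delta_Nil [simp]: "Delta [] = 0"
  by (simp add: Delta_def)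

lemma Delta_Cons [simp]: "Delta (a # v) = a - Delta v"
proof -
  have "Delta (a # v) = (\<Sum>i<Suc (length v). (-1) ^ i * (a # v) ! i)"
    by (simp add: Delta_def)
  also have "\<dots> = a + (\<Sum>i<length v. (-1) ^ Suc i * v ! i)"
    by (subst sum.lessThan_Suc_shift) simp
  also have "\<dots> = a - Delta v"
    by (simp add: Delta_def sum_negf)
  finally show ?thesis .
qed

lemma Delta_append: "Delta (u @ w) = Delta u + (-1) ^ length u * Delta w"
  by (induction u) auto

lemma Delta_braid_equiv: "v \<bowtie> w \<Longrightarrow> Delta w = Delta v"
proof (induction rule: rtranclp_induct)
  case (step y z)
  from step(2) have "Delta z = Delta y"
    by cases (auto simp: Delta_append algebra_simps)
  with step show ?case by simp
qed simp

text \<open>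
  The divisors \<open>g\<close> with this property are those of \<open>gcd_diff v\<close>. Unlike \<open>gcd_diff\<close>, the property
  is transported along a braid step by a one-line congruence.
\<close>

definition congruent_entries :: "int \<Rightarrow> int list \<Rightarrow> bool" where
  "congruent_entries g v \<longleftrightarrow> (\<forall>a\<in>set v. \<forall>b\<in>set v. g dvd a - b)"

lemma congruent_entries_braid_step:
  assumes "braid_step v w" "congruent_entries g v"
  shows "congruent_entries g w"
proof -
  have "\<exists>c. \<forall>x\<in>set w. g dvd x - c"
    using assms
  proof cases
    case (left_over u a b w')
    have "g dvd (2 * a - b) - a" 
      using assms(2) left_over by (simp add: congruent_entries_def algebra_simps)
    then show ?thesis
      using assms(2) left_over by (intro exI[of _ a]) (auto simp: congruent_entries_def)
  next
    case (right_over u a b w')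
    have "g dvd (2 * b - a) - b" 
      using assms(2) right_over by (simp add: congruent_entries_def algebra_simps)
    then show ?thesis
      using assms(2) right_over by (intro exI[of _ b]) (auto simp: congruent_entries_def)
  qed
  then obtain c where c: "\<And>x. x \<in> set w \<Longrightarrow> g dvd x - c" by blast
  have "g dvd a - b" if "a \<in> set w" "b \<in> set w" for a b
    using dvd_diff[OF c[OF that(1)] c[OF that(2)]] by simp
  then show ?thesis by (simp add: congruent_entries_def)
qed

lemma congruent_entries_braid_equiv:
  "v \<bowtie> w \<Longrightarrow> congruent_entries g v \<Longrightarrow> congruent_entries g w"
  by (induction rule: rtranclp_induct) (auto intro: congruent_entries_braid_step)

lemma gcd_diff_congruent: "congruent_entries (gcd_diff v) v"
proof -
  have "gcd_diff v dvd v ! i - v ! j" if "i < length v" "j < length v" for i j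
  proof (cases "i = j")
    case False
    then show ?thesis
      unfolding gcd_diff_def using that by (intro Gcd_dvd) blast
  qed simp
  then show ?thesis by (auto simp: congruent_entries_def in_set_conv_nth)
qed

lemma dvd_gcd_diff: "congruent_entries g v \<Longrightarrow> g dvd gcd_diff v"
  unfolding gcd_diff_def by (rule Gcd_greatest) (auto simp: congruent_entries_def)

text \<open>
  The boundary vectors of uncrossed strings that join neighbouring ends.
\<close>

fun doubled :: "int list \<Rightarrow> int list" where
  "doubled [] = []"
| "doubled (c # cs) = c # c # doubled cs"

text \<open>
  Two parallel strands of the same color pass over a third strand without changing its color,
  since reflecting twice in \<open>c\<close> is the identity.
\<close>

lemma equal_pair_to_front: "u @ c # c # w \<bowtie> c # c # u @ w"
proof (induction u arbitrary: w rule: rev_induct)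
  case (snoc a u)
  have "braid_step (u @ a # c # c # w) (u @ c # (2 * c - a) # c # w)"
    by (rule right_over)
  moreover have "braid_step (u @ c # (2 * c - a) # c # w) (u @ c # c # a # w)"
    using right_over[of "u @ [c]" "2 * c - a" c w] by simp
  ultimately show ?case using snoc[of "a # w"] by (simp add: converse_rtranclp_into_rtranclp)
qed simp

text \<open>
  Shifting the first pair changes the second difference by multiples of the first one, and vice
  versa. This is Euclid's algorithm, which stops when one of the differences is \<open>0\<close>.
\<close>

lemma adjacent_equal_in_orbit:
  fixes a b c :: int
  shows "\<exists>u d w'. a # b # c # w \<bowtie> u @ d # d # w'"
proof (induction "nat (\<bar>b - a\<bar> + \<bar>c - b\<bar>)" arbitrary: a b c rule: less_induct)
  case less
  consider "a = b" | "b = c" | "a \<noteq> b" "b \<noteq> c" by blast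
  then show ?case
  proof cases
    case 1
    then have "a # b # c # w \<bowtie> [] @ a # a # (c # w)" by simp
    then show ?thesis by blast
  next
    case 2
    then have "a # b # c # w \<bowtie> [a] @ b # b # w" by simp
    then show ?thesis by blast
  next
    case 3
    \<comment> \<open>the shorter of the two differences is added to or subtracted from the longer one\<close>
    have "\<exists>a' b' c'. a # b # c # w \<bowtie> a' # b' # c' # w \<and>
            \<bar>b' - a'\<bar> + \<bar>c' - b'\<bar> < \<bar>b - a\<bar> + \<bar>c - b\<bar>"
    proof (cases "\<bar>b - a\<bar> \<le> \<bar>c - b\<bar>")
      case True
      show ?thesis
      proof (cases "(0 < b - a) = (0 < c - b)")
        case t: True
        have "a # b # c # w \<bowtie> b # (2 * b - a) # c # w"
          using right_over[of "[]" a b "c # w"] by auto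
        moreover have "\<bar>(2 * b - a) - b\<bar> + \<bar>c - (2 * b - a)\<bar> < \<bar>b - a\<bar> + \<bar>c - b\<bar>"
          using True t 3 by auto
        ultimately show ?thesis by blast
      next
        case t: False
        have "a # b # c # w \<bowtie> (2 * a - b) # a # c # w"
          using left_over[of "[]" a b "c # w"] by auto
        moreover have "\<bar>a - (2 * a - b)\<bar> + \<bar>c - a\<bar> < \<bar>b - a\<bar> + \<bar>c - b\<bar>"
          using True t 3 by auto
        ultimately show ?thesis by blast
      qed
    next
      case False
      show ?thesis
      proof (cases "(0 < b - a) = (0 < c - b)")
        case t: True
        have "a # b # c # w \<bowtie> a # (2 * b - c) # b # w"
          using left_over[of "[a]" b c w] by auto
        moreover have "\<bar>(2 * b - c) - a\<bar> + \<bar>b - (2 * b - c)\<bar> < \<bar>b - a\<bar> + \<bar>c - b\<bar>"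
          using False t 3 by auto
        ultimately show ?thesis by blast
      next
        case t: False
        have "a # b # c # w \<bowtie> a # c # (2 * c - b) # w"
          using right_over[of "[a]" b c w] by auto
        moreover have "\<bar>c - a\<bar> + \<bar>(2 * c - b) - c\<bar> < \<bar>b - a\<bar> + \<bar>c - b\<bar>"
          using False t 3 by auto
        ultimately show ?thesis by blast
      qed
    qed
    then obtain a' b' c' where *: "a # b # c # w \<bowtie> a' # b' # c' # w"
      and lt: "\<bar>b' - a'\<bar> + \<bar>c' - b'\<bar> < \<bar>b - a\<bar> + \<bar>c - b\<bar>" by blast
    have "nat (\<bar>b' - a'\<bar> + \<bar>c' - b'\<bar>) < nat (\<bar>b - a\<bar> + \<bar>c - b\<bar>)"
      using lt by linarith
    from less[OF this] * show ?thesis by (meson rtranclp_trans)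
  qed
qed

text \<open>
  A pair of equal neighbours at the front can be split off without changing \<open>Delta\<close>. What remains in
  the end has two entries, which \<open>Delta v = 0\<close> forces to be equal.
\<close>

lemma Delta_zero_reduces_to_doubled:
  assumes "length v = 2 * m" "Delta v = 0"
  shows "\<exists>cs. length cs = m \<and> v \<bowtie> doubled cs"
  using assms
proof (induction m arbitrary: v)
  case 0
  then show ?case by (intro exI[of _ "[]"]) simp
next
  case (Suc m)
  have "\<exists>u c w. v \<bowtie> u @ c # c # w"
  proof (cases m)
    case 0
    then obtain a b where v: "v = [a, b]"
      using Suc.prems(1) by (auto simp: length_Suc_conv numeral_2_eq_2)
    then have "a = b" using Suc.prems(2) by simp
    then have "v \<bowtie> [] @ a # a # []" using v by simp
    then show ?thesis by blast
  next
    case (Suc k)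
    then obtain a b c w where "v = a # b # c # w"
      using Suc.prems(1) by (auto simp: length_Suc_conv)
    then show ?thesis using adjacent_equal_in_orbit by blast
  qed
  then obtain u c w where "v \<bowtie> u @ c # c # w" by blast
  then have *: "v \<bowtie> c # c # u @ w" using equal_pair_to_front by (meson rtranclp_trans)
  have "length (u @ w) = 2 * m" "Delta (u @ w) = 0"
    using braid_equiv_length[OF *] Delta_braid_equiv[OF *] Suc.prems by auto
  from Suc.IH[OF this] obtain cs where cs: "length cs = m" "u @ w \<bowtie> doubled cs" by blast
  have "c # c # u @ w \<bowtie> doubled (c # cs)"
    using braid_equiv_context[OF cs(2), of "[c, c]" "[]"] by simp
  with * cs(1) show ?case by (intro exI[of _ "c # cs"]) (auto intro: rtranclp_trans)
qed

definition adjacent_gap_bound :: "int list \<Rightarrow> int \<Rightarrow> bool" where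
  "adjacent_gap_bound v g \<longleftrightarrow>
     (\<forall>u a b w. v \<bowtie> u @ a # b # w \<longrightarrow> a \<noteq> b \<longrightarrow> g \<le> \<bar>b - a\<bar>)"

text \<open>
  A shift of the pair \<open>a, b\<close> reduces \<open>c - b\<close>, for the next entry \<open>c\<close>, to its remainder modulo \<open>b - a\<close>.
  Minimality makes this remainder \<open>0\<close>, so another shift yields \<open>c - b = b - a\<close>. The pair \<open>b, c\<close> has the
  minimal difference again, while the entries to the right of \<open>c\<close> are untouched.
\<close>

lemma minimal_gap_divides_right:
  assumes "adjacent_gap_bound v g" "g > 0"
  assumes "v \<bowtie> u @ a # b # w" "\<bar>b - a\<bar> = g"
  shows "\<forall>c\<in>set w. g dvd c - b"
  using assms(3,4)
proof (induction w arbitrary: u a b)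
  case (Cons c w)
  define n where "n = (c - b) div (b - a)"
  have gap: "\<bar>b - a\<bar> = g" by (rule Cons.prems(2))
  have shift: "v \<bowtie> (u @ [a + n * (b - a)]) @ (b + n * (b - a)) # c # w" for n
    using rtranclp_trans[OF Cons.prems(1) braid_equiv_shift[of u a b "c # w" n]] by simp
  have "c - (b + n * (b - a)) = (c - b) mod (b - a)"
    by (simp add: n_def minus_div_mult_eq_mod[symmetric])
  moreover have "\<bar>(c - b) mod (b - a)\<bar> < \<bar>b - a\<bar>"
    using gap assms(2) by (intro abs_mod_less) auto
  ultimately have "c = b + n * (b - a)"
    using assms(1) shift[of n] gap unfolding adjacent_gap_bound_def by fastforce
  then have c: "c = b + n * (b - a)" .
  have "g dvd b - a" using gap by (metis abs_dvd_iff dvd_refl)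
  then have gc: "g dvd c - b" using c by simp
  \<comment> \<open>one multiple less than before, so that the pair ending in \<open>c\<close> has the gap \<open>g\<close>\<close>
  have "v \<bowtie> (u @ [a + (n - 1) * (b - a)]) @ (b + (n - 1) * (b - a)) # c # w"
    by (rule shift)
  moreover have "\<bar>c - (b + (n - 1) * (b - a))\<bar> = g"
    using c gap by (simp add: algebra_simps)
  ultimately have "\<forall>x\<in>set w. g dvd x - c" by (rule Cons.IH)
  then have "g dvd x - b" if "x \<in> set w" for x
    using dvd_add[of g "x - c" "c - b"] gc that by auto
  with gc show ?case by simp
qed simp

lemma adjacent_gap_bound_rev:
  assumes "adjacent_gap_bound v g"
  shows "adjacent_gap_bound (rev v) g"
  unfolding adjacent_gap_bound_def
proof (intro allI impI)
  fix u a b w assume *: "rev v \<bowtie> u @ a # b # w" "a \<noteq> b"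
  from braid_equiv_rev[OF *(1)] have "v \<bowtie> rev w @ b # a # rev u" by simp
  with assms *(2) show "g \<le> \<bar>b - a\<bar>" unfolding adjacent_gap_bound_def
    by (metis abs_minus_commute)
qed

lemma minimal_gap_divides:
  assumes "adjacent_gap_bound v g" "g > 0"
  assumes "v \<bowtie> u @ a # b # w" "\<bar>b - a\<bar> = g"
  shows "congruent_entries g (u @ a # b # w)"
proof -
  have r: "\<forall>c\<in>set w. g dvd c - b" by (rule minimal_gap_divides_right[OF assms])
  have "rev v \<bowtie> rev w @ b # a # rev u" using braid_equiv_rev[OF assms(3)] by simp
  then have l: "\<forall>c\<in>set u. g dvd c - a"
    using minimal_gap_divides_right[OF adjacent_gap_bound_rev[OF assms(1)] assms(2)] assms(4)
    by (metis abs_minus_commute set_rev)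
  have ab: "g dvd b - a" using assms(4) by (metis abs_dvd_iff dvd_refl)
  have *: "g dvd x - b" if "x \<in> set (u @ a # b # w)" for x
  proof -
    have "x \<in> set u \<or> x = a \<or> x = b \<or> x \<in> set w" using that by auto
    moreover have "g dvd x - b" if "x \<in> set u"
      using dvd_diff[OF l[rule_format, OF that] ab] by simp
    moreover have "g dvd a - b" using ab by (simp add: dvd_diff_commute)
    ultimately show ?thesis using r by auto
  qed
  have "g dvd x - y" if "x \<in> set (u @ a # b # w)" "y \<in> set (u @ a # b # w)" for x y
    using dvd_diff[OF *[OF that(1)] *[OF that(2)]] by simp
  then show ?thesis by (simp add: congruent_entries_def)
qed

lemma nontrivial_has_unequal_neighbours:
  assumes "\<not> trivial_vec v"
  shows "\<exists>u a b w. v = u @ a # b # w \<and> a \<noteq> b"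
  using assms
proof (induction v)
  case (Cons x v)
  show ?case
  proof (cases "trivial_vec v")
    case False
    with Cons.IH obtain u a b w where "v = u @ a # b # w" "a \<noteq> b" by blast
    then have "x # v = (x # u) @ a # b # w \<and> a \<noteq> b" by simp
    then show ?thesis by blast
  next
    case True
    then have eq: "\<forall>y\<in>set v. y = hd v"
      by (cases v) (auto simp: trivial_vec_def in_set_conv_nth, force)
    show ?thesis
    proof (cases v)
      case Nil
      with Cons.prems show ?thesis by (simp add: trivial_vec_def)
    next
      case v: (Cons y w)
      have "x \<noteq> y"
      proof
        assume "x = y"
        then have "\<forall>z\<in>set (x # v). z = y" using eq v by auto
        then have "trivial_vec (x # v)" unfolding trivial_vec_def by (metis nth_mem)
        with Cons.prems show False by simp
      qed
      then have "x # v = [] @ x # y # w \<and> x \<noteq> y" using v by simp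
      then show ?thesis by blast
    qed
  qed
qed (simp add: trivial_vec_def)

lemma gcd_gap_in_orbit:
  assumes "\<not> trivial_vec v"
  obtains u a b w where "v \<bowtie> u @ a # b # w" "a \<noteq> b" "congruent_entries (b - a) (u @ a # b # w)"
proof -
  define P where "P g \<longleftrightarrow> (\<exists>u a b w. v \<bowtie> u @ a # b # w \<and> a \<noteq> b \<and> g = nat \<bar>b - a\<bar>)" for g
  have "\<exists>g. P g"
    using nontrivial_has_unequal_neighbours[OF assms] unfolding P_def by blast
  then have "P (LEAST g. P g)" by (rule LeastI_ex)
  then obtain u a b w where *: "v \<bowtie> u @ a # b # w" "a \<noteq> b" "(LEAST g. P g) = nat \<bar>b - a\<bar>"
    unfolding P_def by blast
  have "\<bar>b - a\<bar> \<le> \<bar>b' - a'\<bar>" if "v \<bowtie> u' @ a' # b' # w'" "a' \<noteq> b'" for u' a' b' w'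
  proof -
    have "P (nat \<bar>b' - a'\<bar>)" using that unfolding P_def by blast
    then have "nat \<bar>b - a\<bar> \<le> nat \<bar>b' - a'\<bar>" using *(3) Least_le by metis
    then show ?thesis by linarith
  qed
  then have "adjacent_gap_bound v \<bar>b - a\<bar>" unfolding adjacent_gap_bound_def by blast
  from minimal_gap_divides[OF this _ *(1) refl] *(2)
  have "congruent_entries (b - a) (u @ a # b # w)" by (simp add: congruent_entries_def)
  with * show thesis using that by blast
qed

lemma Delta_swap:
  "Delta (u @ b # a # w) = Delta (u @ a # b # w) - 2 * (-1) ^ length u * (a - b)"
  by (simp add: Delta_append algebra_simps)

text \<open>
  All differences and \<open>Delta v / 2\<close> are multiples of the gap \<open>b - a\<close>. Shifting the pair \<open>a, b\<close> gives the
  difference to a neighbour of the pair any such value. Choose \<open>\<plusminus> Delta v / 2\<close>: interchanging the two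
  entries then changes \<open>Delta\<close> by \<open>- Delta v\<close>.
\<close>

lemma one_swap_kills_Delta:
  assumes "length v \<ge> 3" "\<not> trivial_vec v" "2 * gcd_diff v dvd Delta v"
  obtains u a b w where "v \<bowtie> u @ a # b # w" "Delta (u @ b # a # w) = 0"
proof -
  from gcd_gap_in_orbit[OF assms(2)] obtain u a b w
    where *: "v \<bowtie> u @ a # b # w" "a \<noteq> b" "congruent_entries (b - a) (u @ a # b # w)" .
  have "b - a dvd gcd_diff v"
    by (intro dvd_gcd_diff congruent_entries_braid_equiv[OF braid_equiv_sym[OF *(1)] *(3)])
  then have "2 * (b - a) dvd Delta v" using assms(3) by (meson dvd_trans mult_dvd_mono dvd_refl)
  then obtain e where e: "Delta v = 2 * (b - a) * e" by blast
  show thesis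
  proof (cases w)
    case (Cons c w')
    have "b - a dvd c - b" using *(3) Cons by (simp add: congruent_entries_def)
    then obtain f where f: "c - b = (b - a) * f" by blast
    \<comment> \<open>the sign with which the entry \<open>b\<close> enters \<open>Delta\<close>\<close>
    define s :: int where "s = (-1) ^ Suc (length u)"
    define n where "n = f + s * e"
    have ss: "s * s = 1" by (simp add: s_def power_mult_distrib[symmetric])
    have *: "v \<bowtie> (u @ [a + n * (b - a)]) @ (b + n * (b - a)) # c # w'" (is "_ \<bowtie> ?u @ ?b # ?c # ?w")
      using rtranclp_trans[OF *(1) braid_equiv_shift[of u a b w n]] Cons by simp
    have d: "?b - c = s * e * (b - a)" using f by (simp add: n_def algebra_simps)
    have "Delta (?u @ c # ?b # ?w) = Delta v - 2 * s * (?b - c)"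
      by (subst Delta_swap, subst Delta_braid_equiv[OF *]) (simp add: s_def)
    also have "2 * s * (?b - c) = (s * s) * (2 * (b - a) * e)"
      unfolding d by (simp add: algebra_simps)
    also have "Delta v - \<dots> = 0" using e ss by simp
    finally show thesis using that[OF *] by blast
  next
    case Nil
    have "length u > 0" using braid_equiv_length[OF *(1)] assms(1) Nil by (cases u) auto
    then obtain u' c where u: "u = u' @ [c]" by (metis append_butlast_last_id length_greater_0_conv)
    have "b - a dvd a - c" using *(3) u by (simp add: congruent_entries_def)
    then obtain f where f: "a - c = (b - a) * f" by blast
    define s :: int where "s = (-1) ^ length u'"
    define n where "n = - f - s * e"
    have ss: "s * s = 1" by (simp add: s_def power_mult_distrib[symmetric])
    have *: "v \<bowtie> u' @ c # (a + n * (b - a)) # (b + n * (b - a)) # w" (is "_ \<bowtie> _ @ _ # ?a # ?w")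
      using rtranclp_trans[OF *(1) braid_equiv_shift[of u a b w n]] u by simp
    have d: "c - ?a = s * e * (b - a)" using f by (simp add: n_def algebra_simps)
    have "Delta (u' @ ?a # c # ?w) = Delta v - 2 * s * (c - ?a)"
      by (subst Delta_swap, subst Delta_braid_equiv[OF *]) (simp add: s_def)
    also have "2 * s * (c - ?a) = (s * s) * (2 * (b - a) * e)"
      unfolding d by (simp add: algebra_simps)
    also have "Delta v - \<dots> = 0" using e ss by simp
    finally show thesis using that[OF *] by blast
  qed
qed

lemma odd_part_exponent_unique:
  fixes a b :: int
  assumes "2 ^ k * a = 2 ^ l * b" "odd a" "odd b"
  shows "k = l"
proof -
  have False if "2 ^ k * a = 2 ^ l * b" "odd a" "k < l" for k l and a b :: int
  proof -
    have "(2 :: int) ^ l = 2 ^ k * 2 ^ (l - k)" using that(3) by (simp flip: power_add)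
    then have "a = 2 ^ (l - k) * b" using that(1) by simp
    then show False using that(2,3) by simp
  qed
  from this[OF assms(1,2)] this[OF assms(1)[symmetric] assms(3)] show ?thesis
    using linorder_cases by blast
qed

lemma two_exponent_decomposition:
  assumes "\<not> trivial_vec v"
  obtains n :: nat where "gcd_diff v = 2 ^ two_exponent v * (2 * int n + 1)"
proof -
  obtain i j where ij: "i < length v" "j < length v" "v ! i \<noteq> v ! j"
    using assms by (auto simp: trivial_vec_def)
  have "gcd_diff v dvd v ! i - v ! j"
    unfolding gcd_diff_def using ij by (intro Gcd_dvd) auto
  then have "gcd_diff v \<noteq> 0" using ij(3) by auto
  moreover have "gcd_diff v \<ge> 0" by (simp add: gcd_diff_def)
  ultimately have pos: "gcd_diff v > 0" by simp
  obtain k x where kx: "gcd_diff v = 2 ^ k * x" "odd x"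
  proof (rule multiplicity_decompose'[of "gcd_diff v" 2])
    show "gcd_diff v \<noteq> 0" by fact
  qed (auto intro: that)
  then have "x > 0" using pos by (simp add: zero_less_mult_iff)
  obtain n' where "x = 2 * n' + 1" using kx(2) by (elim oddE)
  moreover have "n' = int (nat n')" using \<open>x > 0\<close> \<open>x = 2 * n' + 1\<close> by simp
  ultimately have dec: "gcd_diff v = 2 ^ k * (2 * int (nat n') + 1)"
    using kx(1) by simp
  have uniq: "l = k" if "\<exists>n::nat. gcd_diff v = 2 ^ l * (2 * int n + 1)" for l
    using that dec odd_part_exponent_unique[of l _ k] by fastforce
  have "\<exists>n::nat. gcd_diff v = 2 ^ two_exponent v * (2 * int n + 1)"
    unfolding two_exponent_def by (rule theI[of _ k]) (use dec uniq in blast)+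
  with that show thesis by blast
qed

lemma congruent_entries_dvd_Delta:
  assumes "congruent_entries g v" "length v = 2 * m"
  shows "g dvd Delta v"
  using assms
proof (induction m arbitrary: v)
  case (Suc m)
  then obtain a b w where v: "v = a # b # w" by (auto simp: length_Suc_conv)
  then have "g dvd a - b" "congruent_entries g w" "length w = 2 * m"
    using Suc.prems by (auto simp: congruent_entries_def)
  then have "g dvd (a - b) + Delta w" using Suc.IH by (intro dvd_add) auto
  then show ?case using v by (simp add: algebra_simps)
qed simp

text \<open>
  The form in which condition (ii) is used. The odd part of \<open>gcd_diff v\<close> always divides \<open>Delta v\<close>,
  which is a sum of \<open>m\<close> differences.
\<close>

lemma two_exponent_dvd_iff:
  assumes "\<not> trivial_vec v" "length v = 2 * m"
  shows "2 ^ (two_exponent v + 1) dvd Delta v \<longleftrightarrow> 2 * gcd_diff v dvd Delta v"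
proof -
  obtain n :: nat where n: "gcd_diff v = 2 ^ two_exponent v * (2 * int n + 1)"
    using two_exponent_decomposition[OF assms(1)] .
  define x where "x = 2 * int n + 1"
  have x: "gcd_diff v = 2 ^ two_exponent v * x" using n by (simp add: x_def)
  have "coprime (2 ^ (two_exponent v + 1)) x" by (simp add: x_def)
  moreover have "x dvd Delta v"
    using congruent_entries_dvd_Delta[OF gcd_diff_congruent assms(2)] x by (metis dvd_mult_right)
  ultimately have "2 ^ (two_exponent v + 1) dvd Delta v \<longleftrightarrow> 2 ^ (two_exponent v + 1) * x dvd Delta v"
    using divides_mult dvd_mult_left by blast
  then show ?thesis using x by (simp add: mult.assoc)
qed

section \<open>Colors along a string\<close>

definition cuts :: "vtangle \<Rightarrow> nat \<Rightarrow> real set" where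
  "cuts T i = {t. (i, t) \<in> under T}"

definition arc_at :: "vtangle \<Rightarrow> nat \<times> real \<Rightarrow> (nat \<times> real) set" where
  "arc_at T x = {fst x} \<times> connected_component_set ({0..1} - cuts T (fst x)) (snd x)"

lemma arc_at_in_arcs:
  assumes "x \<in> params T" "x \<notin> under T"
  shows "arc_at T x \<in> arcs T"
proof -
  have "fst x < nstr T" "snd x \<in> {0..1} - cuts T (fst x)"
    using assms by (auto simp: params_def cuts_def)
  then show ?thesis
    unfolding arcs_def arc_at_def cuts_def[symmetric] by (blast intro: componentsI)
qed

lemma arc_at_self:
  assumes "x \<in> params T" "x \<notin> under T"
  shows "x \<in> arc_at T x"
proof -
  have "snd x \<in> {0..1} - cuts T (fst x)"
    using assms by (auto simp: params_def cuts_def)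
  then show ?thesis
    unfolding arc_at_def by (cases x) (simp add: connected_component_refl_eq)
qed

lemma arc_memD:
  assumes "A \<in> arcs T" "x \<in> A"
  shows "x \<in> params T" "x \<notin> under T" "A = arc_at T x"
proof -
  obtain i K where iK: "A = {i} \<times> K" "i < nstr T" "K \<in> components ({0..1} - cuts T i)"
    using assms(1) by (auto simp: arcs_def cuts_def)
  then have x: "fst x = i" "snd x \<in> K" using assms(2) by auto
  then have "snd x \<in> {0..1} - cuts T i" using in_components_subset[OF iK(3)] by blast
  then show "x \<in> params T" "x \<notin> under T"
    using iK(2) x(1) by (cases x; auto simp: params_def cuts_def)+
  obtain y where "K = connected_component_set ({0..1} - cuts T i) y"
    using iK(3) by (auto simp: components_def)
  then have "K = connected_component_set ({0..1} - cuts T i) (snd x)"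
    using x(2) by (metis connected_component_eq)
  then show "A = arc_at T x" using iK(1) x(1) by (simp add: arc_at_def)
qed

lemma interval_subset_arc:
  assumes "t \<in> K" "connected K" "K \<subseteq> {0..1}" "{i} \<times> K \<inter> under T = {}"
  shows "{i} \<times> K \<subseteq> arc_at T (i, t)"
  using connected_component_maximal[of t K "{0..1} - cuts T i"] assms
  by (auto simp: arc_at_def cuts_def)

lemma arc_at_eq_if_uncut:
  assumes "i < nstr T" "0 \<le> t" "t \<le> t'" "t' \<le> 1" "{i} \<times> {t..t'} \<inter> under T = {}"
  shows "arc_at T (i, t') = arc_at T (i, t)"
proof -
  have "{i} \<times> {t..t'} \<subseteq> arc_at T (i, t)"
    by (rule interval_subset_arc) (use assms in auto)
  then have "(i, t') \<in> arc_at T (i, t)" using assms by auto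
  moreover have "arc_at T (i, t) \<in> arcs T"
    using assms by (intro arc_at_in_arcs) (auto simp: params_def disjoint_iff)
  ultimately show ?thesis using arc_memD(3) by metis
qed

lemma tangle_diagramD:
  assumes "tangle_diagram T"
  shows "\<forall>x\<in>params T. pt T x \<in> sphere 0 1 \<longleftrightarrow> x \<in> ends T"
    and "inj_on (pt T) (ends T)"
    and "finite {(x, y). crossing_pair T x y}"
    and "\<forall>x\<in>under T. \<exists>y. crossing_pair T x y"
    and "\<forall>x y. crossing_pair T x y \<longrightarrow> \<not> (x \<in> under T \<and> y \<in> under T)"
  using assms unfolding tangle_diagram_def by - (elim conjE, assumption)+

lemma crossing_not_end:
  assumes "tangle_diagram T" "crossing_pair T x y"
  shows "x \<notin> ends T"
proof
  assume x: "x \<in> ends T"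
  have p: "x \<in> params T" "y \<in> params T" "x \<noteq> y" "pt T x = pt T y"
    using assms(2) by (auto simp: crossing_pair_def)
  have sph: "\<forall>x\<in>params T. pt T x \<in> sphere 0 1 \<longleftrightarrow> x \<in> ends T" and inj: "inj_on (pt T) (ends T)"
    using tangle_diagramD[OF assms(1)] by blast+
  from x sph p have "y \<in> ends T" by metis
  with x p inj show False by (auto dest: inj_onD)
qed

lemma under_crosses:
  assumes "tangle_diagram T" "x \<in> under T"
  obtains y where "crossing_pair T x y" "y \<notin> under T" "y \<in> params T"
proof -
  obtain y where y: "crossing_pair T x y" using tangle_diagramD(4)[OF assms(1)] assms(2) by blast
  moreover from y have "y \<notin> under T" using tangle_diagramD(5)[OF assms(1)] assms(2) by blast
  moreover from y have "y \<in> params T" by (simp add: crossing_pair_def)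
  ultimately show thesis by (rule that)
qed

lemma under_in_params: "tangle_diagram T \<Longrightarrow> x \<in> under T \<Longrightarrow> x \<in> params T"
  by (erule under_crosses) (auto simp: crossing_pair_def)

lemma end_not_under: "tangle_diagram T \<Longrightarrow> x \<in> ends T \<Longrightarrow> x \<notin> under T"
  by (meson crossing_not_end under_crosses)

lemma finite_cuts:
  assumes "tangle_diagram T"
  shows "finite (cuts T i)"
proof -
  have "finite {(x, y). crossing_pair T x y}" by (rule tangle_diagramD(3)[OF assms])
  then have "finite ((snd \<circ> fst) ` {(x, y). crossing_pair T x y})" by blast
  moreover have "cuts T i \<subseteq> (snd \<circ> fst) ` {(x, y). crossing_pair T x y}"
  proof
    fix t assume "t \<in> cuts T i"
    then obtain y where "crossing_pair T (i, t) y"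
      using tangle_diagramD(4)[OF assms] by (auto simp: cuts_def)
    then show "t \<in> (snd \<circ> fst) ` {(x, y). crossing_pair T x y}"
      by (intro image_eqI[of _ _ "((i, t), y)"]) auto
  qed
  ultimately show ?thesis by (rule finite_subset[rotated])
qed

text \<open>
  Induction on the number of under-crossings before \<open>t\<close>; the coloring condition is applied at the last
  one, at \<open>s\<close>. The point \<open>u\<close> lies between \<open>s\<close> and the preceding under-crossing (or the start of the
  string), hence on the arc that ends at \<open>s\<close>.
\<close>

lemma colors_congruent_along_string:
  assumes T: "tangle_diagram T" and C: "coloring T C"
    and g: "\<And>A. A \<in> arcs T \<Longrightarrow> g dvd C A - a"
    and i: "i < nstr T" and t: "t \<in> {0..1}" "t \<notin> cuts T i"
  shows "2 * g dvd C (arc_at T (i, t)) - C (arc_at T (i, 0))"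
  using t
proof (induction "card {s \<in> cuts T i. s < t}" arbitrary: t rule: less_induct)
  case less
  define S where "S = {s \<in> cuts T i. s < t}"
  have fin: "finite S" using finite_cuts[OF T] by (simp add: S_def)
  show ?case
  proof (cases "S = {}")
    case True
    have "arc_at T (i, t) = arc_at T (i, 0)"
    proof (rule arc_at_eq_if_uncut[OF i])
      show "{i} \<times> {0..t} \<inter> under T = {}"
      proof (rule ccontr)
        assume "{i} \<times> {0..t} \<inter> under T \<noteq> {}"
        then obtain s where "s \<in> cuts T i" "s \<le> t" by (auto simp: cuts_def)
        moreover from this have "s \<noteq> t" using less.prems by auto
        ultimately show False using True by (auto simp: S_def)
      qed
    qed (use less.prems in auto)
    then show ?thesis by simp
  next
    case False
    define s where "s = Max S"
    have s: "s \<in> cuts T i" "s < t" using Max_in[OF fin False] by (auto simp: s_def S_def)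
    have s_max: "r \<le> s" if "r \<in> cuts T i" "r < t" for r
      using that fin by (auto simp: s_def S_def)
    have su: "(i, s) \<in> under T" using s(1) by (simp add: cuts_def)
    have s01: "0 < s" "s < 1"
    proof -
      have "(i, s) \<notin> ends T" using end_not_under[OF T] su by blast
      moreover have "(i, s) \<in> params T" by (rule under_in_params[OF T su])
      ultimately show "0 < s" "s < 1" by (auto simp: ends_def params_def)
    qed
    have fin': "finite (insert 0 {r \<in> cuts T i. r < s})" using finite_cuts[OF T] by simp
    define r where "r = Max (insert 0 {r \<in> cuts T i. r < s})"
    have r: "r < s" "0 \<le> r"
      using Max_in[OF fin'] s01 Max_ge[OF fin', of 0] by (auto simp: r_def)
    have r_max: "q \<le> r" if "q \<in> cuts T i" "q < s" for q
      using Max_ge[OF fin', of q] that by (auto simp: r_def)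
    define u where "u = (r + s) / 2"
    have u: "r < u" "u < s" "0 \<le> u" "u \<le> 1" using r s01 by (auto simp: u_def)
    have left: "{i} \<times> {u..<s} \<inter> under T = {}"
      using r_max u(1) by (force simp: cuts_def)
    have right: "{i} \<times> {s<..t} \<inter> under T = {}"
      using s_max less.prems(2) by (force simp: cuts_def)
    have "u \<notin> cuts T i" using left u by (auto simp: cuts_def disjoint_iff)
    have "card {q \<in> cuts T i. q < u} < card S"
    proof (rule psubset_card_mono[OF fin])
      have "{q \<in> cuts T i. q < u} \<subseteq> S" using s u by (auto simp: S_def)
      moreover have "s \<in> S" "s \<notin> {q \<in> cuts T i. q < u}" using s u by (auto simp: S_def)
      ultimately show "{q \<in> cuts T i. q < u} \<subset> S" by blast
    qed
    then have IH: "2 * g dvd C (arc_at T (i, u)) - C (arc_at T (i, 0))"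
      using less.hyps[of u] u \<open>u \<notin> cuts T i\<close> by (simp add: S_def)
    obtain y where y: "crossing_pair T (i, s) y" "y \<notin> under T" "y \<in> params T"
      using under_crosses[OF T su] .
    define X Y Z where "X = arc_at T (i, u)" and "Y = arc_at T y" and "Z = arc_at T (i, t)"
    have arcs: "X \<in> arcs T" "Y \<in> arcs T" "Z \<in> arcs T"
      using \<open>u \<notin> cuts T i\<close> less.prems i u y
      by (auto simp: X_def Y_def Z_def params_def cuts_def intro!: arc_at_in_arcs)
    have "{i} \<times> {u..<s} \<subseteq> X" unfolding X_def
      by (rule interval_subset_arc) (use left u s01 in auto)
    then have "{i} \<times> {s - (s - u)<..<s} \<subseteq> X" by auto
    then have "\<exists>\<epsilon>>0. {i} \<times> {s - \<epsilon><..<s} \<subseteq> X" using u by (meson diff_gt_0_iff_gt)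
    moreover have "{i} \<times> {s<..t} \<subseteq> Z" unfolding Z_def
      by (rule interval_subset_arc) (use right s s01 less.prems in auto)
    then have "{i} \<times> {s<..<s + (t - s)} \<subseteq> Z" by auto
    then have "\<exists>\<epsilon>>0. {i} \<times> {s<..<s + \<epsilon>} \<subseteq> Z" using s by (meson diff_gt_0_iff_gt)
    moreover have "y \<in> Y" unfolding Y_def by (rule arc_at_self[OF y(3,2)])
    ultimately have col: "C X + C Z = 2 * C Y"
      using C[unfolded coloring_def, rule_format, of i s y X Y Z] y(1) su arcs by blast
    \<comment> \<open>modulo \<open>2 * g\<close>, the crossing relation says \<open>C Z - a = - (C X - a) = C X - a\<close>\<close>
    have "C Z - C X = 2 * ((C Y - a) - (C X - a))" using col by simp
    moreover have "g dvd (C Y - a) - (C X - a)" using g[OF arcs(2)] g[OF arcs(1)] by (rule dvd_diff)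
    ultimately have "2 * g dvd C Z - C X" by (simp only: mult_dvd_mono dvd_refl)
    from dvd_add[OF this IH] show ?thesis by (simp add: X_def Z_def)
  qed
qed

text \<open>
  Every arc lies on a string with an end on the boundary. So if the end arcs are congruent modulo
  \<open>2 ^ Suc k\<close>, then the congruence modulo \<open>2 ^ k\<close> of all arcs can be improved by one factor \<open>2\<close>.
\<close>

lemma all_colors_congruent:
  assumes T: "tangle_diagram T" and C: "coloring T C"
    and e: "\<And>x. x \<in> ends T \<Longrightarrow> 2 ^ k dvd C (arc_at T x) - a"
    and A: "A \<in> arcs T"
  shows "2 ^ k dvd C A - a"
  using e A
proof (induction k arbitrary: A)
  case (Suc k)
  have IH: "2 ^ k dvd C B - a" if "B \<in> arcs T" for B
  proof (rule Suc.IH[OF _ that])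
    show "2 ^ k dvd C (arc_at T x) - a" if "x \<in> ends T" for x
      using Suc.prems(1)[OF that] by (metis dvd_mult_right power_Suc)
  qed
  obtain i K where iK: "A = {i} \<times> K" "i < nstr T" "K \<in> components ({0..1} - cuts T i)"
    using Suc.prems(2) by (auto simp: arcs_def cuts_def)
  then obtain t where "t \<in> K" using in_components_nonempty by blast
  then have m: "(i, t) \<in> A" using iK by simp
  note memD = arc_memD[OF Suc.prems(2) m]
  have "2 * 2 ^ k dvd C (arc_at T (i, t)) - C (arc_at T (i, 0))"
    by (rule colors_congruent_along_string[OF T C IH iK(2)])
       (use memD in \<open>auto simp: params_def cuts_def\<close>)
  moreover have "2 ^ Suc k dvd C (arc_at T (i, 0)) - a"
    by (rule Suc.prems(1)) (use iK in \<open>auto simp: ends_def\<close>)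
  ultimately have "2 ^ Suc k dvd (C (arc_at T (i, t)) - C (arc_at T (i, 0))) + (C (arc_at T (i, 0)) - a)"
    by (intro dvd_add) simp_all
  then show ?case using memD by simp
qed simp

text \<open>
  Translating all entries by \<open>a\<close> preserves an alternating sum of even length, and changing signs
  changes a sum of multiples of \<open>g\<close> by a multiple of \<open>2 * g\<close>.
\<close>

lemma Delta_cong_sum:
  assumes "\<And>x. x \<in> set v \<Longrightarrow> g dvd x - a" "length v = 2 * m"
  shows "2 * g dvd Delta v - (\<Sum>l<2 * m. v ! l - a)"
proof -
  have "Delta v = (\<Sum>l<2 * m. (-1) ^ l * (v ! l - a))"
  proof -
    have "(\<Sum>l<2 * m. (-1) ^ l * a) = 0" by (induction m) auto
    then show ?thesis by (simp add: Delta_def assms(2) right_diff_distrib sum_subtractf)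
  qed
  then have "Delta v - (\<Sum>l<2 * m. v ! l - a) = (\<Sum>l<2 * m. ((-1) ^ l - 1) * (v ! l - a))"
    by (simp add: sum_subtractf[symmetric] left_diff_distrib)
  also have "2 * g dvd \<dots>"
  proof (rule dvd_sum)
    fix l assume "l \<in> {..<2 * m}"
    then have "g dvd v ! l - a" using assms by simp
    moreover have "2 dvd (-1 :: int) ^ l - 1" by simp
    ultimately show "2 * g dvd ((-1) ^ l - 1) * (v ! l - a)" by (rule mult_dvd_mono[rotated])
  qed
  finally show ?thesis .
qed

text \<open>
  Grouping the boundary points by strings, each string contributes \<open>2 * D (i, 0)\<close> modulo
  \<open>2 ^ (k + 1)\<close>, where \<open>2 ^ k\<close> divides \<open>D (i, 0)\<close>.
\<close>

lemma boundary_vector_Delta: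
  assumes "colored_diagram_with_boundary m T C v" "\<not> trivial_vec v"
  shows "2 ^ (two_exponent v + 1) dvd Delta v"
proof -
  have T: "tangle_diagram T" and m: "nstr T = m" and C: "coloring T C"
    and B: "boundary_vector T C v"
    using assms(1) by (auto simp: colored_diagram_with_boundary_def)
  from B obtain e where len: "length v = 2 * m" and e: "bij_betw e {..<2 * m} (ends T)"
    and col: "\<forall>k<2 * m. \<exists>A\<in>arcs T. e k \<in> A \<and> v ! k = C A"
    unfolding boundary_vector_def m by blast
  have col: "v ! k = C (arc_at T (e k))" if "k < 2 * m" for k
    using col that arc_memD(3) by metis
  define k a where "k = two_exponent v" and "a = v ! 0"
  have "2 ^ k dvd gcd_diff v" 
    using two_exponent_decomposition[OF assms(2)] k_def by (metis dvd_triv_left)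
  then have dv: "2 ^ k dvd x - a" if "x \<in> set v" for x
    using that gcd_diff_congruent[of v] len unfolding congruent_entries_def a_def
    by (metis dvd_trans length_pos_if_in_set nth_mem)
  have "2 ^ k dvd C A - a" if "A \<in> arcs T" for A
  proof (rule all_colors_congruent[OF T C _ that])
    fix x assume "x \<in> ends T"
    then obtain l where l: "l < 2 * m" "x = e l" using e by (auto simp: bij_betw_def)
    then show "2 ^ k dvd C (arc_at T x) - a" using col[OF l(1)] dv[of "v ! l"] len nth_mem[of l v] by simp
  qed
  note along = colors_congruent_along_string[OF T C this]
  define D where "D x = C (arc_at T x) - a" for x
  have "(\<Sum>l<2 * m. v ! l - a) = (\<Sum>l<2 * m. D (e l))"
    using col by (simp add: D_def)
  also have "\<dots> = sum D (ends T)" by (rule sum.reindex_bij_betw[OF e])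
  also have "\<dots> = (\<Sum>i<m. D (i, 0) + D (i, 1))"
  proof -
    have "sum D (ends T) = (\<Sum>i<m. \<Sum>s\<in>{0, 1}. D (i, s))"
      unfolding ends_def m by (subst sum.cartesian_product) simp
    then show ?thesis by simp
  qed
  also have "2 * 2 ^ k dvd \<dots>"
  proof (rule dvd_sum)
    fix i assume "i \<in> {..<m}"
    then have i: "i < nstr T" using m by simp
    have "(i, 1) \<notin> under T" using end_not_under[OF T] i by (auto simp: ends_def)
    then have "2 * 2 ^ k dvd D (i, 1) - D (i, 0)"
      using along[OF _ i, of 1] by (simp add: D_def cuts_def)
    moreover have "2 ^ k dvd D (i, 0)"
    proof -
      have "(i, 0) \<in> ends T" using i by (auto simp: ends_def)
      then obtain l where l: "l < 2 * m" "(i, 0) = e l" using e by (auto simp: bij_betw_def)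
      then show ?thesis using col[OF l(1)] dv[of "v ! l"] len nth_mem[of l v] by (simp add: D_def)
    qed
    then have "2 * 2 ^ k dvd 2 * D (i, 0)" by simp
    ultimately have "2 * 2 ^ k dvd (D (i, 1) - D (i, 0)) + 2 * D (i, 0)" by (rule dvd_add)
    then show "2 * 2 ^ k dvd D (i, 0) + D (i, 1)" by (simp add: algebra_simps)
  qed
  finally have "2 * 2 ^ k dvd (\<Sum>l<2 * m. v ! l - a)" .
  from dvd_add[OF Delta_cong_sum[OF dv len] this] show ?thesis by (simp add: k_def)
qed

section \<open>A step function of class \<open>C\<^sup>1\<close>\<close>

text \<open>
  A building block of class \<open>C\<^sup>1\<close>, unlike \<open>max 0\<close> itself.
\<close>

definition ramp :: "real \<Rightarrow> real" where
  "ramp x = (max 0 x)\<^sup>2"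

lemma ramp_deriv: "(ramp has_real_derivative 2 * max 0 x) (at x)"
proof -
  consider "x < 0" | "x = 0" | "x > 0" by linarith
  then show ?thesis
  proof cases
    case 1
    have "((\<lambda>x. 0) has_real_derivative 0) (at x)" by simp
    then have "(ramp has_real_derivative 0) (at x)"
      by (rule has_field_derivative_transform_within_open[of _ _ _ "{..<0}"])
         (use 1 in \<open>auto simp: ramp_def\<close>)
    then show ?thesis using 1 by simp
  next
    case 2
    have eq: "(\<lambda>h. (ramp (0 + h) - ramp 0) / h) = max 0"
      by (auto simp: fun_eq_iff ramp_def power2_eq_square max_def)
    have "(max 0 \<longlongrightarrow> (0::real)) (at 0)"
      using tendsto_max[OF tendsto_const[of "0::real" "at 0"] tendsto_ident_at] by simp
    then have "(ramp has_real_derivative 0) (at 0)"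
      unfolding DERIV_def eq by simp
    then show ?thesis using 2 by simp
  next
    case 3
    have "((\<lambda>x. x\<^sup>2) has_real_derivative 2 * x) (at x)"
      by (auto intro!: derivative_eq_intros)
    then have "(ramp has_real_derivative 2 * x) (at x)"
      by (rule has_field_derivative_transform_within_open[of _ _ _ "{0<..}"])
         (use 3 in \<open>auto simp: ramp_def\<close>)
    then show ?thesis using 3 by simp
  qed
qed

text \<open>
  A step from \<open>0\<close> to \<open>1\<close> on \<open>{0..1}\<close>: its derivative is the hat function with peak \<open>2\<close> at \<open>1/2\<close>.
\<close>

definition smooth_step :: "real \<Rightarrow> real" where
  "smooth_step x = 2 * ramp x - 4 * ramp (x - 1/2) + 2 * ramp (x - 1)"

definition smooth_step_deriv :: "real \<Rightarrow> real" where
  "smooth_step_deriv x = 4 * max 0 x - 8 * max 0 (x - 1/2) + 4 * max 0 (x - 1)"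

lemma smooth_step_has_derivative:
  "(smooth_step has_real_derivative smooth_step_deriv x) (at x)"
proof -
  have "((\<lambda>x. x - c) has_real_derivative 1) (at x)" for c
    by (auto intro!: derivative_eq_intros)
  from DERIV_chain2[OF ramp_deriv this]
  have "((\<lambda>x. ramp (x - c)) has_real_derivative 2 * max 0 (x - c)) (at x)" for c by simp
  note * = this this[of 0, simplified]
  show ?thesis
    unfolding smooth_step_def[abs_def] smooth_step_deriv_def
    by (auto intro!: derivative_eq_intros * simp: algebra_simps)
qed

lemmas smooth_step_has_derivative_chain [derivative_intros] =
  DERIV_chain2[OF smooth_step_has_derivative]

lemma continuous_smooth_step_deriv: "continuous_on UNIV smooth_step_deriv"
  unfolding smooth_step_deriv_def[abs_def] by (intro continuous_intros)

lemma smooth_step_values: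
  "x \<le> 0 \<Longrightarrow> smooth_step x = 0"
  "0 \<le> x \<Longrightarrow> x \<le> 1/2 \<Longrightarrow> smooth_step x = 2 * x\<^sup>2"
  "1/2 \<le> x \<Longrightarrow> x \<le> 1 \<Longrightarrow> smooth_step x = 1 - 2 * (1 - x)\<^sup>2"
  "1 \<le> x \<Longrightarrow> smooth_step x = 1"
  by (auto simp: smooth_step_def ramp_def max_def power2_eq_square field_simps)

lemma smooth_step_deriv_values:
  "x \<le> 0 \<Longrightarrow> smooth_step_deriv x = 0"
  "1 \<le> x \<Longrightarrow> smooth_step_deriv x = 0"
  "smooth_step_deriv (1/2) = 2"
  by (auto simp: smooth_step_deriv_def max_def)

lemma smooth_step_bounds: "0 \<le> smooth_step x" "smooth_step x \<le> 1"
proof -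
  consider "x \<le> 0" | "0 \<le> x" "x \<le> 1/2" | "1/2 \<le> x" "x \<le> 1" | "1 \<le> x" by linarith
  then have "0 \<le> smooth_step x \<and> smooth_step x \<le> 1"
  proof cases
    case 2
    then have "x\<^sup>2 \<le> (1/2)\<^sup>2" by (intro power_mono) auto
    then show ?thesis using 2 by (auto simp: smooth_step_values power2_eq_square)
  next
    case 3
    then have "(1 - x)\<^sup>2 \<le> (1/2)\<^sup>2" by (intro power_mono) auto
    then show ?thesis using 3 by (auto simp: smooth_step_values power2_eq_square)
  qed (auto simp: smooth_step_values)
  then show "0 \<le> smooth_step x" "smooth_step x \<le> 1" by auto
qed

lemma smooth_step_reflect: "smooth_step (1 - x) = 1 - smooth_step x"
proof -
  consider "x \<le> 0" | "0 \<le> x" "x \<le> 1/2" | "1/2 \<le> x" "x \<le> 1" | "1 \<le> x" by linarith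
  then show ?thesis by cases (auto simp: smooth_step_values)
qed

lemma smooth_step_less_half: "x < 1/2 \<Longrightarrow> smooth_step x < 1/2"
proof (cases "x \<le> 0")
  case False
  assume "x < 1/2"
  then have "x\<^sup>2 < (1/2)\<^sup>2" using False by (intro power_strict_mono) auto
  then show ?thesis using False \<open>x < 1/2\<close> by (simp add: smooth_step_values power2_eq_square)
qed (simp add: smooth_step_values)

lemma smooth_step_greater_half: "x > 1/2 \<Longrightarrow> smooth_step x > 1/2"
  using smooth_step_less_half[of "1 - x"] by (simp add: smooth_step_reflect)

lemma smooth_step_half: "smooth_step (1/2) = 1/2"
  by (simp add: smooth_step_values power2_eq_square)

lemma smooth_step_eq_half_iff: "smooth_step x = 1/2 \<longleftrightarrow> x = 1/2"
proof (cases "x = 1/2")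
  case False
  then show ?thesis using smooth_step_less_half[of x] smooth_step_greater_half[of x] by fastforce
next
  case True
  show ?thesis unfolding True by (simp only: smooth_step_half)
qed

section \<open>Curves in polar coordinates\<close>

text \<open>
  All strings run from the boundary of the disk, at \<open>t = 0\<close>, inwards to radius \<open>3/4\<close> and back to the
  boundary, at \<open>t = 1\<close>. They never meet the centre, so their angles are real functions.
\<close>

definition radius :: "real \<Rightarrow> real" where
  "radius t = 1 - t + t\<^sup>2"

text \<open>
  Angles are measured in units of \<open>1 / m\<close>. The relevant ones lie in \<open>{-1..2 * m}\<close>, hence in the range
  \<open>{-1..2}\<close> of radians, where \<open>cis\<close> is injective.
\<close>

definition polar :: "nat \<Rightarrow> real \<Rightarrow> real \<Rightarrow> complex" where
  "polar m t a = rcis (radius t) (a / real m)"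

definition polar_diagram :: "nat \<Rightarrow> (nat \<Rightarrow> real \<Rightarrow> real) \<Rightarrow> (nat \<times> real) set \<Rightarrow> vtangle" where
  "polar_diagram m \<Theta> U = \<lparr>nstr = m, strand = (\<lambda>i t. polar m t (\<Theta> i t)), under = U\<rparr>"

lemma radius_pos: "radius t > 0"
proof -
  have "radius t = (t - 1/2)\<^sup>2 + 3/4" by (simp add: radius_def power2_eq_square field_simps)
  then show ?thesis using zero_le_power2[of "t - 1/2"] by linarith
qed

lemma radius_eq_iff: "radius s = radius t \<longleftrightarrow> s = t \<or> s = 1 - t"
proof -
  have "radius s - radius t = (s - t) * (s - (1 - t))"
    by (simp add: radius_def power2_eq_square algebra_simps)
  then show ?thesis by (metis diff_eq_eq eq_iff_diff_eq_0 mult_eq_0_iff)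
qed

lemma radius_reflect [simp]: "radius (1 - t) = radius t"
  by (simp add: radius_eq_iff)

lemma radius_eq_1_iff: "radius t = 1 \<longleftrightarrow> t = 0 \<or> t = 1"
  using radius_eq_iff[of t 0] by (simp add: radius_def)

lemma radius_le_1: "0 \<le> t \<Longrightarrow> t \<le> 1 \<Longrightarrow> radius t \<le> 1"
  using mult_left_le[of t t] by (simp add: radius_def power2_eq_square)

lemma norm_polar [simp]: "norm (polar m t a) = radius t"
  using radius_pos[of t] by (simp add: polar_def)

lemma polar_eq_iff:
  assumes "m \<ge> 1" "a \<in> {-1..2 * real m}" "b \<in> {-1..2 * real m}"
  shows "polar m s a = polar m t b \<longleftrightarrow> (s = t \<or> s = 1 - t) \<and> a = b"
proof
  assume eq: "polar m s a = polar m t b"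
  then have r: "radius s = radius t" by (metis norm_polar)
  have "x / real m \<in> {-pi<..pi}" if "x \<in> {-1..2 * real m}" for x
  proof -
    have "-1 * real m \<le> x" "x \<le> 2 * real m" using that assms(1) by auto
    then have "-1 \<le> x / real m" "x / real m \<le> 2" using assms(1) by (simp_all add: field_simps)
    then show ?thesis using pi_gt3 by auto
  qed
  note * = this
  have "Arg (polar m s a) = a / real m" "Arg (polar m t b) = b / real m"
    unfolding polar_def by (intro Arg_rcis * assms radius_pos)+
  then have "a / real m = b / real m" using eq by metis
  then have "a = b" using assms(1) by simp
  then show "(s = t \<or> s = 1 - t) \<and> a = b" using r by (simp add: radius_eq_iff)
next
  assume "(s = t \<or> s = 1 - t) \<and> a = b"
  then show "polar m s a = polar m t b" by (auto simp: polar_def)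
qed

lemma polar_eq_iff_near_end:
  assumes "m \<ge> 1" "a \<in> {-1..2 * real m}" "b \<in> {-1..2 * real m}" "s \<in> {0..1/2}" "t \<in> {0..1/2}"
  shows "polar m s a = polar m t b \<longleftrightarrow> s = t \<and> a = b"
  using polar_eq_iff[OF assms(1-3), of s t] assms(4,5) by auto

definition polar_velocity :: "nat \<Rightarrow> real \<Rightarrow> real \<Rightarrow> real \<Rightarrow> complex" where
  "polar_velocity m t a a' =
     (of_real (2 * t - 1) + \<i> * of_real (radius t * (a' / real m))) * cis (a / real m)"

lemma polar_has_vector_derivative:
  assumes "(f has_real_derivative f') (at t)"
  shows "((\<lambda>t. polar m t (f t)) has_vector_derivative polar_velocity m t (f t) f') (at t)"
proof -
  have r: "(radius has_real_derivative 2 * t - 1) (at t)"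
    unfolding radius_def[abs_def] by (auto intro!: derivative_eq_intros)
  note c = DERIV_fun_cos[OF DERIV_cdivide[OF assms, of "real m"]]
  note s = DERIV_fun_sin[OF DERIV_cdivide[OF assms, of "real m"]]
  show ?thesis
    unfolding has_vector_derivative_complex_iff polar_def polar_velocity_def
    using DERIV_mult[OF r c] DERIV_mult[OF r s] by (simp add: algebra_simps)
qed

lemma span_two_complex:
  fixes v w :: complex
  assumes "Re v * Im w - Im v * Re w \<noteq> 0"
  shows "span {v, w} = UNIV"
proof -
  define D where "D = Re v * Im w - Im v * Re w"
  have "z \<in> span {v, w}" for z
  proof -
    have "z = ((Re z * Im w - Im z * Re w) / D) *\<^sub>R v + ((Im z * Re v - Re z * Im v) / D) *\<^sub>R w"
      using assms unfolding D_def[symmetric]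
      by (simp add: complex_eq_iff field_simps) (simp add: D_def algebra_simps)
    then show ?thesis by (metis insertI1 insertI2 span_add span_base span_scale)
  qed
  then show ?thesis by blast
qed

text \<open>
  The determinant of the velocities of two curves at a common point is
  \<open>radius s / m * ((2 * s - 1) * b' - (2 * t - 1) * a')\<close>, where \<open>2 * t - 1\<close> is the derivative of the
  radius and \<open>a'\<close>, \<open>b'\<close> are those of the angles.
\<close>

lemma polar_transverse:
  assumes "(2 * s - 1) * b' \<noteq> (2 * t - 1) * a'" "radius t = radius s" "m \<ge> 1"
  shows "span {polar_velocity m s c a', polar_velocity m t c b'} = UNIV"
proof (rule span_two_complex)
  define C S where "C = cos (c / real m)" and "S = sin (c / real m)"
  have "C * C + S * S = 1"
    using sin_cos_squared_add[of "c / real m"] by (simp add: C_def S_def power2_eq_square)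
  define x y where "x = radius s * (a' / real m)" and "y = radius s * (b' / real m)"
  have "Re (polar_velocity m s c a') * Im (polar_velocity m t c b')
        - Im (polar_velocity m s c a') * Re (polar_velocity m t c b')
        = ((2 * s - 1) * C - x * S) * ((2 * t - 1) * S + y * C)
        - ((2 * s - 1) * S + x * C) * ((2 * t - 1) * C - y * S)"
    unfolding polar_velocity_def assms(2) x_def[symmetric] y_def[symmetric]
    by (simp add: C_def S_def mult.commute add.commute)
  also have "\<dots> = ((2 * s - 1) * y - (2 * t - 1) * x) * (C * C + S * S)"
    by (simp add: algebra_simps)
  also have "\<dots> = (radius s / real m) * ((2 * s - 1) * b' - (2 * t - 1) * a')"
    unfolding \<open>C * C + S * S = 1\<close> x_def y_def by (simp add: algebra_simps diff_divide_distrib)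
  finally show "Re (polar_velocity m s c a') * Im (polar_velocity m t c b')
        - Im (polar_velocity m s c a') * Re (polar_velocity m t c b') \<noteq> 0"
    using assms radius_pos[of s] by simp
qed

section \<open>Diagrams with a common radius function\<close>

text \<open>
  The crossings of a diagram with angles \<open>\<Theta>\<close>: equal radii mean \<open>snd x = snd y\<close> or
  \<open>snd x = 1 - snd y\<close>.
\<close>

definition meets :: "nat \<Rightarrow> (nat \<Rightarrow> real \<Rightarrow> real) \<Rightarrow> nat \<times> real \<Rightarrow> nat \<times> real \<Rightarrow> bool" where
  "meets m \<Theta> x y \<longleftrightarrow> x \<in> {..<m} \<times> {0..1} \<and> y \<in> {..<m} \<times> {0..1} \<and> x \<noteq> y \<and>
     (snd x = snd y \<or> snd x = 1 - snd y) \<and> \<Theta> (fst x) (snd x) = \<Theta> (fst y) (snd y)"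

text \<open>
  The parameter reached from the end \<open>p\<close> of a string after moving inwards by \<open>u\<close>. For \<open>u\<close> up to \<open>1/2\<close>
  these parameters cover the half of the string that starts at \<open>p\<close>, and the radius only depends on \<open>u\<close>.
\<close>

definition at_depth :: "nat \<times> real \<Rightarrow> real \<Rightarrow> nat \<times> real" where
  "at_depth p u = (fst p, if snd p = 0 then u else 1 - u)"

lemma fst_at_depth [simp]: "fst (at_depth p u) = fst p"
  by (simp add: at_depth_def)

lemma meets_sym: "meets m \<Theta> x y \<Longrightarrow> meets m \<Theta> y x"
  by (auto simp: meets_def)

lemma radius_at_depth [simp]: "radius (snd (at_depth p u)) = radius u"
  by (simp add: at_depth_def)

lemma at_depth_in_params:
  "p \<in> {..<m} \<times> {0, 1} \<Longrightarrow> u \<in> {0..1} \<Longrightarrow> at_depth p u \<in> {..<m} \<times> {0..1}"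
  by (auto simp: at_depth_def)

lemma at_depth_0 [simp]: "p \<in> {..<m} \<times> {0, 1} \<Longrightarrow> at_depth p 0 = p"
  by (auto simp: at_depth_def)

lemma at_depth_inj:
  assumes "p \<in> {..<m} \<times> {0, 1}" "q \<in> {..<m} \<times> {0, 1}" "u \<in> {0..1/2}" "u' \<in> {0..1/2}"
    "at_depth p u = at_depth q u'" "u < 1/2"
  shows "p = q \<and> u = u'"
  using assms by (cases p; cases q) (auto simp: at_depth_def split: if_splits)

lemma at_depth_cases:
  assumes "x \<in> {..<m} \<times> {0..1 :: real}"
  obtains p u where "p \<in> {..<m} \<times> {0, 1}" "u \<in> {0..1/2}" "x = at_depth p u"
proof (cases "snd x \<le> 1/2")
  case True
  then show thesis using that[of "(fst x, 0)" "snd x"] assms by (auto simp: at_depth_def)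
next
  case False
  then show thesis using that[of "(fst x, 1)" "1 - snd x"] assms by (auto simp: at_depth_def)
qed

text \<open>
  The diagrams built below. The end \<open>e k\<close> sits at angle \<open>k\<close>, and its string keeps this angle up to depth
  \<open>\<delta>\<close>; this collar is where the next crossing is inserted. The assumption \<open>turning\<close> makes the curves
  immersed at their innermost points, where the radius is stationary, and \<open>meets_transverse\<close> says that
  the determinant of \<open>polar_transverse\<close> is nonzero.
\<close>

locale layered_diagram =
  fixes m :: nat and \<delta> :: real and e :: "nat \<Rightarrow> nat \<times> real"
    and \<Theta> \<Theta>' :: "nat \<Rightarrow> real \<Rightarrow> real" and U :: "(nat \<times> real) set"
  assumes m_pos: "m \<ge> 1"
    and depth: "0 < \<delta>" "\<delta> \<le> 1/4"
    and ends_bij: "bij_betw e {..<2 * m} ({..<m} \<times> {0, 1})"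
    and angle_deriv: "\<And>i t. i < m \<Longrightarrow> (\<Theta> i has_real_derivative \<Theta>' i t) (at t)"
    and angle_deriv_cont: "\<And>i. i < m \<Longrightarrow> continuous_on UNIV (\<Theta>' i)"
    and turning: "\<And>i. i < m \<Longrightarrow> \<Theta>' i (1/2) \<noteq> 0"
    and angle_range: "\<And>i t. i < m \<Longrightarrow> t \<in> {0..1} \<Longrightarrow> \<Theta> i t \<in> {0..2 * real m - 1}"
    and collar: "\<And>k u. k < 2 * m \<Longrightarrow> u \<in> {0..\<delta>} \<Longrightarrow>
        \<Theta> (fst (e k)) (snd (at_depth (e k) u)) = real k \<and>
        \<Theta>' (fst (e k)) (snd (at_depth (e k) u)) = 0"
    and finite_meets: "finite {(x, y). meets m \<Theta> x y}"
    and meets_transverse: "\<And>x y. meets m \<Theta> x y \<Longrightarrow>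
        (2 * snd x - 1) * \<Theta>' (fst y) (snd y) \<noteq> (2 * snd y - 1) * \<Theta>' (fst x) (snd x)"
    and meets_double: "\<And>x y z. meets m \<Theta> x y \<Longrightarrow> meets m \<Theta> x z \<Longrightarrow> y = z"
    and under_meets: "\<And>x. x \<in> U \<Longrightarrow> \<exists>y. meets m \<Theta> x y"
    and not_both_under: "\<And>x y. meets m \<Theta> x y \<Longrightarrow> \<not> (x \<in> U \<and> y \<in> U)"
begin

abbreviation "T \<equiv> polar_diagram m \<Theta> U"

lemma T_simps [simp]:
  "nstr T = m" "strand T i t = polar m t (\<Theta> i t)" "under T = U"
  "pt T x = polar m (snd x) (\<Theta> (fst x) (snd x))"
  "params T = {..<m} \<times> {0..1}" "ends T = {..<m} \<times> {0, 1}"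
  by (simp_all add: polar_diagram_def pt_def params_def ends_def)

lemma end_in: "k < 2 * m \<Longrightarrow> e k \<in> {..<m} \<times> {0, 1}"
  using ends_bij by (auto simp: bij_betw_def)

lemma end_eq_iff: "k < 2 * m \<Longrightarrow> l < 2 * m \<Longrightarrow> e k = e l \<longleftrightarrow> k = l"
  using ends_bij by (auto simp: bij_betw_def inj_on_def)

lemma end_cases:
  assumes "p \<in> {..<m} \<times> {0, 1}"
  obtains k where "k < 2 * m" "p = e k"
  using assms ends_bij by (auto simp: bij_betw_def)

lemma crossing_pair_iff: "crossing_pair T x y \<longleftrightarrow> meets m \<Theta> x y"
proof (cases "x \<in> {..<m} \<times> {0..1} \<and> y \<in> {..<m} \<times> {0..1}")
  case True
  have "\<Theta> (fst z) (snd z) \<in> {-1..2 * real m}" if "z \<in> {..<m} \<times> {0..1}" for z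
    using angle_range[of "fst z" "snd z"] that by auto
  then show ?thesis
    unfolding crossing_pair_def meets_def using True polar_eq_iff[OF m_pos] by auto
next
  case False
  then show ?thesis by (auto simp: crossing_pair_def meets_def)
qed

lemma angle_end: "k < 2 * m \<Longrightarrow> \<Theta> (fst (e k)) (snd (e k)) = real k"
  using collar[of k 0] depth end_in by (metis at_depth_0 atLeastAtMost_iff less_imp_le order_refl)

lemma velocity_eq:
  assumes "x \<in> {..<m} \<times> {0..1}"
  shows "velocity T x = polar_velocity m (snd x) (\<Theta> (fst x) (snd x)) (\<Theta>' (fst x) (snd x))"
proof -
  have "strand T (fst x) = (\<lambda>t. polar m t (\<Theta> (fst x) t))" by (simp add: polar_diagram_def)
  moreover have "((\<lambda>t. polar m t (\<Theta> (fst x) t)) has_vector_derivative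
      polar_velocity m (snd x) (\<Theta> (fst x) (snd x)) (\<Theta>' (fst x) (snd x))) (at (snd x))"
    using assms by (intro polar_has_vector_derivative angle_deriv) auto
  ultimately show ?thesis
    unfolding velocity_def using assms by (auto intro!: vector_derivative_at_within_ivl)
qed

lemma strand_immersed:
  assumes "i < m"
  shows "immersed_interval (strand T i)"
  unfolding immersed_interval_def
proof (intro exI conjI ballI)
  let ?g' = "\<lambda>t. polar_velocity m t (\<Theta> i t) (\<Theta>' i t)"
  have c: "continuous_on {0..1} (\<Theta>' i)"
    by (rule continuous_on_subset[OF angle_deriv_cont[OF assms]]) simp
  have c': "continuous_on {0..1} (\<Theta> i)"
    by (intro continuous_at_imp_continuous_on ballI DERIV_isCont[OF angle_deriv[OF assms]])
  show "continuous_on {0..1} ?g'"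
    unfolding polar_velocity_def radius_def by (intro continuous_intros c c') (use m_pos in auto)
  fix t :: real assume t: "t \<in> {0..1}"
  have "strand T i = (\<lambda>t. polar m t (\<Theta> i t))" by (simp add: polar_diagram_def)
  then show "(strand T i has_vector_derivative ?g' t) (at t within {0..1})"
    by (simp only: has_vector_derivative_at_within polar_has_vector_derivative angle_deriv[OF assms])
  show "?g' t \<noteq> 0"
  proof (cases "t = 1/2")
    case True
    show ?thesis unfolding True polar_velocity_def
      using turning[OF assms] radius_pos[of "1/2"] m_pos by simp
  next
    case False
    then have "of_real (2 * t - 1) + \<i> * of_real (radius t * (\<Theta>' i t / real m)) \<noteq> 0"
      by (auto simp: complex_eq_iff)
    then show ?thesis by (simp add: polar_velocity_def)
  qed
qed

lemma is_tangle_diagram: "tangle_diagram T"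
  unfolding tangle_diagram_def
proof (intro conjI)
  show "\<forall>i<nstr T. immersed_interval (strand T i)" using strand_immersed by simp
  show "\<forall>x\<in>params T. pt T x \<in> cball 0 1" by (auto simp: radius_le_1)
  show "\<forall>x\<in>params T. (pt T x \<in> sphere 0 1) = (x \<in> ends T)" by (auto simp: radius_eq_1_iff)
  show "inj_on (pt T) (ends T)"
  proof (rule inj_onI, goal_cases)
    case (1 x y)
    obtain k where k: "k < 2 * m" "x = e k" using 1(1) end_cases by auto
    obtain l where l: "l < 2 * m" "y = e l" using 1(2) end_cases by auto
    have "polar m (snd x) (real k) = polar m (snd y) (real l)"
      using 1(3) angle_end k l by simp
    then have "real k = real l"
      using k l by (subst (asm) polar_eq_iff[OF m_pos]) auto
    then show ?case using k l by simp
  qed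
  show "finite {(x, y). crossing_pair T x y}" using finite_meets by (simp add: crossing_pair_iff)
  show "\<forall>x y. crossing_pair T x y \<longrightarrow> span {velocity T x, velocity T y} = UNIV"
  proof (intro allI impI)
    fix x y assume "crossing_pair T x y"
    then have xy: "meets m \<Theta> x y" by (simp add: crossing_pair_iff)
    have "span {polar_velocity m (snd x) (\<Theta> (fst x) (snd x)) (\<Theta>' (fst x) (snd x)),
                polar_velocity m (snd y) (\<Theta> (fst x) (snd x)) (\<Theta>' (fst y) (snd y))} = UNIV"
      by (rule polar_transverse[OF meets_transverse[OF xy] _ m_pos])
         (use xy in \<open>auto simp: meets_def radius_eq_iff\<close>)
    then show "span {velocity T x, velocity T y} = UNIV"
      using xy by (simp add: velocity_eq meets_def)
  qed
  show "\<forall>x y z. crossing_pair T x y \<and> crossing_pair T x z \<longrightarrow> y = z"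
    using meets_double by (auto simp: crossing_pair_iff)
  show "\<forall>x\<in>under T. \<exists>y. crossing_pair T x y" using under_meets by (simp add: crossing_pair_iff)
  show "\<forall>x y. crossing_pair T x y \<longrightarrow> \<not> (x \<in> under T \<and> y \<in> under T)"
    using not_both_under by (simp add: crossing_pair_iff)
qed

text \<open>
  Crossings lie deeper than the collar, where the angles are distinct integers, and not at depth \<open>1/2\<close>,
  where the radial parts of both velocities vanish.
\<close>

lemma meets_depth:
  assumes "meets m \<Theta> x y"
  obtains p q u where "p \<in> {..<m} \<times> {0, 1}" "q \<in> {..<m} \<times> {0, 1}" "u \<in> {\<delta><..<1/2}"
    "x = at_depth p u" "y = at_depth q u"
proof -
  have xy: "x \<in> {..<m} \<times> {0..1}" "y \<in> {..<m} \<times> {0..1}" using assms by (auto simp: meets_def)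
  obtain p u where p: "p \<in> {..<m} \<times> {0, 1}" "u \<in> {0..1/2}" "x = at_depth p u"
    using at_depth_cases[OF xy(1)] .
  obtain q u' where q: "q \<in> {..<m} \<times> {0, 1}" "u' \<in> {0..1/2}" "y = at_depth q u'"
    using at_depth_cases[OF xy(2)] .
  have "radius (snd x) = radius (snd y)" using assms unfolding meets_def radius_eq_iff by blast
  then have "u' = u" using p q by (auto simp: radius_eq_iff)
  have "u \<noteq> 1/2"
  proof
    assume "u = 1/2"
    then have "snd x = 1/2" "snd y = 1/2" using p q \<open>u' = u\<close> by (auto simp: at_depth_def)
    then show False using meets_transverse[OF assms] by (simp only:) simp
  qed
  moreover have "u > \<delta>"
  proof (rule ccontr)
    assume "\<not> u > \<delta>"
    then have u: "u \<in> {0..\<delta>}" using p by auto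
    obtain k l where k: "k < 2 * m" "p = e k" and l: "l < 2 * m" "q = e l"
      using end_cases p q by metis
    have "real k = real l"
      using collar[OF k(1) u] collar[OF l(1) u] assms p q k l \<open>u' = u\<close> by (auto simp: meets_def)
    then show False using assms p q k l \<open>u' = u\<close> by (auto simp: meets_def)
  qed
  ultimately show thesis using that[OF p(1) q(1), of u] p q \<open>u' = u\<close> by auto
qed

end

section \<open>Adding a crossing at the boundary\<close>

lemma meets_at_depth:
  assumes "p \<in> {..<m} \<times> {0, 1}" "q \<in> {..<m} \<times> {0, 1}" "u \<in> {0..1/2}" "u' \<in> {0..1/2}"
  shows "meets m \<Theta> (at_depth p u) (at_depth q u') \<longleftrightarrow>
     u = u' \<and> at_depth p u \<noteq> at_depth q u \<and>
     \<Theta> (fst p) (snd (at_depth p u)) = \<Theta> (fst q) (snd (at_depth q u))"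
proof -
  have *: "snd (at_depth p u) = snd (at_depth q u') \<or> snd (at_depth p u) = 1 - snd (at_depth q u')
        \<longleftrightarrow> u = u'"
    using assms by (auto simp: at_depth_def)
  have "at_depth p u \<in> {..<m} \<times> {0..1}" "at_depth q u' \<in> {..<m} \<times> {0..1}"
    using assms by (auto intro!: at_depth_in_params)
  then show ?thesis unfolding meets_def * by auto
qed

lemma snd_at_depth:
  "b \<in> {..<m} \<times> {0, 1} \<Longrightarrow> 2 * snd (at_depth b u) - 1 = (2 * snd b - 1) * (1 - 2 * u)"
  by (auto simp: at_depth_def)

text \<open>
  Equal to \<open>1\<close> up to depth \<open>\<delta> / 2\<close>, to \<open>1/2\<close> exactly at depth \<open>3 * \<delta> / 4\<close>, and to \<open>0\<close> from depth \<open>\<delta>\<close> on.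
\<close>

definition swap_bump :: "real \<Rightarrow> real \<Rightarrow> real" where
  "swap_bump \<delta> u = smooth_step (2 - 2 * u / \<delta>)"

definition end_sign :: "(nat \<Rightarrow> nat \<times> real) \<Rightarrow> nat \<Rightarrow> nat \<times> real \<Rightarrow> real" where
  "end_sign e k b = (if b = e k then 1 else if b = e (Suc k) then -1 else 0)"

text \<open>
  The ends \<open>e k\<close> and \<open>e (Suc k)\<close> exchange their angles \<open>k\<close> and \<open>k + 1\<close> while the depth decreases from
  \<open>\<delta>\<close> to \<open>\<delta> / 2\<close>. The first bump acts near the start of a string, the second one near its end.
\<close>

definition swapped_angle ::
    "real \<Rightarrow> (nat \<Rightarrow> nat \<times> real) \<Rightarrow> nat \<Rightarrow> (nat \<Rightarrow> real \<Rightarrow> real) \<Rightarrow> nat \<Rightarrow> real \<Rightarrow> real" where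
  "swapped_angle \<delta> e k \<Theta> i t =
     \<Theta> i t + end_sign e k (i, 0) * swap_bump \<delta> t + end_sign e k (i, 1) * swap_bump \<delta> (1 - t)"

definition swapped_angle_deriv ::
    "real \<Rightarrow> (nat \<Rightarrow> nat \<times> real) \<Rightarrow> nat \<Rightarrow> (nat \<Rightarrow> real \<Rightarrow> real) \<Rightarrow> nat \<Rightarrow> real \<Rightarrow> real" where
  "swapped_angle_deriv \<delta> e k \<Theta>' i t =
     \<Theta>' i t - 2 / \<delta> * (end_sign e k (i, 0) * smooth_step_deriv (2 - 2 * t / \<delta>)
                      - end_sign e k (i, 1) * smooth_step_deriv (2 - 2 * (1 - t) / \<delta>))"

lemma swap_bump_bounds: "0 \<le> swap_bump \<delta> u" "swap_bump \<delta> u \<le> 1"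
  by (simp_all add: swap_bump_def smooth_step_bounds)

lemma swap_bump_eq_0: "0 < \<delta> \<Longrightarrow> \<delta> \<le> u \<Longrightarrow> swap_bump \<delta> u = 0"
  by (simp add: swap_bump_def smooth_step_values field_simps)

lemma swap_bump_eq_1: "0 < \<delta> \<Longrightarrow> u \<le> \<delta> / 2 \<Longrightarrow> swap_bump \<delta> u = 1"
  by (simp add: swap_bump_def smooth_step_values field_simps)

lemma swap_bump_eq_half_iff: "0 < \<delta> \<Longrightarrow> swap_bump \<delta> u = 1/2 \<longleftrightarrow> u = 3 * \<delta> / 4"
  unfolding swap_bump_def smooth_step_eq_half_iff by (simp add: field_simps)

lemma swapped_angle_has_derivative:
  assumes "(\<Theta> i has_real_derivative \<Theta>' i t) (at t)" "0 < \<delta>"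
  shows "(swapped_angle \<delta> e k \<Theta> i has_real_derivative swapped_angle_deriv \<delta> e k \<Theta>' i t) (at t)"
proof -
  have "((\<lambda>t. 2 - 2 * t / \<delta>) has_real_derivative - (2 / \<delta>)) (at t)"
    "((\<lambda>t. 2 - 2 * (1 - t) / \<delta>) has_real_derivative 2 / \<delta>) (at t)"
    using assms(2) by (auto intro!: derivative_eq_intros simp: field_simps)
  note * = this[THEN DERIV_chain2[OF smooth_step_has_derivative]]
  show ?thesis
    unfolding swapped_angle_def[abs_def] swapped_angle_deriv_def swap_bump_def
    using DERIV_add[OF DERIV_add[OF assms(1) DERIV_cmult[OF *(1), of "end_sign e k (i, 0)"]]
        DERIV_cmult[OF *(2), of "end_sign e k (i, 1)"]]
    by (simp add: algebra_simps)
qed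

lemma swapped_angle_deriv_continuous:
  assumes "continuous_on UNIV (\<Theta>' i)" "0 < \<delta>"
  shows "continuous_on UNIV (swapped_angle_deriv \<delta> e k \<Theta>' i)"
proof -
  have "continuous_on UNIV (\<lambda>t. smooth_step_deriv (f t))" if "continuous_on UNIV f" for f :: "real \<Rightarrow> real"
    using continuous_on_compose2[OF continuous_smooth_step_deriv that] by simp
  moreover have "continuous_on UNIV (\<lambda>t. 2 - 2 * t / \<delta>)"
    "continuous_on UNIV (\<lambda>t. 2 - 2 * (1 - t) / \<delta>)"
    using assms(2) by (simp_all add: continuous_intros)
  ultimately show ?thesis
    unfolding swapped_angle_deriv_def[abs_def] by (intro continuous_intros assms(1))
qed

text \<open>
  The set \<open>V\<close> records the kind of the new crossing: virtual if it is empty, otherwise classical with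
  the given under-strand.
\<close>

locale end_swap = layered_diagram +
  fixes k :: nat and V :: "(nat \<times> real) set"
  assumes k: "Suc k < 2 * m"
    and V: "V = {} \<or> V = {at_depth (e k) (3 * \<delta> / 4)} \<or> V = {at_depth (e (Suc k)) (3 * \<delta> / 4)}"
begin

abbreviation "p \<equiv> e k"
abbreviation "q \<equiv> e (Suc k)"
abbreviation "u\<^sub>0 \<equiv> 3 * \<delta> / 4"
abbreviation "x\<^sub>0 \<equiv> at_depth p u\<^sub>0"
abbreviation "y\<^sub>0 \<equiv> at_depth q u\<^sub>0"
abbreviation "\<Theta>\<^sub>2 \<equiv> swapped_angle \<delta> e k \<Theta>"
abbreviation "\<Theta>\<^sub>2' \<equiv> swapped_angle_deriv \<delta> e k \<Theta>'"
abbreviation "e\<^sub>2 \<equiv> e \<circ> Transposition.transpose k (Suc k)"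

definition position_sign :: "nat \<Rightarrow> real" where
  "position_sign l = (if l = k then 1 else if l = Suc k then -1 else 0)"

lemma ends_k: "p \<in> {..<m} \<times> {0, 1}" "q \<in> {..<m} \<times> {0, 1}" "p \<noteq> q"
  using end_in[of k] end_in[of "Suc k"] end_eq_iff[of k "Suc k"] k by auto

lemma end_sign_e: "l < 2 * m \<Longrightarrow> end_sign e k (e l) = position_sign l"
  using k by (simp add: end_sign_def position_sign_def end_eq_iff)

lemma swapped_angle_at_depth:
  assumes "b \<in> {..<m} \<times> {0, 1}" "u \<in> {0..1/2}"
  shows "\<Theta>\<^sub>2 (fst b) (snd (at_depth b u)) =
    \<Theta> (fst b) (snd (at_depth b u)) + end_sign e k b * swap_bump \<delta> u"
proof -
  have "swap_bump \<delta> (1 - u) = 0" using assms depth by (intro swap_bump_eq_0) auto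
  moreover have "snd b = 0 \<and> (fst b, 0) = b \<or> snd b = 1 \<and> (fst b, 1) = b"
    using assms(1) by auto
  ultimately show ?thesis by (auto simp: swapped_angle_def at_depth_def)
qed

lemma swapped_angle_deriv_at_depth:
  assumes "b \<in> {..<m} \<times> {0, 1}" "u \<in> {0..1/2}"
  shows "\<Theta>\<^sub>2' (fst b) (snd (at_depth b u)) = \<Theta>' (fst b) (snd (at_depth b u)) +
    (2 * snd b - 1) * (2 / \<delta>) * end_sign e k b * smooth_step_deriv (2 - 2 * u / \<delta>)"
proof -
  have "\<delta> \<le> 1 - u" using assms depth by auto
  then have "2 - 2 * (1 - u) / \<delta> \<le> 0" using depth by (simp add: field_simps)
  then have "smooth_step_deriv (2 - 2 * (1 - u) / \<delta>) = 0" by (rule smooth_step_deriv_values)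
  moreover have "snd b = 0 \<and> (fst b, 0) = b \<or> snd b = 1 \<and> (fst b, 1) = b"
    using assms(1) by auto
  ultimately show ?thesis by (auto simp: swapped_angle_deriv_def at_depth_def)
qed

lemma swapped_collar:
  assumes "l < 2 * m" "u \<in> {0..\<delta>}"
  shows "\<Theta>\<^sub>2 (fst (e l)) (snd (at_depth (e l) u)) = real l + position_sign l * swap_bump \<delta> u"
  using swapped_angle_at_depth[OF end_in[OF assms(1)], of u] collar[OF assms] assms depth
  by (simp add: end_sign_e)

lemma swapped_collar_deriv:
  assumes "l < 2 * m" "u \<in> {0..\<delta>}"
  shows "\<Theta>\<^sub>2' (fst (e l)) (snd (at_depth (e l) u)) =
    (2 * snd (e l) - 1) * (2 / \<delta>) * position_sign l * smooth_step_deriv (2 - 2 * u / \<delta>)"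
  using swapped_angle_deriv_at_depth[OF end_in[OF assms(1)], of u] collar[OF assms] assms depth
  by (simp add: end_sign_e)

lemma swapped_beyond:
  assumes "b \<in> {..<m} \<times> {0, 1}" "u \<in> {\<delta>..1/2}"
  shows "\<Theta>\<^sub>2 (fst b) (snd (at_depth b u)) = \<Theta> (fst b) (snd (at_depth b u))"
    "\<Theta>\<^sub>2' (fst b) (snd (at_depth b u)) = \<Theta>' (fst b) (snd (at_depth b u))"
proof -
  have "2 - 2 * u / \<delta> \<le> 0" using assms depth by (simp add: field_simps)
  then have "smooth_step_deriv (2 - 2 * u / \<delta>) = 0" by (rule smooth_step_deriv_values)
  then show "\<Theta>\<^sub>2 (fst b) (snd (at_depth b u)) = \<Theta> (fst b) (snd (at_depth b u))"
    "\<Theta>\<^sub>2' (fst b) (snd (at_depth b u)) = \<Theta>' (fst b) (snd (at_depth b u))"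
    using assms depth
    by (simp_all add: swapped_angle_at_depth swapped_angle_deriv_at_depth swap_bump_eq_0)
qed

text \<open>
  Among the angles \<open>l\<close> of the other ends and \<open>k + c\<close>, \<open>k + 1 - c\<close> of the moving ones, a coincidence is
  only possible between the latter, half-way.
\<close>

lemma position_sign_eqD:
  assumes "real l + position_sign l * c = real l' + position_sign l' * c" "l \<noteq> l'" "0 \<le> c" "c \<le> 1"
  shows "c = 1/2 \<and> (l = k \<and> l' = Suc k \<or> l = Suc k \<and> l' = k)"
  using assms unfolding position_sign_def by (auto split: if_splits)

lemma collar_bounds:
  assumes "0 \<le> c" "c \<le> 1" "l < 2 * m"
  shows "real l + position_sign l * c \<in> {0..2 * real m - 1}"
  using assms k unfolding position_sign_def by auto

lemma swapped_meets_iff: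
  "meets m \<Theta>\<^sub>2 x y \<longleftrightarrow> meets m \<Theta> x y \<or> (x, y) = (x\<^sub>0, y\<^sub>0) \<or> (x, y) = (y\<^sub>0, x\<^sub>0)"
proof -
  have new: "meets m \<Theta>\<^sub>2 x\<^sub>0 y\<^sub>0"
  proof -
    have "swap_bump \<delta> u\<^sub>0 = 1/2" by (rule swap_bump_eq_half_iff[THEN iffD2, OF depth(1) refl])
    then have "\<Theta>\<^sub>2 (fst p) (snd x\<^sub>0) = \<Theta>\<^sub>2 (fst q) (snd y\<^sub>0)"
      using swapped_collar[of k u\<^sub>0] swapped_collar[of "Suc k" u\<^sub>0] k depth
      by (simp add: position_sign_def)
    moreover have "x\<^sub>0 \<noteq> y\<^sub>0"
      using at_depth_inj[OF ends_k(1,2), of u\<^sub>0 u\<^sub>0] ends_k(3) depth by auto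
    ultimately show ?thesis
      using meets_at_depth[OF ends_k(1,2), of u\<^sub>0 u\<^sub>0 \<Theta>\<^sub>2] at_depth_inj[OF ends_k(1,2), of u\<^sub>0 u\<^sub>0] depth ends_k(3)
      by auto
  qed
  have old: "meets m \<Theta>\<^sub>2 x y" if xy: "meets m \<Theta> x y" for x y
  proof -
    from meets_depth[OF xy] obtain b c u where b: "b \<in> {..<m} \<times> {0, 1}" "c \<in> {..<m} \<times> {0, 1}"
      "u \<in> {\<delta><..<1/2}" "x = at_depth b u" "y = at_depth c u" .
    have u: "u \<in> {0..1/2}" "u \<in> {\<delta>..1/2}" using b(3) depth by auto
    show ?thesis
      using xy swapped_beyond(1)[OF b(1) u(2)] swapped_beyond(1)[OF b(2) u(2)]
      unfolding b(4,5) meets_at_depth[OF b(1,2) u(1) u(1)] by simp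
  qed
  have "meets m \<Theta> x y \<or> (x, y) = (x\<^sub>0, y\<^sub>0) \<or> (x, y) = (y\<^sub>0, x\<^sub>0)" if xy: "meets m \<Theta>\<^sub>2 x y"
  proof -
    have xy': "x \<in> {..<m} \<times> {0..1}" "y \<in> {..<m} \<times> {0..1}" using xy by (auto simp: meets_def)
    obtain b u where b: "b \<in> {..<m} \<times> {0, 1}" "u \<in> {0..1/2}" "x = at_depth b u"
      using at_depth_cases[OF xy'(1)] .
    obtain c u' where c: "c \<in> {..<m} \<times> {0, 1}" "u' \<in> {0..1/2}" "y = at_depth c u'"
      using at_depth_cases[OF xy'(2)] .
    have m2: "u = u'" "at_depth b u \<noteq> at_depth c u"
      "\<Theta>\<^sub>2 (fst b) (snd (at_depth b u)) = \<Theta>\<^sub>2 (fst c) (snd (at_depth c u))"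
      using xy unfolding b(3) c(3) meets_at_depth[OF b(1) c(1) b(2) c(2)] by blast+
    show ?thesis
    proof (cases "u \<le> \<delta>")
      case False
      then have "u \<in> {\<delta>..1/2}" using b(2) by auto
      note swapped_beyond(1)[OF b(1) this] swapped_beyond(1)[OF c(1) this]
      then have "\<Theta> (fst b) (snd (at_depth b u)) = \<Theta> (fst c) (snd (at_depth c u))"
        using m2(3) by simp
      then have "meets m \<Theta> x y"
        unfolding b(3) c(3) meets_at_depth[OF b(1) c(1) b(2) c(2)] using m2(1,2) by blast
      then show ?thesis ..
    next
      case True
      then have u: "u \<in> {0..\<delta>}" using b by auto
      obtain l where l: "l < 2 * m" "b = e l" using end_cases[OF b(1)] .
      obtain l' where l': "l' < 2 * m" "c = e l'" using end_cases[OF c(1)] .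
      have "l \<noteq> l'" using m2(2) l l' by auto
      have eq: "real l + position_sign l * swap_bump \<delta> u = real l' + position_sign l' * swap_bump \<delta> u"
        using m2(3) swapped_collar[OF l(1) u] swapped_collar[OF l'(1) u] l l' by simp
      from position_sign_eqD[OF eq \<open>l \<noteq> l'\<close> swap_bump_bounds]
      have "swap_bump \<delta> u = 1/2" and ll: "l = k \<and> l' = Suc k \<or> l = Suc k \<and> l' = k" by auto
      then have "u = u\<^sub>0" by (simp only: swap_bump_eq_half_iff[OF depth(1)])
      then have "x = at_depth b u\<^sub>0" "y = at_depth c u\<^sub>0" 
        by (simp_all only: b(3) c(3) \<open>u = u\<^sub>0\<close> m2(1)[symmetric])
      then show ?thesis using ll l l' by auto
    qed
  qed
  moreover have "meets m \<Theta>\<^sub>2 x y" if "(x, y) = (x\<^sub>0, y\<^sub>0) \<or> (x, y) = (y\<^sub>0, x\<^sub>0)"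
    using that new meets_sym[OF new] by (elim disjE) simp_all
  ultimately show ?thesis using old by blast
qed

lemma new_not_old: "\<not> meets m \<Theta> x\<^sub>0 z" "\<not> meets m \<Theta> y\<^sub>0 z"
proof -
  have "\<not> meets m \<Theta> (at_depth b u\<^sub>0) z" if b: "b \<in> {..<m} \<times> {0, 1}" for b
  proof
    assume "meets m \<Theta> (at_depth b u\<^sub>0) z"
    from meets_depth[OF this] obtain b' c u where *: "u \<in> {\<delta><..<1/2}" "at_depth b u\<^sub>0 = at_depth b' u"
      by metis
    then have "radius u\<^sub>0 = radius u" by (metis radius_at_depth)
    then show False using * depth by (auto simp: radius_eq_iff)
  qed
  then show "\<not> meets m \<Theta> x\<^sub>0 z" "\<not> meets m \<Theta> y\<^sub>0 z" using ends_k by auto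
qed

lemma new_not_under: "x\<^sub>0 \<notin> U" "y\<^sub>0 \<notin> U"
  using under_meets new_not_old by blast+

lemma x\<^sub>0_neq_y\<^sub>0: "x\<^sub>0 \<noteq> y\<^sub>0"
  using at_depth_inj[OF ends_k(1,2), of u\<^sub>0 u\<^sub>0] ends_k(3) depth by auto

text \<open>
  The new diagram is of the same kind, with half the collar. Up to depth \<open>\<delta>\<close> its only crossing is the
  new one, where the angles have derivatives of opposite signs with respect to depth; beyond \<open>\<delta>\<close> nothing
  has changed.
\<close>

lemma swapped_layered: "layered_diagram m (\<delta> / 2) e\<^sub>2 \<Theta>\<^sub>2 \<Theta>\<^sub>2' (U \<union> V)"
proof
  show "m \<ge> 1" "0 < \<delta> / 2" "\<delta> / 2 \<le> 1/4" using m_pos depth by auto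
  have "bij_betw (Transposition.transpose k (Suc k)) {..<2 * m} {..<2 * m}"
    using k by (intro permutes_imp_bij permutes_swap_id) auto
  then show "bij_betw e\<^sub>2 {..<2 * m} ({..<m} \<times> {0, 1})" using ends_bij by (rule bij_betw_trans)
next
  fix i t assume "i < m"
  then show "(\<Theta>\<^sub>2 i has_real_derivative \<Theta>\<^sub>2' i t) (at t)"
    using angle_deriv depth by (intro swapped_angle_has_derivative) auto
next
  fix i assume "i < m"
  then show "continuous_on UNIV (\<Theta>\<^sub>2' i)"
    using angle_deriv_cont depth by (intro swapped_angle_deriv_continuous) auto
next
  fix i assume "i < m"
  then show "\<Theta>\<^sub>2' i (1/2) \<noteq> 0"
    using swapped_beyond(2)[of "(i, 0)" "1/2"] turning[of i] depth by (simp add: at_depth_def)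
next
  fix i t assume i: "i < m" and t: "t \<in> {0..1::real}"
  then have it: "(i, t) \<in> {..<m} \<times> {0..1}" by auto
  obtain b u where b: "b \<in> {..<m} \<times> {0, 1}" "u \<in> {0..1/2}" "(i, t) = at_depth b u"
    using at_depth_cases[OF it] .
  then have bi: "fst b = i" "snd (at_depth b u) = t" by (metis fst_at_depth fst_conv, metis snd_conv)
  show "\<Theta>\<^sub>2 i t \<in> {0..2 * real m - 1}"
  proof (cases "u \<le> \<delta>")
    case True
    obtain l where l: "l < 2 * m" "b = e l" using end_cases[OF b(1)] .
    have "\<Theta>\<^sub>2 i t = real l + position_sign l * swap_bump \<delta> u"
      using swapped_collar[OF l(1), of u] True b bi l by auto
    then show ?thesis using collar_bounds[OF swap_bump_bounds l(1)] by simp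
  next
    case False
    then have "\<Theta>\<^sub>2 i t = \<Theta> i t" using swapped_beyond(1)[OF b(1), of u] b bi by auto
    then show ?thesis using angle_range[OF i t] by simp
  qed
next
  fix l u assume l: "l < 2 * m" and u: "u \<in> {0..\<delta> / 2}"
  define l' where "l' = Transposition.transpose k (Suc k) l"
  have l': "l' < 2 * m" "real l' + position_sign l' = real l"
    using l k by (auto simp: l'_def Transposition.transpose_def position_sign_def)
  have u': "u \<in> {0..\<delta>}" using u depth by auto
  have "1 \<le> 2 - 2 * u / \<delta>" using u depth by (simp add: field_simps)
  then have "smooth_step_deriv (2 - 2 * u / \<delta>) = 0" by (rule smooth_step_deriv_values)
  then show "\<Theta>\<^sub>2 (fst (e\<^sub>2 l)) (snd (at_depth (e\<^sub>2 l) u)) = real l \<and>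
      \<Theta>\<^sub>2' (fst (e\<^sub>2 l)) (snd (at_depth (e\<^sub>2 l) u)) = 0"
    using swapped_collar[OF l'(1) u'] swapped_collar_deriv[OF l'(1) u'] l'(2) swap_bump_eq_1[of \<delta> u] u depth
    by (simp add: l'_def)
next
  have "{(x, y). meets m \<Theta>\<^sub>2 x y} = {(x, y). meets m \<Theta> x y} \<union> {(x\<^sub>0, y\<^sub>0), (y\<^sub>0, x\<^sub>0)}"
    by (auto simp: swapped_meets_iff)
  then show "finite {(x, y). meets m \<Theta>\<^sub>2 x y}" using finite_meets by simp
next
  have new: "(2 * snd x\<^sub>0 - 1) * \<Theta>\<^sub>2' (fst y\<^sub>0) (snd y\<^sub>0) \<noteq> (2 * snd y\<^sub>0 - 1) * \<Theta>\<^sub>2' (fst x\<^sub>0) (snd x\<^sub>0)"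
  proof -
    have "2 - 2 * u\<^sub>0 / \<delta> = 1/2" using depth by (simp add: field_simps)
    then have "\<Theta>\<^sub>2' (fst y\<^sub>0) (snd y\<^sub>0) = - (2 * snd q - 1) * (4 / \<delta>)"
      "\<Theta>\<^sub>2' (fst x\<^sub>0) (snd x\<^sub>0) = (2 * snd p - 1) * (4 / \<delta>)"
      using swapped_collar_deriv[of k u\<^sub>0] swapped_collar_deriv[of "Suc k" u\<^sub>0] k depth
      by (simp_all add: position_sign_def smooth_step_deriv_values minus_divide_left)
    moreover define c where "c = (2 * snd p - 1) * (2 * snd q - 1) * (1 - 2 * u\<^sub>0) * (4 / \<delta>)"
    moreover have "2 * snd p - 1 \<noteq> 0" "2 * snd q - 1 \<noteq> 0" using ends_k by auto
    then have "c \<noteq> 0" using depth by (simp add: c_def)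
    moreover note snd_at_depth[OF ends_k(1)] snd_at_depth[OF ends_k(2)]
    ultimately have "(2 * snd x\<^sub>0 - 1) * \<Theta>\<^sub>2' (fst y\<^sub>0) (snd y\<^sub>0) = - c"
      "(2 * snd y\<^sub>0 - 1) * \<Theta>\<^sub>2' (fst x\<^sub>0) (snd x\<^sub>0) = c"
      by (simp_all only: mult.commute mult.left_commute mult_minus_left mult_minus_right)
    then show ?thesis using \<open>c \<noteq> 0\<close> by simp
  qed
  fix x y assume "meets m \<Theta>\<^sub>2 x y"
  then consider "meets m \<Theta> x y" | "x = x\<^sub>0" "y = y\<^sub>0" | "x = y\<^sub>0" "y = x\<^sub>0"
    by (auto simp: swapped_meets_iff)
  then show "(2 * snd x - 1) * \<Theta>\<^sub>2' (fst y) (snd y) \<noteq> (2 * snd y - 1) * \<Theta>\<^sub>2' (fst x) (snd x)"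
  proof cases
    case 1
    from meets_depth[OF 1] obtain b c u where b: "b \<in> {..<m} \<times> {0, 1}" "c \<in> {..<m} \<times> {0, 1}"
      "u \<in> {\<delta><..<1/2}" "x = at_depth b u" "y = at_depth c u" .
    then have "\<Theta>\<^sub>2' (fst x) (snd x) = \<Theta>' (fst x) (snd x)" "\<Theta>\<^sub>2' (fst y) (snd y) = \<Theta>' (fst y) (snd y)"
      using swapped_beyond(2)[of _ u] by auto
    then show ?thesis using meets_transverse[OF 1] by simp
  qed (use new in simp_all)
next
  fix x y z assume "meets m \<Theta>\<^sub>2 x y" "meets m \<Theta>\<^sub>2 x z"
  then show "y = z" using meets_double new_not_old x\<^sub>0_neq_y\<^sub>0 unfolding swapped_meets_iff
    by (metis prod.inject)
next
  fix x assume "x \<in> U \<union> V"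
  then have "x \<in> U \<or> x = x\<^sub>0 \<or> x = y\<^sub>0" using V by auto
  then show "\<exists>y. meets m \<Theta>\<^sub>2 x y" using under_meets unfolding swapped_meets_iff by blast
next
  fix x y assume "meets m \<Theta>\<^sub>2 x y"
  then consider "meets m \<Theta> x y" | "x = x\<^sub>0" "y = y\<^sub>0" | "x = y\<^sub>0" "y = x\<^sub>0"
    by (auto simp: swapped_meets_iff)
  then show "\<not> (x \<in> U \<union> V \<and> y \<in> U \<union> V)"
  proof cases
    case 1
    then have "x \<notin> V" "y \<notin> V" using V new_not_old meets_sym[OF 1] by blast+
    then show ?thesis using not_both_under[OF 1] by blast
  qed (use V new_not_under x\<^sub>0_neq_y\<^sub>0 in auto)
qed

end

section \<open>Removing a crossing at the boundary\<close>

lemma polar_at_depth [simp]: "polar m (snd (at_depth b u)) a = polar m u a"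
  by (simp add: polar_def)

lemma continuous_on_polar:
  assumes "continuous_on S f" "continuous_on S g"
  shows "continuous_on S (\<lambda>z. polar m (f z) (g z))"
proof (cases "m = 0")
  case True
  then show ?thesis unfolding polar_def rcis_def radius_def by (simp, intro continuous_intros assms)
next
  case False
  then show ?thesis
    unfolding polar_def rcis_def radius_def by (intro continuous_intros assms) simp
qed

lemma continuous_on_smooth_step:
  "continuous_on S f \<Longrightarrow> continuous_on S (\<lambda>z. smooth_step (f z))"
proof (rule continuous_on_compose2[of UNIV smooth_step])
  show "continuous_on UNIV smooth_step"
    by (intro continuous_at_imp_continuous_on ballI DERIV_isCont[OF smooth_step_has_derivative])
qed auto

lemma end_segment_at_depth:
  assumes "b \<in> {..<m} \<times> {0, 1}" "0 \<le> v"
  shows "end_segment b (snd (at_depth b v)) = at_depth b ` {0..v}"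
proof -
  have "snd b = 0 \<or> snd b = 1" using assms(1) by auto
  then show ?thesis
  proof
    assume b: "snd b = 0"
    have "closed_segment 0 v = {0..v}" using assms(2) by (simp add: closed_segment_eq_real_ivl)
    then show ?thesis using b by (auto simp: end_segment_def at_depth_def)
  next
    assume b: "snd b = 1"
    have "closed_segment 1 (1 - v) = (\<lambda>u. 1 - u) ` {0..v}"
      using assms(2) by (simp add: closed_segment_eq_real_ivl)
    then have "end_segment b (snd (at_depth b v)) = {fst b} \<times> (\<lambda>u. 1 - u) ` {0..v}"
      using b by (simp only: end_segment_def at_depth_def) simp
    also have "\<dots> = at_depth b ` {0..v}"
    proof -
      have "at_depth b = (\<lambda>u. (fst b, 1 - u))" using b by (simp add: at_depth_def fun_eq_iff)
      moreover have "{i} \<times> f ` S = (\<lambda>u. (i, f u)) ` S" for i :: nat and f :: "real \<Rightarrow> real" and S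
        by auto
      ultimately show ?thesis by (simp only:)
    qed
    finally show ?thesis .
  qed
qed

lemma standard_triangle:
  "convex hull {0, 1, \<i>} = {z. 0 \<le> Re z \<and> 0 \<le> Im z \<and> Re z + Im z \<le> 1}"
proof (intro set_eqI iffI)
  fix z assume "z \<in> convex hull {0, 1, \<i>}"
  then show "z \<in> {z. 0 \<le> Re z \<and> 0 \<le> Im z \<and> Re z + Im z \<le> 1}"
    unfolding convex_hull_3 by auto
next
  fix z assume "z \<in> {z. 0 \<le> Re z \<and> 0 \<le> Im z \<and> Re z + Im z \<le> 1}"
  then show "z \<in> convex hull {0, 1, \<i>}"
    unfolding convex_hull_3
    by (intro CollectI exI[of _ "1 - Re z - Im z"] exI[of _ "Re z"] exI[of _ "Im z"])
       (auto simp: complex_eq_iff)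
qed

lemma interior_standard_triangle:
  assumes "z \<in> interior (convex hull {0, 1, \<i>})"
  shows "0 < Re z" "0 < Im z" "Re z + Im z < 1"
proof -
  obtain r where r: "r > 0" "ball z r \<subseteq> convex hull {0, 1, \<i>}"
    using assms by (auto simp: mem_interior)
  have "z + w \<in> {z. 0 \<le> Re z \<and> 0 \<le> Im z \<and> Re z + Im z \<le> 1}" if "norm w < r" for w
  proof -
    have "z + w \<in> ball z r" using that by (simp add: dist_norm)
    with r(2) show ?thesis unfolding standard_triangle by blast
  qed
  from this[of "of_real (- r / 2)"] this[of "\<i> * of_real (- r / 2)"] this[of "of_real (r / 2)"]
  show "0 < Re z" "0 < Im z" "Re z + Im z < 1" using r(1) by (simp_all add: norm_mult)
qed

text \<open>
  The continuous extension of \<open>(2 * smooth_step (2 - 3 * y / 2) - 1) / (1 - y)\<close> to \<open>{0..1}\<close>: the angle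
  between the two strands at the height \<open>y\<close> of the boundary triangle, divided by the width \<open>1 - y\<close> of the
  standard triangle there. It is positive at \<open>y = 1\<close> too, because the strands cross
  transversally at the apex.
\<close>

definition triangle_width :: "real \<Rightarrow> real" where
  "triangle_width y = 1 / (1 - min y (2/3)) + 9 * max 0 (y - 2/3)"

lemma triangle_width_pos: "triangle_width y > 0"
proof -
  have "0 < 1 - min y (2/3)" by (simp add: min_def)
  then show ?thesis unfolding triangle_width_def by (intro add_pos_nonneg divide_pos_pos) auto
qed

lemma triangle_width_eq:
  assumes "0 \<le> y" "y \<le> 1"
  shows "(1 - y) * triangle_width y = 2 * smooth_step (2 - 3 * y / 2) - 1"
proof (cases "y \<le> 2/3")
  case True
  then have "smooth_step (2 - 3 * y / 2) = 1" by (simp add: smooth_step_values)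
  then show ?thesis using True by (simp add: triangle_width_def)
next
  case False
  then have "smooth_step (2 - 3 * y / 2) = 1 - 2 * (1 - (2 - 3 * y / 2))\<^sup>2"
    using assms by (intro smooth_step_values(3)) auto
  then show ?thesis using False
    by (simp add: triangle_width_def power2_eq_square algebra_simps)
qed

lemma continuous_on_triangle_width:
  assumes "continuous_on S f"
  shows "continuous_on S (\<lambda>z. triangle_width (f z))"
proof -
  have "1 - min (f z) (2/3) \<noteq> 0" for z by (simp add: min_def)
  then show ?thesis unfolding triangle_width_def by (intro continuous_intros assms) auto
qed

context end_swap
begin

sublocale swapped: layered_diagram m "\<delta> / 2" e\<^sub>2 \<Theta>\<^sub>2 \<Theta>\<^sub>2' "U \<union> V"
  by (rule swapped_layered)

abbreviation "T\<^sub>2 \<equiv> polar_diagram m \<Theta>\<^sub>2 (U \<union> V)"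

lemma swapped_pt_collar:
  assumes "u \<in> {0..\<delta>}"
  shows "pt T\<^sub>2 (at_depth p u) = polar m u (real k + swap_bump \<delta> u)"
    "pt T\<^sub>2 (at_depth q u) = polar m u (real k + 1 - swap_bump \<delta> u)"
  using swapped_collar[OF _ assms, of k] swapped_collar[OF _ assms, of "Suc k"] k
  by (simp_all add: position_sign_def add.commute[of 1])

lemma pt_collar:
  assumes "u \<in> {0..\<delta>}"
  shows "pt T (at_depth p u) = polar m u (real k)"
    "pt T (at_depth q u) = polar m u (real k + 1)"
  using collar[OF _ assms, of k] collar[OF _ assms, of "Suc k"] k
  by (simp_all add: add.commute[of 1])

text \<open>
  In the polar rectangle around the two ends, the diagram only consists of these two strands: all other
  strands have integer angles there, which lie outside \<open>{k - 1/4..k + 5/4}\<close>.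
\<close>

lemma swapped_pt_in_strip:
  assumes z: "z \<in> {..<m} \<times> {0..1}" and eq: "pt T\<^sub>2 z = polar m u a"
    and u: "u \<in> {0..\<delta>}" and a: "real k - 1/4 \<le> a" "a \<le> real k + 5/4"
  shows "z = at_depth p u \<and> a = real k + swap_bump \<delta> u \<or>
         z = at_depth q u \<and> a = real k + 1 - swap_bump \<delta> u"
proof -
  obtain b u' where b: "b \<in> {..<m} \<times> {0, 1}" "u' \<in> {0..1/2}" "z = at_depth b u'"
    using at_depth_cases[OF z] .
  obtain l where l: "l < 2 * m" "b = e l" using end_cases[OF b(1)] .
  have z': "fst z < m" "snd z \<in> {0..1}" using z by auto
  have "\<Theta>\<^sub>2 (fst z) (snd z) \<in> {-1..2 * real m}" using swapped.angle_range[OF z'] by auto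
  moreover have "polar m u' (\<Theta>\<^sub>2 (fst z) (snd z)) = polar m u a"
    using eq b(3) by simp
  moreover have "a \<in> {-1..2 * real m}" using a k by auto
  ultimately have ua: "u' = u" "\<Theta>\<^sub>2 (fst z) (snd z) = a"
    using polar_eq_iff_near_end[OF m_pos, of _ a u' u] b(2) u depth by auto
  have "a = real l + position_sign l * swap_bump \<delta> u"
    using swapped_collar[OF l(1) u] ua b l by simp
  moreover have "l = k \<or> l = Suc k"
  proof (rule ccontr)
    assume "\<not> (l = k \<or> l = Suc k)"
    then have "a = real l" "l < k \<or> Suc k < l"
      using calculation by (auto simp: position_sign_def)
    then show False using a by auto
  qed
  ultimately show ?thesis using ua b l by (auto simp: position_sign_def)
qed

text \<open>
  The disk in which the new crossing is removed: the polar rectangle of the collar around the two ends.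
  Its margins of \<open>1/4\<close> in the angle keep clear of the neighbouring strands, at \<open>k - 1\<close> and \<open>k + 2\<close>.
\<close>

definition strip :: "complex set" where
  "strip = (\<lambda>z. polar m (Re z) (Im z)) ` cbox (Complex 0 (real k - 1/4)) (Complex \<delta> (real k + 5/4))"

lemma strip_iff:
  "w \<in> strip \<longleftrightarrow> (\<exists>u a. w = polar m u a \<and> u \<in> {0..\<delta>} \<and> real k - 1/4 \<le> a \<and> a \<le> real k + 5/4)"
proof
  assume "w \<in> strip"
  then obtain z where "w = polar m (Re z) (Im z)"
    "z \<in> cbox (Complex 0 (real k - 1/4)) (Complex \<delta> (real k + 5/4))"
    unfolding strip_def by blast
  then show "\<exists>u a. w = polar m u a \<and> u \<in> {0..\<delta>} \<and> real k - 1/4 \<le> a \<and> a \<le> real k + 5/4"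
    by (intro exI[of _ "Re z"] exI[of _ "Im z"]) (auto simp: in_cbox_complex_iff)
next
  assume "\<exists>u a. w = polar m u a \<and> u \<in> {0..\<delta>} \<and> real k - 1/4 \<le> a \<and> a \<le> real k + 5/4"
  then obtain u a where "w = polar m u a" "u \<in> {0..\<delta>}" "real k - 1/4 \<le> a" "a \<le> real k + 5/4"
    by blast
  then show "w \<in> strip"
    unfolding strip_def by (intro image_eqI[of _ _ "Complex u a"]) (auto simp: in_cbox_complex_iff)
qed

lemma strip_memI:
  "u \<in> {0..\<delta>} \<Longrightarrow> real k - 1/4 \<le> a \<Longrightarrow> a \<le> real k + 5/4 \<Longrightarrow> polar m u a \<in> strip"
  unfolding strip_iff by blast

lemma strip_homeomorphic: "strip homeomorphic cball (0::complex) 1"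
proof -
  let ?R = "cbox (Complex 0 (real k - 1/4)) (Complex \<delta> (real k + 5/4))"
  have "inj_on (\<lambda>z. polar m (Re z) (Im z)) ?R"
  proof (rule inj_onI)
    fix z w assume "z \<in> ?R" "w \<in> ?R" and eq: "polar m (Re z) (Im z) = polar m (Re w) (Im w)"
    then have *: "Re x \<in> {0..1/2} \<and> Im x \<in> {-1..2 * real m}" if "x = z \<or> x = w" for x
      using that k depth by (auto simp: in_cbox_complex_iff)
    then show "z = w"
      using polar_eq_iff_near_end[OF m_pos, of "Im z" "Im w" "Re z" "Re w"] eq *[of z] *[of w]
      by (simp add: complex_eq_iff)
  qed
  moreover have "continuous_on ?R (\<lambda>z. polar m (Re z) (Im z))"
    by (intro continuous_on_polar continuous_intros)
  ultimately have "?R homeomorphic strip"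
    using homeomorphic_compact[OF compact_cbox] strip_def by metis
  moreover have "?R homeomorphic cball (0::complex) 1"
  proof (rule homeomorphic_convex_compact_cball)
    have "Complex (\<delta> / 2) (real k) \<in> interior ?R"
      using depth by (simp add: interior_cbox in_box_complex_iff)
    then show "interior ?R \<noteq> {}" by blast
  qed auto
  ultimately show ?thesis by (meson homeomorphic_sym homeomorphic_trans)
qed

text \<open>
  Horizontal lines of the standard triangle go to circular arcs between the two strands, linearly in the
  angle. The side from \<open>0\<close> to \<open>\<i>\<close> follows the strand of \<open>p\<close>, the side from \<open>1\<close> to \<open>\<i>\<close> that of \<open>q\<close>.
\<close>

definition triangle_map :: "complex \<Rightarrow> complex" where
  "triangle_map z = polar m (u\<^sub>0 * Im z)
     (real k + swap_bump \<delta> (u\<^sub>0 * Im z) - Re z * triangle_width (Im z))"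

lemma bump_triangle: "swap_bump \<delta> (u\<^sub>0 * y) = smooth_step (2 - 3 * y / 2)"
  using depth by (simp add: swap_bump_def)

lemma triangle_angle_bounds:
  assumes "0 \<le> x" "0 \<le> y" "x + y \<le> 1"
  shows "real k + 1 - swap_bump \<delta> (u\<^sub>0 * y) \<le> real k + swap_bump \<delta> (u\<^sub>0 * y) - x * triangle_width y"
    "real k + swap_bump \<delta> (u\<^sub>0 * y) - x * triangle_width y \<le> real k + swap_bump \<delta> (u\<^sub>0 * y)"
    "x + y < 1 \<Longrightarrow>
      real k + 1 - swap_bump \<delta> (u\<^sub>0 * y) < real k + swap_bump \<delta> (u\<^sub>0 * y) - x * triangle_width y"
    "0 < x \<Longrightarrow>
      real k + swap_bump \<delta> (u\<^sub>0 * y) - x * triangle_width y < real k + swap_bump \<delta> (u\<^sub>0 * y)"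
proof -
  have w: "(1 - y) * triangle_width y = 2 * swap_bump \<delta> (u\<^sub>0 * y) - 1"
    using triangle_width_eq[of y] assms unfolding bump_triangle by simp
  have "x * triangle_width y \<le> (1 - y) * triangle_width y"
    using assms triangle_width_pos[of y] by (intro mult_right_mono) auto
  then show "real k + 1 - swap_bump \<delta> (u\<^sub>0 * y) \<le> real k + swap_bump \<delta> (u\<^sub>0 * y) - x * triangle_width y"
    unfolding w by simp
  show "real k + 1 - swap_bump \<delta> (u\<^sub>0 * y) < real k + swap_bump \<delta> (u\<^sub>0 * y) - x * triangle_width y"
    if "x + y < 1"
  proof -
    have "x * triangle_width y < (1 - y) * triangle_width y"
      using that triangle_width_pos[of y] by (intro mult_strict_right_mono) auto
    then show ?thesis unfolding w by simp
  qed
qed (use assms triangle_width_pos[of y] in auto)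

lemma triangle_map_region:
  assumes "0 \<le> x" "0 \<le> y" "x + y \<le> 1"
  shows "u\<^sub>0 * y \<in> {0..\<delta>}"
    "real k \<le> real k + swap_bump \<delta> (u\<^sub>0 * y) - x * triangle_width y"
    "real k + swap_bump \<delta> (u\<^sub>0 * y) - x * triangle_width y \<le> real k + 1"
proof -
  have "u\<^sub>0 * y \<le> u\<^sub>0 * 1" using assms depth by (intro mult_left_mono) auto
  then show "u\<^sub>0 * y \<in> {0..\<delta>}" using assms depth by auto
qed (use triangle_angle_bounds(1,2)[OF assms] swap_bump_bounds[of \<delta> "u\<^sub>0 * y"] in linarith)+

lemma u\<^sub>0_depth: "u\<^sub>0 \<in> {0..\<delta>}" "0 \<le> u\<^sub>0"
  using depth by auto

lemma image_scaled_interval: "(\<lambda>y. u\<^sub>0 * y) ` {0..1} = {0..u\<^sub>0}"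
  using depth by (subst image_mult_atLeastAtMost) auto

lemma swapped_triangle: "boundary_triangle T\<^sub>2 p (snd x\<^sub>0) q (snd y\<^sub>0) triangle_map"
  unfolding boundary_triangle_def
proof (intro conjI)
  let ?D = "convex hull {0, 1, \<i>}"
  show "p \<in> ends T\<^sub>2" "q \<in> ends T\<^sub>2" "p \<noteq> q" using ends_k by auto
  have "(fst p, snd x\<^sub>0) = x\<^sub>0" "(fst q, snd y\<^sub>0) = y\<^sub>0" by (simp_all add: at_depth_def)
  then show "crossing_pair T\<^sub>2 (fst p, snd x\<^sub>0) (fst q, snd y\<^sub>0)"
    by (simp add: swapped.crossing_pair_iff swapped_meets_iff)
  show "continuous_on ?D triangle_map"
    unfolding triangle_map_def bump_triangle
    by (intro continuous_on_polar continuous_on_smooth_step continuous_on_triangle_width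
        continuous_intros) auto
  show "inj_on triangle_map ?D"
  proof (rule inj_onI)
    fix z w assume zw: "z \<in> ?D" "w \<in> ?D" and eq: "triangle_map z = triangle_map w"
    define A where "A x = real k + swap_bump \<delta> (u\<^sub>0 * Im x) - Re x * triangle_width (Im x)" for x
    have *: "u\<^sub>0 * Im x \<in> {0..1/2} \<and> A x \<in> {-1..2 * real m}" if "x = z \<or> x = w" for x
    proof -
      have "0 \<le> Re x" "0 \<le> Im x" "Re x + Im x \<le> 1" using that zw unfolding standard_triangle by auto
      note region = triangle_map_region[OF this]
      have "u\<^sub>0 * Im x \<in> {0..1/2}" using region(1) depth(2) unfolding atLeastAtMost_iff by linarith
      moreover have "A x \<in> {-1..2 * real m}" using region(2,3) k unfolding A_def atLeastAtMost_iff by linarith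
      ultimately show ?thesis ..
    qed
    have "u\<^sub>0 * Im z = u\<^sub>0 * Im w \<and> A z = A w"
      using polar_eq_iff_near_end[OF m_pos, of "A z" "A w" "u\<^sub>0 * Im z" "u\<^sub>0 * Im w"]
        *[of z] *[of w] eq unfolding triangle_map_def A_def by blast
    then have "Im z = Im w" "A z = A w" using depth by auto
    then have "Im z = Im w" "Re z = Re w"
      using triangle_width_pos[of "Im w"] by (auto simp: A_def)
    then show "z = w" by (simp add: complex_eq_iff)
  qed
  show "triangle_map ` ?D \<subseteq> cball 0 1"
  proof
    fix w assume "w \<in> triangle_map ` ?D"
    then obtain z where z: "z \<in> ?D" "w = triangle_map z" by blast
    then have "u\<^sub>0 * Im z \<in> {0..\<delta>}"
      by (intro triangle_map_region(1)[of "Re z"]) (auto simp: standard_triangle)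
    then have "radius (u\<^sub>0 * Im z) \<le> 1"
      using depth(2) unfolding atLeastAtMost_iff by (intro radius_le_1) linarith+
    then show "w \<in> cball 0 1" unfolding z(2) triangle_map_def mem_cball_0 norm_polar .
  qed
  show "triangle_map ` closed_segment 0 \<i> = pt T\<^sub>2 ` end_segment p (snd x\<^sub>0)"
  proof -
    have "triangle_map ` closed_segment 0 \<i> = (\<lambda>y. triangle_map (y *\<^sub>R \<i>)) ` {0..1}"
      unfolding closed_segment_def by auto
    also have "\<dots> = (\<lambda>y. pt T\<^sub>2 (at_depth p (u\<^sub>0 * y))) ` {0..1}"
    proof (intro image_cong refl)
      fix y :: real assume "y \<in> {0..1}"
      then have "u\<^sub>0 * y \<in> {0..\<delta>}" using triangle_map_region(1)[of 0 y] by auto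
      then show "triangle_map (y *\<^sub>R \<i>) = pt T\<^sub>2 (at_depth p (u\<^sub>0 * y))"
        by (subst swapped_pt_collar(1)) (auto simp: triangle_map_def)
    qed
    also have "\<dots> = pt T\<^sub>2 ` at_depth p ` (\<lambda>y. u\<^sub>0 * y) ` {0..1}" by (simp only: image_image)
    finally show ?thesis
      unfolding image_scaled_interval end_segment_at_depth[OF ends_k(1) u\<^sub>0_depth(2)] .
  qed
  show "triangle_map ` closed_segment 1 \<i> = pt T\<^sub>2 ` end_segment q (snd y\<^sub>0)"
  proof -
    have "triangle_map ` closed_segment 1 \<i> = (\<lambda>y. triangle_map (Complex (1 - y) y)) ` {0..1}"
    proof -
      have "(1 - y) *\<^sub>R 1 + y *\<^sub>R \<i> = Complex (1 - y) y" for y by (simp add: complex_eq_iff)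
      then show ?thesis unfolding closed_segment_def by auto
    qed
    also have "\<dots> = (\<lambda>y. pt T\<^sub>2 (at_depth q (u\<^sub>0 * y))) ` {0..1}"
    proof (intro image_cong refl)
      fix y :: real assume y: "y \<in> {0..1}"
      then have "u\<^sub>0 * y \<in> {0..\<delta>}" using triangle_map_region(1)[of 0 y] by auto
      then have "pt T\<^sub>2 (at_depth q (u\<^sub>0 * y)) = polar m (u\<^sub>0 * y) (real k + 1 - swap_bump \<delta> (u\<^sub>0 * y))"
        by (rule swapped_pt_collar(2))
      moreover have "(1 - y) * triangle_width y = 2 * swap_bump \<delta> (u\<^sub>0 * y) - 1"
        using triangle_width_eq[of y] y unfolding bump_triangle by simp
      then have "real k + swap_bump \<delta> (u\<^sub>0 * y) - (1 - y) * triangle_width y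
               = real k + 1 - swap_bump \<delta> (u\<^sub>0 * y)" by simp
      ultimately show "triangle_map (Complex (1 - y) y) = pt T\<^sub>2 (at_depth q (u\<^sub>0 * y))"
        unfolding triangle_map_def by (simp only: complex.sel)
    qed
    also have "\<dots> = pt T\<^sub>2 ` at_depth q ` (\<lambda>y. u\<^sub>0 * y) ` {0..1}" by (simp only: image_image)
    finally show ?thesis
      unfolding image_scaled_interval end_segment_at_depth[OF ends_k(2) u\<^sub>0_depth(2)] .
  qed
  show "triangle_map ` closed_segment 0 1 \<subseteq> sphere 0 1"
  proof
    fix w assume "w \<in> triangle_map ` closed_segment 0 1"
    then obtain x where "w = triangle_map (of_real x)"
      unfolding closed_segment_def by (auto simp: scaleR_conv_of_real)
    then show "w \<in> sphere 0 1" by (simp add: triangle_map_def radius_def)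
  qed
  show "triangle_map ` interior ?D \<inter> pt T\<^sub>2 ` params T\<^sub>2 = {}"
  proof (rule ccontr)
    assume "triangle_map ` interior ?D \<inter> pt T\<^sub>2 ` params T\<^sub>2 \<noteq> {}"
    then obtain z x where z: "z \<in> interior ?D" and x: "x \<in> {..<m} \<times> {0..1}"
      and eq: "pt T\<^sub>2 x = triangle_map z" unfolding disjoint_iff swapped.T_simps(5) by blast
    note int = interior_standard_triangle[OF z]
    define a where "a = real k + swap_bump \<delta> (u\<^sub>0 * Im z) - Re z * triangle_width (Im z)"
    have le: "0 \<le> Re z" "0 \<le> Im z" "Re z + Im z \<le> 1" using int by auto
    note reg = triangle_map_region[OF le] and bnd = triangle_angle_bounds[OF le]
    have "a = real k + swap_bump \<delta> (u\<^sub>0 * Im z) \<or> a = real k + 1 - swap_bump \<delta> (u\<^sub>0 * Im z)"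
      using swapped_pt_in_strip[OF x, of "u\<^sub>0 * Im z" a] eq reg
      unfolding triangle_map_def a_def[symmetric] by auto
    then show False using bnd(3,4) int unfolding a_def[symmetric] by auto
  qed
qed

text \<open>
  The old diagram itself is the result of the move: it agrees with the new one outside the collar of the
  two ends, and inside it consists of two radial segments.
\<close>

lemma swapped_reduces: "removes_boundary_crossing T\<^sub>2 x\<^sub>0 y\<^sub>0 T"
  unfolding removes_boundary_crossing_def Let_def
proof (intro exI conjI)
  let ?s' = "snd (at_depth p \<delta>)" and ?t' = "snd (at_depth q \<delta>)"
  let ?S = "end_segment p ?s' \<union> end_segment q ?t'"
  have depth0: "0 \<le> \<delta>" using depth by simp
  note seg = end_segment_at_depth[OF ends_k(1) depth0] end_segment_at_depth[OF ends_k(2) depth0]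
  show "x\<^sub>0 = (fst p, snd x\<^sub>0)" "y\<^sub>0 = (fst q, snd y\<^sub>0)" by (simp_all add: at_depth_def)
  show "boundary_triangle T\<^sub>2 p (snd x\<^sub>0) q (snd y\<^sub>0) triangle_map" by (rule swapped_triangle)
  show "strip \<subseteq> cball 0 1"
    using depth by (auto simp: strip_iff radius_le_1)
  show "strip homeomorphic cball (0::complex) 1" by (rule strip_homeomorphic)
  show "triangle_map ` (convex hull {0, 1, \<i>}) \<subseteq> strip"
  proof
    fix w assume "w \<in> triangle_map ` (convex hull {0, 1, \<i>})"
    then obtain z where z: "z \<in> convex hull {0, 1, \<i>}" "w = triangle_map z" by blast
    then show "w \<in> strip"
      using triangle_map_region[of "Re z" "Im z"] unfolding standard_triangle strip_iff triangle_map_def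
      by (intro exI conjI) auto
  qed
  have inside: "snd (at_depth b \<delta>) \<in> {0<..<1}"
    "snd (at_depth b u\<^sub>0) \<in> open_segment (snd b) (snd (at_depth b \<delta>))"
    if "b \<in> {..<m} \<times> {0, 1}" for b
    using that depth by (auto simp: at_depth_def open_segment_eq_real_ivl)
  show "?s' \<in> {0<..<1}" "?t' \<in> {0<..<1}"
    "snd x\<^sub>0 \<in> open_segment (snd p) ?s'" "snd y\<^sub>0 \<in> open_segment (snd q) ?t'"
    by (intro inside ends_k)+
  show "end_segment p ?s' \<inter> end_segment q ?t' = {}"
  proof (rule ccontr)
    assume "end_segment p ?s' \<inter> end_segment q ?t' \<noteq> {}"
    then obtain w where "w \<in> at_depth p ` {0..\<delta>}" "w \<in> at_depth q ` {0..\<delta>}"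
      unfolding seg by blast
    then obtain u u' where "u \<in> {0..\<delta>}" "u' \<in> {0..\<delta>}" "at_depth p u = at_depth q u'"
      by (elim imageE) simp
    then show False using at_depth_inj[OF ends_k(1,2), of u u'] ends_k(3) depth by auto
  qed
  show "\<forall>z\<in>params T\<^sub>2. (pt T\<^sub>2 z \<in> strip) = (z \<in> ?S)"
  proof
    fix z assume "z \<in> params T\<^sub>2"
    then have z: "z \<in> {..<m} \<times> {0..1}" by simp
    show "(pt T\<^sub>2 z \<in> strip) = (z \<in> ?S)"
    proof
      assume "pt T\<^sub>2 z \<in> strip"
      then obtain u a where "pt T\<^sub>2 z = polar m u a" "u \<in> {0..\<delta>}"
        "real k - 1/4 \<le> a" "a \<le> real k + 5/4" unfolding strip_iff by blast
      from swapped_pt_in_strip[OF z this] this(2) show "z \<in> ?S" unfolding seg by auto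
    next
      assume "z \<in> ?S"
      then obtain u where u: "u \<in> {0..\<delta>}" "z = at_depth p u \<or> z = at_depth q u" unfolding seg by auto
      then show "pt T\<^sub>2 z \<in> strip"
        using swapped_pt_collar[OF u(1)] swap_bump_bounds[of \<delta> u]
        by (auto simp del: swapped.T_simps intro!: strip_memI[OF u(1)])
    qed
  qed
  show "\<forall>z\<in>?S. \<forall>w\<in>?S. crossing_pair T\<^sub>2 z w \<longrightarrow> {z, w} = {x\<^sub>0, y\<^sub>0}"
  proof (intro ballI impI)
    fix z w assume z: "z \<in> ?S" and zw: "crossing_pair T\<^sub>2 z w"
    obtain u b where u: "u \<in> {0..\<delta>}" "z = at_depth b u" using z unfolding seg by blast
    have "\<not> meets m \<Theta> z w"
    proof
      assume "meets m \<Theta> z w"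
      from meets_depth[OF this] obtain b' c u' where *: "u' \<in> {\<delta><..<1/2}" "z = at_depth b' u'"
        by metis
      then have "radius u = radius u'" using u by (metis radius_at_depth)
      then show False using * u depth by (auto simp: radius_eq_iff)
    qed
    then show "{z, w} = {x\<^sub>0, y\<^sub>0}" using zw by (auto simp: swapped.crossing_pair_iff swapped_meets_iff)
  qed
  show "nstr T = nstr T\<^sub>2" by simp
  show "\<forall>z\<in>params T\<^sub>2 - ?S. pt T z = pt T\<^sub>2 z"
  proof
    fix z assume "z \<in> params T\<^sub>2 - ?S"
    then have z: "z \<in> {..<m} \<times> {0..1}" "z \<notin> ?S" by auto
    obtain b u where b: "b \<in> {..<m} \<times> {0, 1}" "u \<in> {0..1/2}" "z = at_depth b u"
      using at_depth_cases[OF z(1)] .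
    show "pt T z = pt T\<^sub>2 z"
    proof (cases "u \<le> \<delta>")
      case False
      then show ?thesis using b swapped_beyond(1)[OF b(1), of u] by simp
    next
      case True
      then have u: "u \<in> {0..\<delta>}" using b by auto
      obtain l where l: "l < 2 * m" "b = e l" using end_cases[OF b(1)] .
      have "l \<noteq> k" "l \<noteq> Suc k" using z(2) u b l unfolding seg by auto
      then show ?thesis using swapped_collar[OF l(1) u] collar[OF l(1) u] b l
        by (simp add: position_sign_def)
    qed
  qed
  show "pt T ` ?S \<subseteq> strip"
  proof
    fix w assume "w \<in> pt T ` ?S"
    then obtain u where u: "u \<in> {0..\<delta>}" "w = pt T (at_depth p u) \<or> w = pt T (at_depth q u)"
      unfolding seg by auto
    then show "w \<in> strip"
      using pt_collar[OF u(1)] by (auto simp del: T_simps intro!: strip_memI[OF u(1)])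
  qed
  show "inj_on (pt T) ?S"
  proof (rule inj_onI)
    fix z w assume zw: "z \<in> ?S" "w \<in> ?S" "pt T z = pt T w"
    have S_params: "x \<in> {..<m} \<times> {0..1}" if "x \<in> ?S" for x
      using that ends_k depth unfolding seg by (auto simp: at_depth_def)
    obtain u b where u: "u \<in> {0..\<delta>}" "z = at_depth b u" using zw(1) unfolding seg by blast
    show "z = w"
    proof (rule ccontr)
      assume "z \<noteq> w"
      then have "crossing_pair T z w" using zw S_params unfolding crossing_pair_def by auto
      then have "meets m \<Theta> z w" by (simp add: crossing_pair_iff)
      from meets_depth[OF this] obtain b' c u' where *: "u' \<in> {\<delta><..<1/2}" "z = at_depth b' u'"
        by metis
      then have "radius u = radius u'" using u by (metis radius_at_depth)
      then show False using * u depth by (auto simp: radius_eq_iff)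
    qed
  qed
  have "swap_bump \<delta> 0 = 1" using depth by (intro swap_bump_eq_1) auto
  then show "pt T p = pt T\<^sub>2 q" "pt T q = pt T\<^sub>2 p"
    using swapped_pt_collar[of 0] pt_collar[of 0] depth ends_k by simp_all
  show "under T = under T\<^sub>2 - {x\<^sub>0, y\<^sub>0}" using V new_not_under by auto
qed

lemma swapped_step: "reduction_step T\<^sub>2 T"
proof -
  have "move_a T\<^sub>2 T \<or> move_b T\<^sub>2 T"
    unfolding move_a_def move_b_def using swapped_reduces by blast
  then show ?thesis unfolding reduction_step_def using is_tangle_diagram swapped.is_tangle_diagram by blast
qed

lemma swapped_virtual_crossings:
  "virtual_crossings T\<^sub>2 \<subseteq> virtual_crossings T \<union> (if V = {} then {pt T\<^sub>2 x\<^sub>0} else {})"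
proof
  fix w assume "w \<in> virtual_crossings T\<^sub>2"
  then obtain x y where xy: "w = pt T\<^sub>2 x" "crossing_pair T\<^sub>2 x y" "x \<notin> U \<union> V" "y \<notin> U \<union> V"
    unfolding virtual_crossings_def by auto
  show "w \<in> virtual_crossings T \<union> (if V = {} then {pt T\<^sub>2 x\<^sub>0} else {})"
  proof (cases "meets m \<Theta> x y")
    case True
    from meets_depth[OF True] obtain b c u where b: "b \<in> {..<m} \<times> {0, 1}" "c \<in> {..<m} \<times> {0, 1}"
      "u \<in> {\<delta><..<1/2}" "x = at_depth b u" "y = at_depth c u" .
    then have "w = pt T x" using swapped_beyond(1)[OF b(1), of u] xy(1) by simp
    moreover have "crossing_pair T x y" using True by (simp add: crossing_pair_iff)
    moreover have "x \<notin> under T" "y \<notin> under T" using xy(3,4) by simp_all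
    ultimately have "w \<in> virtual_crossings T" unfolding virtual_crossings_def by blast
    then show ?thesis by simp
  next
    case False
    then have "x = x\<^sub>0 \<and> y = y\<^sub>0 \<or> x = y\<^sub>0 \<and> y = x\<^sub>0"
      using xy by (auto simp: swapped.crossing_pair_iff swapped_meets_iff)
    then have "V = {}" "w = pt T\<^sub>2 x\<^sub>0" using V xy unfolding crossing_pair_def by auto
    then show ?thesis by simp
  qed
qed

end

section \<open>Strings without crossings\<close>

definition uncrossed_angle :: "nat \<Rightarrow> real \<Rightarrow> real" where
  "uncrossed_angle i t = 2 * real i + smooth_step (2 * t - 1/2)"

definition uncrossed_end :: "nat \<Rightarrow> nat \<times> real" where
  "uncrossed_end k = (k div 2, real (k mod 2))"

text \<open>
  The angles of different strings lie in disjoint intervals. A string is symmetric about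
  its innermost point, \<open>f (1 - t) = 1 - f t\<close>, so that it could meet itself only where \<open>f t = 1/2\<close>, that is,
  at this point.
\<close>

lemma uncrossed_no_meets: "\<not> meets m uncrossed_angle x y"
proof
  assume xy: "meets m uncrossed_angle x y"
  define f where "f t = smooth_step (2 * t - 1/2)" for t
  have eq: "2 * real (fst x) + f (snd x) = 2 * real (fst y) + f (snd y)"
    and ne: "x \<noteq> y" and s: "snd x = snd y \<or> snd x = 1 - snd y"
    using xy by (auto simp: meets_def uncrossed_angle_def f_def)
  have "0 \<le> f (snd x)" "f (snd x) \<le> 1" "0 \<le> f (snd y)" "f (snd y) \<le> 1"
    by (simp_all add: f_def smooth_step_bounds)
  then have i: "fst x = fst y" using eq by linarith
  then have sx: "snd x = 1 - snd y" "snd x \<noteq> snd y" using s ne by (auto simp: prod_eq_iff)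
  have "f (1 - snd y) = 1 - f (snd y)"
    using smooth_step_reflect[of "2 * snd y - 1/2"] by (simp add: f_def algebra_simps)
  then have "f (snd y) = 1/2" using eq i sx by simp
  then have "snd y = 1/2" unfolding f_def smooth_step_eq_half_iff by simp
  then show False using sx by simp
qed

lemma uncrossed_layered:
  assumes "m \<ge> 1"
  shows "layered_diagram m (1/4) uncrossed_end uncrossed_angle
           (\<lambda>i t. 2 * smooth_step_deriv (2 * t - 1/2)) {}"
proof
  show "bij_betw uncrossed_end {..<2 * m} ({..<m} \<times> {0, 1})"
    by (rule bij_betw_byWitness[where f' = "\<lambda>(i, a). if a = 0 then 2 * i else 2 * i + 1"])
       (auto simp: uncrossed_end_def mod_2_eq_odd)
  fix i t assume "i < m"
  show "(uncrossed_angle i has_real_derivative 2 * smooth_step_deriv (2 * t - 1/2)) (at t)"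
    unfolding uncrossed_angle_def[abs_def]
    by (auto intro!: derivative_eq_intros)
next
  fix i assume "i < m"
  show "continuous_on UNIV (\<lambda>t. 2 * smooth_step_deriv (2 * t - 1/2))"
    by (intro continuous_intros continuous_on_compose2[OF continuous_smooth_step_deriv]) auto
  show "2 * smooth_step_deriv (2 * (1/2) - 1/2) \<noteq> 0"
    using smooth_step_deriv_values(3) by simp
next
  fix i t assume "i < m" "t \<in> {0..1::real}"
  then have "real i \<le> real m - 1" by linarith
  then show "uncrossed_angle i t \<in> {0..2 * real m - 1}"
    using smooth_step_bounds[of "2 * t - 1/2"] by (simp add: uncrossed_angle_def)
next
  fix k u assume u: "u \<in> {0..1/4::real}"
  show "uncrossed_angle (fst (uncrossed_end k)) (snd (at_depth (uncrossed_end k) u)) = real k \<and>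
      2 * smooth_step_deriv (2 * snd (at_depth (uncrossed_end k) u) - 1/2) = 0"
  proof (cases "even k")
    case True
    then have "2 * real (k div 2) = real k" by (metis dvd_mult_div_cancel of_nat_mult of_nat_numeral)
    then show ?thesis using True u
      by (simp add: uncrossed_end_def at_depth_def uncrossed_angle_def smooth_step_values
          smooth_step_deriv_values)
  next
    case False
    then have "2 * (k div 2) + 1 = k" by presburger
    then have "2 * real (k div 2) + 1 = real k" by linarith
    moreover have "k mod 2 = 1" using False by presburger
    ultimately show ?thesis using u
      by (simp add: uncrossed_end_def at_depth_def uncrossed_angle_def smooth_step_values
          smooth_step_deriv_values)
  qed
qed (use assms in \<open>auto simp: uncrossed_no_meets\<close>)

section \<open>Colors as functions on parameters\<close>

text \<open>
  Colorings are easier to extend as functions on parameters, constant between consecutive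
  under-crossings, than as functions on arcs: a new under-crossing cuts an arc but only changes
  the values on a short end segment.
\<close>

definition colors_points ::
    "nat \<Rightarrow> (nat \<Rightarrow> real \<Rightarrow> real) \<Rightarrow> (nat \<times> real) set \<Rightarrow> (nat \<times> real \<Rightarrow> int) \<Rightarrow> bool" where
  "colors_points m \<Theta> U c \<longleftrightarrow>
     (\<forall>i s t. i < m \<and> 0 \<le> s \<and> s \<le> t \<and> t \<le> 1 \<and> {i} \<times> {s..t} \<inter> U = {} \<longrightarrow> c (i, s) = c (i, t)) \<and>
     (\<forall>i t y. meets m \<Theta> (i, t) y \<and> (i, t) \<in> U \<longrightarrow>
        (\<exists>\<epsilon>>0. \<forall>r\<in>{t - \<epsilon><..<t}. \<forall>s\<in>{t<..<t + \<epsilon>}. c (i, r) + c (i, s) = 2 * c y))"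

context layered_diagram
begin

lemma constant_on_arc:
  assumes c: "colors_points m \<Theta> U c" and A: "A \<in> arcs T" and xy: "x \<in> A" "y \<in> A"
  shows "c x = c y"
proof -
  obtain i K where K: "A = {i} \<times> K" "i < m" "K \<in> components ({0..1} - {t. (i, t) \<in> U})"
    using A by (auto simp: arcs_def)
  have con: "connected K" and sub: "K \<subseteq> {0..1} - {t. (i, t) \<in> U}"
    using K(3) by (auto dest: in_components_connected in_components_subset)
  have le: "c (i, s) = c (i, t)" if st: "s \<in> K" "t \<in> K" "s \<le> t" for s t
  proof -
    have "{s..t} \<subseteq> K" using connected_contains_Icc[OF con st(1,2)] .
    then have "{i} \<times> {s..t} \<inter> U = {}" using sub by blast
    moreover have "0 \<le> s" "t \<le> 1" using sub st by auto
    ultimately show ?thesis using c K(2) st(3) unfolding colors_points_def by blast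
  qed
  obtain s t where st: "x = (i, s)" "s \<in> K" "y = (i, t)" "t \<in> K" using K(1) xy by blast
  show ?thesis
  proof (cases "s \<le> t")
    case True
    from le[OF st(2,4) this] show ?thesis unfolding st(1,3) .
  next
    case False
    then have "t \<le> s" by simp
    from le[OF st(4,2) this] show ?thesis unfolding st(1,3) by (rule sym)
  qed
qed

lemma coloring_of_points:
  assumes c: "colors_points m \<Theta> U c"
  shows "coloring T (\<lambda>A. c (SOME x. x \<in> A))"
  unfolding coloring_def
proof (intro allI impI ballI, elim conjE exE)
  have C: "c (SOME x. x \<in> A) = c x" if "A \<in> arcs T" "x \<in> A" for A x
    using constant_on_arc[OF c that(1) someI[of "\<lambda>x. x \<in> A"] that(2)] that(2) by blast
  fix i t y X Y Z and \<epsilon>\<^sub>1 \<epsilon>\<^sub>2 :: real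
  assume "crossing_pair T (i, t) y" and tU: "(i, t) \<in> under T"
    and arcs: "X \<in> arcs T" "Y \<in> arcs T" "Z \<in> arcs T" and y: "y \<in> Y"
    and X: "0 < \<epsilon>\<^sub>1" "{i} \<times> {t - \<epsilon>\<^sub>1<..<t} \<subseteq> X" and Z: "0 < \<epsilon>\<^sub>2" "{i} \<times> {t<..<t + \<epsilon>\<^sub>2} \<subseteq> Z"
  then have "meets m \<Theta> (i, t) y" "(i, t) \<in> U" by (simp_all add: crossing_pair_iff)
  then obtain \<epsilon> where \<epsilon>: "\<epsilon> > 0"
    "\<forall>r\<in>{t - \<epsilon><..<t}. \<forall>s\<in>{t<..<t + \<epsilon>}. c (i, r) + c (i, s) = 2 * c y"
    using c unfolding colors_points_def by blast
  define r s where "r = t - min \<epsilon> \<epsilon>\<^sub>1 / 2" and "s = t + min \<epsilon> \<epsilon>\<^sub>2 / 2"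
  have rs: "r \<in> {t - \<epsilon><..<t}" "r \<in> {t - \<epsilon>\<^sub>1<..<t}" "s \<in> {t<..<t + \<epsilon>}" "s \<in> {t<..<t + \<epsilon>\<^sub>2}"
    using \<epsilon>(1) X(1) Z(1) by (auto simp: r_def s_def min_def)
  then have "c (i, r) + c (i, s) = 2 * c y" using \<epsilon>(2) by blast
  moreover have "(i, r) \<in> X" "(i, s) \<in> Z" using X(2) Z(2) rs by auto
  ultimately show "c (SOME x. x \<in> X) + c (SOME x. x \<in> Z) = 2 * c (SOME x. x \<in> Y)"
    using C arcs y by metis
qed

lemma boundary_vector_of_points:
  assumes c: "colors_points m \<Theta> U c"
  shows "boundary_vector T (\<lambda>A. c (SOME x. x \<in> A)) (map (c \<circ> e) [0..<2 * m])"
  unfolding boundary_vector_def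
proof (intro conjI exI allI impI)
  show "bij_betw e {..<2 * nstr T} (ends T)" using ends_bij by simp
next
  fix k assume k: "k < 2 * nstr T"
  then have "snd (e k) = 0 \<or> snd (e k) = 1" using end_in[of k] by auto
  then show "pt T (e k) = cis (real k / real m)"
    using k angle_end[of k] by (auto simp: polar_def radius_def rcis_def)
next
  fix k l assume kl: "k < l \<and> l < 2 * nstr T"
  then show "real k / real m < real l / real m" using m_pos by (simp add: divide_strict_right_mono)
  have "real l / real m \<le> 2" using kl m_pos by (simp add: field_simps)
  moreover have "0 \<le> real k / real m" by simp
  ultimately show "real l / real m < real k / real m + 2 * pi" using pi_gt3 by linarith
next
  fix k assume k: "k < 2 * nstr T"
  then have e: "e k \<in> ends T" using end_in by simp
  then have u: "e k \<notin> under T" by (rule end_not_under[OF is_tangle_diagram])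
  have p: "e k \<in> params T" using e by (auto simp: ends_def params_def)
  note A = arc_at_in_arcs[OF p u] arc_at_self[OF p u]
  have "c (SOME x. x \<in> arc_at T (e k)) = c (e k)"
    using constant_on_arc[OF c A(1) someI[of "\<lambda>x. x \<in> arc_at T (e k)", OF A(2)] A(2)] .
  then show "\<exists>A\<in>arcs T. e k \<in> A \<and> map (c \<circ> e) [0..<2 * m] ! k = c (SOME x. x \<in> A)"
    using A k by (intro bexI[of _ "arc_at T (e k)"]) auto
qed simp

lemma collar_not_under:
  assumes "b \<in> {..<m} \<times> {0, 1}" "u \<in> {0..\<delta>}"
  shows "at_depth b u \<notin> U"
proof
  assume "at_depth b u \<in> U"
  then obtain y where "meets m \<Theta> (at_depth b u) y" using under_meets by blast
  from meets_depth[OF this] obtain b' c u' where *: "u' \<in> {\<delta><..<1/2}" "at_depth b u = at_depth b' u'"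
    by metis
  then have "radius u = radius u'" by (metis radius_at_depth)
  then show False using * assms depth by (auto simp: radius_eq_iff)
qed

lemma collar_color:
  assumes c: "colors_points m \<Theta> U c" and b: "b \<in> {..<m} \<times> {0, 1}" and u: "u \<in> {0..\<delta>}"
  shows "c (at_depth b u) = c b"
proof -
  have const: "c (i, s) = c (i, t)"
    if "i < m" "0 \<le> s" "s \<le> t" "t \<le> 1" "{i} \<times> {s..t} \<inter> U = {}" for i s t
    using c that unfolding colors_points_def by blast
  have free: "at_depth b v \<notin> U" if "0 \<le> v" "v \<le> u" for v
    using collar_not_under[OF b, of v] that u by auto
  have i: "fst b < m" and ab: "snd b = 0 \<or> snd b = 1" using b by auto
  from ab show ?thesis
  proof
    assume 0: "snd b = 0"
    have "{fst b} \<times> {0..u} \<inter> U = {}" using free 0 by (auto simp: at_depth_def)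
    then have "c (fst b, 0) = c (fst b, u)" using u i depth by (intro const) auto
    moreover have "b = (fst b, 0)" using 0 by (simp add: prod_eq_iff)
    ultimately show ?thesis using 0 by (metis at_depth_def)
  next
    assume 1: "snd b = 1"
    have "(fst b, t) \<notin> U" if "1 - u \<le> t" "t \<le> 1" for t
      using free[of "1 - t"] 1 that by (auto simp: at_depth_def)
    then have "{fst b} \<times> {1 - u..1} \<inter> U = {}" by auto
    then have "c (fst b, 1 - u) = c (fst b, 1)" using u i depth by (intro const) auto
    moreover have "b = (fst b, 1)" using 1 by (simp add: prod_eq_iff)
    moreover have "at_depth b u = (fst b, 1 - u)" using 1 by (simp add: at_depth_def)
    ultimately show ?thesis by metis
  qed
qed

end

context end_swap
begin

lemma virtual_swap_colors:
  assumes "V = {}" "colors_points m \<Theta> U c"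
  shows "colors_points m \<Theta>\<^sub>2 (U \<union> V) c"
  using assms new_not_under unfolding colors_points_def swapped_meets_iff by auto

text \<open>
  Only the segment between the end \<open>b\<close> and the new under-crossing is recolored. Old crossings lie deeper
  than the collar, so their relations hold as before on sufficiently short intervals.
\<close>

lemma classical_swap_colors:
  assumes c: "colors_points m \<Theta> U c"
    and b: "b = p \<and> b' = q \<or> b = q \<and> b' = p" and V': "V = {at_depth b u\<^sub>0}"
    and a: "a = 2 * c b' - c b"
  shows "colors_points m \<Theta>\<^sub>2 (U \<union> V) (\<lambda>x. if x \<in> at_depth b ` {0..<u\<^sub>0} then a else c x)"
proof -
  let ?B = "at_depth b ` {0..<u\<^sub>0}"
  let ?c = "\<lambda>x. if x \<in> ?B then a else c x"
  have be: "b \<in> {..<m} \<times> {0, 1}" "b' \<in> {..<m} \<times> {0, 1}" "b \<noteq> b'" using b ends_k by auto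
  then have b01: "snd b = 0 \<or> snd b = 1" by auto
  have B0: "(i, t) \<in> ?B \<longleftrightarrow> i = fst b \<and> 0 \<le> t \<and> t < u\<^sub>0" if "snd b = 0" for i t
    using that by (auto simp: at_depth_def)
  have B1: "(i, t) \<in> ?B \<longleftrightarrow> i = fst b \<and> 1 - u\<^sub>0 < t \<and> t \<le> 1" if "snd b = 1" for i t
  proof
    assume "(i, t) \<in> ?B"
    then show "i = fst b \<and> 1 - u\<^sub>0 < t \<and> t \<le> 1" using that by (auto simp: at_depth_def)
  next
    assume "i = fst b \<and> 1 - u\<^sub>0 < t \<and> t \<le> 1"
    then show "(i, t) \<in> ?B" using that by (intro image_eqI[of _ _ "1 - t"]) (auto simp: at_depth_def)
  qed
  have middle: "(i, t) \<notin> ?B" if "\<delta> \<le> t" "t \<le> 1 - \<delta>" for i t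
    using b01
  proof
    assume 0: "snd b = 0"
    show ?thesis unfolding B0[OF 0] using that depth by auto
  next
    assume 1: "snd b = 1"
    show ?thesis unfolding B1[OF 1] using that depth by auto
  qed
  have const: "?c (i, s) = ?c (i, t)"
    if st: "i < m" "0 \<le> s" "s \<le> t" "t \<le> 1" "{i} \<times> {s..t} \<inter> (U \<union> V) = {}" for i s t
  proof -
    have "c (i, s) = c (i, t)" using c st unfolding colors_points_def by blast
    moreover have "(i, s) \<in> ?B \<longleftrightarrow> (i, t) \<in> ?B"
    proof -
      have nin: "at_depth b u\<^sub>0 \<notin> {i} \<times> {s..t}" using st(5) V' by auto
      from b01 show ?thesis
      proof
        assume 0: "snd b = 0"
        then have "at_depth b u\<^sub>0 = (fst b, u\<^sub>0)" by (simp add: at_depth_def)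
        then show ?thesis using nin st unfolding B0[OF 0] by auto
      next
        assume 1: "snd b = 1"
        then have "at_depth b u\<^sub>0 = (fst b, 1 - u\<^sub>0)" by (simp add: at_depth_def)
        then show ?thesis using nin st unfolding B1[OF 1] by auto
      qed
    qed
    ultimately show ?thesis by simp
  qed
  have rel: "\<exists>\<epsilon>>0. \<forall>r\<in>{t - \<epsilon><..<t}. \<forall>s\<in>{t<..<t + \<epsilon>}. ?c (i, r) + ?c (i, s) = 2 * ?c y"
    if my: "meets m \<Theta>\<^sub>2 (i, t) y" and iU: "(i, t) \<in> U \<union> V" for i t y
  proof (cases "meets m \<Theta> (i, t) y")
    case True
    have "(i, t) \<notin> V"
    proof
      assume "(i, t) \<in> V"
      then have "(i, t) = x\<^sub>0 \<or> (i, t) = y\<^sub>0" using V' b by auto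
      then show False using True new_not_old by metis
    qed
    with iU True c obtain \<epsilon> where \<epsilon>: "\<epsilon> > 0"
      "\<forall>r\<in>{t - \<epsilon><..<t}. \<forall>s\<in>{t<..<t + \<epsilon>}. c (i, r) + c (i, s) = 2 * c y"
      unfolding colors_points_def by blast
    from meets_depth[OF True] obtain b1 b2 u where u: "u \<in> {\<delta><..<1/2}"
      "(i, t) = at_depth b1 u" "y = at_depth b2 u" by metis
    have t: "\<delta> < t" "t < 1 - \<delta>" and y: "\<delta> < snd y" "snd y < 1 - \<delta>"
      using u depth by (auto simp: at_depth_def split: if_splits)
    have cy: "?c y = c y" using middle[of "snd y" "fst y"] y by simp
    define \<mu> where "\<mu> = min \<epsilon> (min (t - \<delta>) (1 - \<delta> - t))"
    have \<mu>: "0 < \<mu>" "\<mu> \<le> \<epsilon>" "\<mu> \<le> t - \<delta>" "\<mu> \<le> 1 - \<delta> - t" using \<epsilon>(1) t by (simp_all add: \<mu>_def)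
    show ?thesis
    proof (intro exI[of _ \<mu>] conjI ballI)
      fix r s assume r: "r \<in> {t - \<mu><..<t}" and s: "s \<in> {t<..<t + \<mu>}"
      have "(i, r) \<notin> ?B" "(i, s) \<notin> ?B" using r s \<mu> by (intro middle; simp)+
      moreover have "r \<in> {t - \<epsilon><..<t}" "s \<in> {t<..<t + \<epsilon>}" using r s \<mu> by auto
      ultimately show "?c (i, r) + ?c (i, s) = 2 * ?c y" using \<epsilon>(2) cy by simp
    qed (rule \<mu>(1))
  next
    case False
    then have xy: "(i, t) = at_depth b u\<^sub>0" "y = at_depth b' u\<^sub>0"
    proof -
      have "(i, t) = x\<^sub>0 \<and> y = y\<^sub>0 \<or> (i, t) = y\<^sub>0 \<and> y = x\<^sub>0"
        using my False unfolding swapped_meets_iff by blast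
      moreover from this have "(i, t) \<notin> U" using new_not_under by metis
      then have "(i, t) = at_depth b u\<^sub>0" using iU V' by blast
      ultimately show "(i, t) = at_depth b u\<^sub>0" "y = at_depth b' u\<^sub>0"
        using b x\<^sub>0_neq_y\<^sub>0 by metis+
    qed
    have "y \<notin> ?B"
    proof
      assume "y \<in> ?B"
      then obtain u where "u \<in> {0..<u\<^sub>0}" "at_depth b' u\<^sub>0 = at_depth b u" using xy by auto
      then show False using at_depth_inj[OF be(2,1), of u\<^sub>0 u] be(3) depth by auto
    qed
    then have cy: "?c y = c b'" using collar_color[OF c be(2) u\<^sub>0_depth(1)] xy by simp
    have cb: "c (at_depth b u) = c b" if "u \<in> {0..\<delta>}" for u
      by (rule collar_color[OF c be(1) that])
    show ?thesis
    proof (intro exI[of _ "\<delta> / 4"] conjI ballI)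
      show "0 < \<delta> / 4" using depth by simp
      fix r s assume r: "r \<in> {t - \<delta> / 4<..<t}" and s: "s \<in> {t<..<t + \<delta> / 4}"
      from b01 show "?c (i, r) + ?c (i, s) = 2 * ?c y"
      proof
        assume 0: "snd b = 0"
        then have t: "t = u\<^sub>0" "i = fst b" using xy by (simp_all add: at_depth_def)
        have "(i, r) \<in> ?B" "(i, s) \<notin> ?B" unfolding B0[OF 0] using r s t depth by auto
        moreover have "(i, s) = at_depth b s" using 0 t by (simp add: at_depth_def)
        then have "c (i, s) = c b" using cb[of s] s t depth by auto
        ultimately show ?thesis using cy a by simp
      next
        assume 1: "snd b = 1"
        then have t: "t = 1 - u\<^sub>0" "i = fst b" using xy by (simp_all add: at_depth_def)
        have "(i, s) \<in> ?B" "(i, r) \<notin> ?B" unfolding B1[OF 1] using r s t depth by auto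
        moreover have "(i, r) = at_depth b (1 - r)" using 1 t by (simp add: at_depth_def)
        then have "c (i, r) = c b" using cb[of "1 - r"] r t depth by auto
        ultimately show ?thesis using cy a by simp
      qed
    qed
  qed
  show ?thesis
    unfolding colors_points_def using const rel by blast
qed

lemma swapped_P3: "P3 T \<Longrightarrow> P3 T\<^sub>2"
  unfolding P3_def using swapped_step by (meson converse_rtranclp_into_rtranclp)

lemma swapped_virtual_count:
  assumes "finite (virtual_crossings T)" "card (virtual_crossings T) \<le> n"
  shows "finite (virtual_crossings T\<^sub>2)"
    "card (virtual_crossings T\<^sub>2) \<le> (if V = {} then Suc n else n)"
proof -
  let ?N = "if V = {} then {pt T\<^sub>2 x\<^sub>0} else {}"
  have fin: "finite (virtual_crossings T \<union> ?N)" using assms by simp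
  show "finite (virtual_crossings T\<^sub>2)" by (rule finite_subset[OF swapped_virtual_crossings fin])
  have "card (virtual_crossings T\<^sub>2) \<le> card (virtual_crossings T \<union> ?N)"
    by (rule card_mono[OF fin swapped_virtual_crossings])
  also have "\<dots> \<le> card (virtual_crossings T) + card ?N" by (rule card_Un_le)
  also have "\<dots> \<le> (if V = {} then Suc n else n)" using assms(2) by simp
  finally show "card (virtual_crossings T\<^sub>2) \<le> (if V = {} then Suc n else n)" .
qed

end

section \<open>Realizing integer vectors\<close>

text \<open>
  What is preserved when a diagram is built crossing by crossing, with \<open>n\<close> counting the virtual ones.
  The positions \<open>0, \<dots>, 2 * m - 1\<close> of the ends give the order of the entries.
\<close>

definition realizable :: "nat \<Rightarrow> nat \<Rightarrow> int list \<Rightarrow> bool" where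
  "realizable m n v \<longleftrightarrow> (\<exists>\<delta> e \<Theta> \<Theta>' U c.
     layered_diagram m \<delta> e \<Theta> \<Theta>' U \<and> colors_points m \<Theta> U c \<and> v = map (c \<circ> e) [0..<2 * m] \<and>
     P3 (polar_diagram m \<Theta> U) \<and> finite (virtual_crossings (polar_diagram m \<Theta> U)) \<and>
     card (virtual_crossings (polar_diagram m \<Theta> U)) \<le> n)"

lemma list_update_adjacent:
  "(u @ a # b # w)[length u := x, Suc (length u) := y] = u @ x # y # w"
  by (simp add: list_update_append)

text \<open>
  The three kinds of crossings between the ends of \<open>a\<close> and \<open>b\<close>: virtual, with \<open>a\<close> passing under, and
  with \<open>b\<close> passing under. The strand passing under is the recolored one.
\<close>

lemma realizable_swap:
  assumes "realizable m n (u @ a # b # w)"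
  shows "realizable m (Suc n) (u @ b # a # w)"
    "realizable m n (u @ b # (2 * b - a) # w)"
    "realizable m n (u @ (2 * a - b) # a # w)"
proof -
  obtain \<delta> e \<Theta> \<Theta>' U c where L: "layered_diagram m \<delta> e \<Theta> \<Theta>' U" and c: "colors_points m \<Theta> U c"
    and v: "u @ a # b # w = map (c \<circ> e) [0..<2 * m]"
    and D: "P3 (polar_diagram m \<Theta> U)" "finite (virtual_crossings (polar_diagram m \<Theta> U))"
      "card (virtual_crossings (polar_diagram m \<Theta> U)) \<le> n"
    using assms unfolding realizable_def by blast
  define k where "k = length u"
  define \<tau> where "\<tau> = Transposition.transpose k (Suc k)"
  have len: "length (u @ a # b # w) = 2 * m" unfolding v by simp
  then have k: "Suc k < 2 * m" by (simp add: k_def)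
  have nth: "(u @ a # b # w) ! l = c (e l)" if "l < 2 * m" for l unfolding v using that by simp
  have ab: "a = c (e k)" "b = c (e (Suc k))"
    using nth[of k] nth[of "Suc k"] k by (auto simp: k_def nth_append)
  have swapI: "realizable m n' (u @ c' (e (Suc k)) # c' (e k) # w)"
    if V: "V = {} \<or> V = {at_depth (e k) (3 * \<delta> / 4)} \<or> V = {at_depth (e (Suc k)) (3 * \<delta> / 4)}"
      and c': "colors_points m (swapped_angle \<delta> e k \<Theta>) (U \<union> V) c'"
      and same: "\<And>l. l < 2 * m \<Longrightarrow> l \<noteq> k \<Longrightarrow> l \<noteq> Suc k \<Longrightarrow> c' (e l) = c (e l)"
      and n': "n' = (if V = {} then Suc n else n)" for V c' n'
  proof -
    interpret layered_diagram m \<delta> e \<Theta> \<Theta>' U by (rule L)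
    interpret end_swap m \<delta> e \<Theta> \<Theta>' U k V by unfold_locales (use k V in auto)
    have "u @ c' (e (Suc k)) # c' (e k) # w = map (c' \<circ> e\<^sub>2) [0..<2 * m]"
    proof (rule nth_equalityI)
      show "length (u @ c' (e (Suc k)) # c' (e k) # w) = length (map (c' \<circ> e\<^sub>2) [0..<2 * m])"
        using len by simp
      fix l assume "l < length (u @ c' (e (Suc k)) # c' (e k) # w)"
      then have l: "l < 2 * m" using len by simp
      have "(u @ c' (e (Suc k)) # c' (e k) # w) ! l
          = (u @ a # b # w)[k := c' (e (Suc k)), Suc k := c' (e k)] ! l"
        unfolding k_def list_update_adjacent ..
      also have "\<dots> = c' (e\<^sub>2 l)"
        using l len k same[OF l] nth[OF l]
        by (auto simp: nth_list_update Transposition.transpose_def)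
      finally show "(u @ c' (e (Suc k)) # c' (e k) # w) ! l = map (c' \<circ> e\<^sub>2) [0..<2 * m] ! l"
        using l by simp
    qed
    with swapped_layered c' swapped_P3[OF D(1)] swapped_virtual_count[OF D(2,3)] n'
    show ?thesis unfolding realizable_def by blast
  qed
  interpret layered_diagram m \<delta> e \<Theta> \<Theta>' U by (rule L)
  show "realizable m (Suc n) (u @ b # a # w)"
  proof -
    interpret end_swap m \<delta> e \<Theta> \<Theta>' U k "{}" by unfold_locales (use k in auto)
    show ?thesis using swapI[OF _ virtual_swap_colors[OF refl c]] unfolding ab by auto
  qed
  have e_notin: "e l \<notin> at_depth b ` {0..<3 * \<delta> / 4}"
    if l: "l < 2 * m" and b: "b \<in> {..<m} \<times> {0, 1}" "e l \<noteq> b" for l b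
  proof
    assume "e l \<in> at_depth b ` {0..<3 * \<delta> / 4}"
    then obtain u where "u \<in> {0..<3 * \<delta> / 4}" "at_depth (e l) 0 = at_depth b u"
      using end_in[OF l] by auto
    then show False using at_depth_inj[OF end_in[OF l] b(1), of 0 u] b(2) depth by auto
  qed
  have e_in: "b \<in> at_depth b ` {0..<3 * \<delta> / 4}" if "b \<in> {..<m} \<times> {0, 1}" for b
    using that depth by (intro image_eqI[of _ _ 0]) auto
  show "realizable m n (u @ b # (2 * b - a) # w)"
  proof -
    interpret end_swap m \<delta> e \<Theta> \<Theta>' U k "{at_depth (e k) (3 * \<delta> / 4)}" by unfold_locales (use k in auto)
    let ?c = "\<lambda>x. if x \<in> at_depth (e k) ` {0..<u\<^sub>0} then 2 * c (e (Suc k)) - c (e k) else c x"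
    have "realizable m n (u @ ?c (e (Suc k)) # ?c (e k) # w)"
    proof (rule swapI)
      show "colors_points m \<Theta>\<^sub>2 (U \<union> {at_depth (e k) u\<^sub>0}) ?c"
        by (rule classical_swap_colors[OF c, of _ "e (Suc k)"]) auto
      show "?c (e l) = c (e l)" if "l < 2 * m" "l \<noteq> k" "l \<noteq> Suc k" for l
        using e_notin[OF that(1) ends_k(1)] that k end_eq_iff[of l k] by simp
    qed auto
    moreover have "?c (e (Suc k)) = b" using e_notin[OF k ends_k(1)] ends_k(3) ab by auto
    moreover have "?c (e k) = 2 * b - a" using e_in[OF ends_k(1)] ab by simp
    ultimately show ?thesis by simp
  qed
  show "realizable m n (u @ (2 * a - b) # a # w)"
  proof -
    interpret end_swap m \<delta> e \<Theta> \<Theta>' U k "{at_depth (e (Suc k)) (3 * \<delta> / 4)}"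
      by unfold_locales (use k in auto)
    let ?c = "\<lambda>x. if x \<in> at_depth (e (Suc k)) ` {0..<u\<^sub>0} then 2 * c (e k) - c (e (Suc k)) else c x"
    have "realizable m n (u @ ?c (e (Suc k)) # ?c (e k) # w)"
    proof (rule swapI)
      show "colors_points m \<Theta>\<^sub>2 (U \<union> {at_depth (e (Suc k)) u\<^sub>0}) ?c"
        by (rule classical_swap_colors[OF c, of _ "e k"]) auto
      show "?c (e l) = c (e l)" if "l < 2 * m" "l \<noteq> k" "l \<noteq> Suc k" for l
        using e_notin[OF that(1) ends_k(2)] that k end_eq_iff[of l "Suc k"] by simp
    qed auto
    moreover have "?c (e k) = a" using e_notin[OF _ ends_k(2), of k] k ends_k(3) ab by auto
    moreover have "?c (e (Suc k)) = 2 * a - b" using e_in[OF ends_k(2)] ab by simp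
    ultimately show ?thesis by simp
  qed
qed

lemma realizable_braid_equiv:
  assumes "v \<bowtie> w" "realizable m n v"
  shows "realizable m n w"
  using assms
proof (induction rule: rtranclp_induct)
  case (step y z)
  then have "realizable m n y" by blast
  with step(2) show ?case by cases (use realizable_swap in blast)+
qed

lemma doubled_eq_map: "doubled cs = map (\<lambda>k. cs ! (k div 2)) [0..<2 * length cs]"
proof (induction cs)
  case (Cons c cs)
  have "[0..<2 * length (c # cs)] = 0 # 1 # map (\<lambda>k. Suc (Suc k)) [0..<2 * length cs]"
    by (simp add: upt_conv_Cons map_Suc_upt del: upt_Suc flip: map_map[unfolded o_def])
  then show ?case by (simp add: Cons.IH o_def)
qed simp

lemma realizable_doubled:
  assumes "m \<ge> 1" "length cs = m"
  shows "realizable m 0 (doubled cs)"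
proof -
  interpret layered_diagram m "1/4" uncrossed_end uncrossed_angle
    "\<lambda>i t. 2 * smooth_step_deriv (2 * t - 1/2)" "{}"
    by (rule uncrossed_layered[OF assms(1)])
  have nc: "\<not> crossing_pair T x y" for x y by (simp add: crossing_pair_iff uncrossed_no_meets)
  then have "trivial_diagram T" using is_tangle_diagram by (simp add: trivial_diagram_def)
  then have "P3 T" unfolding P3_def by blast
  moreover have "virtual_crossings T = {}" using nc by (auto simp: virtual_crossings_def)
  moreover have "colors_points m uncrossed_angle {} (\<lambda>x. cs ! fst x)"
    by (simp add: colors_points_def)
  moreover have "doubled cs = map ((\<lambda>x. cs ! fst x) \<circ> uncrossed_end) [0..<2 * m]"
    using assms(2) by (simp add: doubled_eq_map uncrossed_end_def)
  ultimately show ?thesis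
    unfolding realizable_def using layered_diagram_axioms by fastforce
qed

lemma realizable_imp_diagram:
  assumes "realizable m n v"
  shows "\<exists>T C. colored_diagram_with_boundary m T C v \<and> P3 T \<and>
           finite (virtual_crossings T) \<and> card (virtual_crossings T) \<le> n"
proof -
  obtain \<delta> e \<Theta> \<Theta>' U c where L: "layered_diagram m \<delta> e \<Theta> \<Theta>' U" and c: "colors_points m \<Theta> U c"
    and v: "v = map (c \<circ> e) [0..<2 * m]"
    and D: "P3 (polar_diagram m \<Theta> U)" "finite (virtual_crossings (polar_diagram m \<Theta> U))"
      "card (virtual_crossings (polar_diagram m \<Theta> U)) \<le> n"
    using assms unfolding realizable_def by blast
  interpret layered_diagram m \<delta> e \<Theta> \<Theta>' U by (rule L)
  have "colored_diagram_with_boundary m T (\<lambda>A. c (SOME x. x \<in> A)) v"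
    unfolding colored_diagram_with_boundary_def v
    using is_tangle_diagram coloring_of_points[OF c] boundary_vector_of_points[OF c] by simp
  with D show ?thesis by blast
qed

lemma trivial_vec_eq_doubled:
  assumes "trivial_vec v" "length v = 2 * m"
  shows "v = doubled (replicate m (v ! 0))"
proof (rule nth_equalityI)
  show "length v = length (doubled (replicate m (v ! 0)))" using assms by (simp add: doubled_eq_map)
  fix i assume i: "i < length v"
  then have "0 < length v" by linarith
  then have "v ! i = v ! 0" using assms(1) i unfolding trivial_vec_def by blast
  moreover have "doubled (replicate m (v ! 0)) ! i = v ! 0" using i assms(2) by (simp add: doubled_eq_map)
  ultimately show "v ! i = doubled (replicate m (v ! 0)) ! i" by simp
qed

text \<open>
  Read backwards, the reduction of \<open>v\<close> builds the diagram from inside out: first the classical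
  crossings that produce \<open>u @ b # a # w\<close> from uncrossed strings, then the virtual crossing, then the
  remaining classical crossings.
\<close>

lemma even_Delta_realizable:
  assumes "m \<ge> 2" "length v = 2 * m" "\<not> trivial_vec v" "2 * gcd_diff v dvd Delta v"
  shows "realizable m 1 v"
proof -
  have "length v \<ge> 3" using assms by simp
  from one_swap_kills_Delta[OF this assms(3,4)] obtain u a b w
    where vu: "v \<bowtie> u @ a # b # w" and D0: "Delta (u @ b # a # w) = 0" .
  have "length (u @ b # a # w) = 2 * m" using braid_equiv_length[OF vu] assms(2) by simp
  from Delta_zero_reduces_to_doubled[OF this D0] obtain cs
    where cs: "length cs = m" "u @ b # a # w \<bowtie> doubled cs" by blast
  have "realizable m 0 (doubled cs)" using assms cs by (intro realizable_doubled) auto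
  then have "realizable m 0 (u @ b # a # w)"
    by (rule realizable_braid_equiv[OF braid_equiv_sym[OF cs(2)]])
  then have "realizable m 1 (u @ a # b # w)" using realizable_swap(1) by fastforce
  then show ?thesis by (rule realizable_braid_equiv[OF braid_equiv_sym[OF vu]])
qed

text \<open>
  For two entries, \<open>gcd_diff v\<close> and \<open>Delta v\<close> are both \<open>a - b\<close> up to sign.
\<close>

lemma two_entries_trivial:
  assumes "length v = 2" "2 * gcd_diff v dvd Delta v"
  shows "trivial_vec v"
proof -
  obtain a b where v: "v = [a, b]" using assms(1) by (auto simp: length_Suc_conv numeral_2_eq_2)
  have "congruent_entries (a - b) v"
    using v by (auto simp: congruent_entries_def dvd_diff_commute)
  then have "a - b dvd gcd_diff v" by (rule dvd_gcd_diff)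
  then have "2 * (a - b) dvd a - b"
    using assms(2) v by (metis Delta_Cons Delta_Nil diff_zero dvd_trans mult_dvd_mono dvd_refl)
  then obtain j where "a - b = 2 * (a - b) * j" by blast
  then have "(a - b) * (1 - 2 * j) = 0" by (simp add: algebra_simps)
  moreover have "1 - 2 * j \<noteq> 0" by presburger
  ultimately have "a = b" by simp
  then show ?thesis using v by (auto simp: trivial_vec_def less_Suc_eq)
qed

theorem theorem1p2:
  fixes m :: nat
  assumes "m \<ge> 1"
  shows
    "(\<forall>v :: int list. length v = 2 * m \<longrightarrow>
        ((\<exists>T C. colored_diagram_with_boundary m T C v) \<longleftrightarrow>
         (trivial_vec v \<or> (\<not> trivial_vec v \<and> 2 ^ (two_exponent v + 1) dvd Delta v)))) \<and>
     (m \<ge> 2 \<longrightarrow>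
        (\<forall>v :: int list. length v = 2 * m \<and>
           (trivial_vec v \<or> (\<not> trivial_vec v \<and> 2 ^ (two_exponent v + 1) dvd Delta v)) \<longrightarrow>
           (\<exists>T C. colored_diagram_with_boundary m T C v \<and> P2 T \<and> P3 T))) \<and>
     (m = 1 \<longrightarrow>
        (\<forall>v T C. colored_diagram_with_boundary m T C v \<longrightarrow> trivial_vec v))"
proof -
  have necessary: "trivial_vec v \<or> (\<not> trivial_vec v \<and> 2 ^ (two_exponent v + 1) dvd Delta v)"
    if "colored_diagram_with_boundary m T C v" for v T C
    using boundary_vector_Delta[OF that] by blast
  have one: "trivial_vec v"
    if "m = 1" "length v = 2 * m"
      "trivial_vec v \<or> (\<not> trivial_vec v \<and> 2 ^ (two_exponent v + 1) dvd Delta v)" for v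
    using that two_exponent_dvd_iff[of v m] two_entries_trivial[of v] by auto
  have "realizable m 1 v"
    if v: "length v = 2 * m"
      "trivial_vec v \<or> (\<not> trivial_vec v \<and> 2 ^ (two_exponent v + 1) dvd Delta v)" for v
  proof (cases "trivial_vec v")
    case True
    have "realizable m 0 v"
      using realizable_doubled[OF assms, of "replicate m (v ! 0)"] trivial_vec_eq_doubled[OF True v(1)]
      by simp
    then show ?thesis unfolding realizable_def by force
  next
    case False
    then have "m \<ge> 2" using one[OF _ v] assms by (cases "m = 1") auto
    then show ?thesis
      using False v two_exponent_dvd_iff[OF False v(1)] by (intro even_Delta_realizable) auto
  qed
  then have sufficient: "\<exists>T C. colored_diagram_with_boundary m T C v \<and> P2 T \<and> P3 T"
    if "length v = 2 * m"
      "trivial_vec v \<or> (\<not> trivial_vec v \<and> 2 ^ (two_exponent v + 1) dvd Delta v)" for v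
    using realizable_imp_diagram[of m 1 v] that unfolding P2_def by blast
  have "length v = 2 * m" if "colored_diagram_with_boundary m T C v" for v T C
    using that by (auto simp: colored_diagram_with_boundary_def boundary_vector_def)
  then show ?thesis using necessary sufficient one by blast
qed

end
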